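(* Let $T>0$, $0<\eta<T$, $2<\alpha\le 3$, $\beta_0=0$, $0<\beta_1\le 1$, $1<\beta_2\le 2$, and let $a_i,b_i,\lambda_i\in\mathbb{R}$ ($i=0,1,2$) satisfy $$a_0+b_0\neq 0,\qquad a_1\eta^{1-\beta_1}+b_1T^{1-\beta_1}\neq 0,\qquad a_i\eta^{2-\beta_i}+b_iT^{2-\beta_i}\neq 0\ \ (i=1,2).$$ Let $f:[0,T]\times\mathbb{R}^3\to\mathbb{R}$ and $g_0,g_1,g_2:[0,T]\times\mathbb{R}\to\mathbb{R}$ be continuous. Assume: (1) There exist non-decreasing functions $\varphi:[0,\infty)\to[0,\infty)$ and $\psi_i:[0,\infty)\to[0,\infty)$ ($i=0,1,2$), a number $\tau\in(0,\min(1,\alpha-\beta_2))$, and functions $l_f\in L^{1/\tau}([0,T];\mathbb{R}^+)$, $l_{g_i}\in L^1([0,T];\mathbb{R}^+)$ ($i=0,1,2$) such that $$|f(t,u,v,w)|\le l_f(t)\,\varphi(|u|+|v|+|w|),\qquad |g_i(t,u)|\le l_{g_i}(t)\,\psi_i(|u|),\quad i=0,1,2,$$ for all $t\in[0,T]$ and $u,v,w\in\mathbb{R}$. (2) There exists a constant $K>0$ such that $$\frac{K}{\varphi(K)\,\|l_f\|_{1/\tau}\,(\Delta_0+\Delta_1+\Delta_2)+\sum_{i=0}^{2}(\rho_i+\widetilde\rho_i+\widehat\rho_i)\,|\lambda_i|\,\psi_i(K)\,\|l_{g_i}\|_1}>1,$$ where the constants $\Delta_i,\rho_i,\widetilde\rho_i,\widehat\rho_i$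 are those defined in the context. Then the boundary value problem $$\mathfrak{D}_{0^+}^{\alpha}u(t)=f\big(t,u(t),\mathfrak{D}_{0^+}^{\beta_1}u(t),\mathfrak{D}_{0^+}^{\beta_2}u(t)\big),\qquad 0\le t\le T,$$ $$a_0u(0)+b_0u(T)=\lambda_0\int_0^T g_0(s,u(s))\,ds,$$ $$a_1\mathfrak{D}_{0^+}^{\beta_1}u(\eta)+b_1\mathfrak{D}_{0^+}^{\beta_1}u(T)=\lambda_1\int_0^T g_1(s,u(s))\,ds,$$ $$a_2\mathfrak{D}_{0^+}^{\beta_2}u(\eta)+b_2\mathfrak{D}_{0^+}^{\beta_2}u(T)=\lambda_2\int_0^T g_2(s,u(s))\,ds$$ has at least one solution on $[0,T]$.
   Context: $\mathbb{R}^+$ denotes the nonnegative reals; $\|\cdot\|_{p}$ is the norm of $L^p([0,T])$. Riemann–Liouville integral: for $\gamma>0$ and continuous $h$, $I_{0^+}^{\gamma}h(t)=\frac{1}{\Gamma(\gamma)}\int_0^t(t-s)^{\gamma-1}h(s)\,ds$. Caputo derivative: for $\gamma>0$ and $n=\lceil\gamma\rceil$, an $n$-times continuously differentiable $u$ on $[0,T]$ has $\mathfrak{D}_{0^+}^{\gamma}u(t)=\frac{1}{\Gamma(n-\gamma)}\int_0^t(t-s)^{n-\gamma-1}u^{(n)}(s)\,ds$ if $n-1<\gamma<n$, and $\mathfrak{D}_{0^+}^{\gamma}u=u^{(n)}$ if $\gamma=n$. Meaning of the equation: for $2<\alpha\le3$ and continuous $h$ on $[0,T]$, "$\mathfrak{D}_{0^+}^{\alpha}u=h$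 on $[0,T]$" means that $u(t)=I_{0^+}^{\alpha}h(t)-k_0-k_1t-k_2t^2$ for all $t\in[0,T]$, for some constants $k_0,k_1,k_2\in\mathbb{R}$; such $u$ are twice continuously differentiable. A solution of the boundary value problem is a twice continuously differentiable $u:[0,T]\to\mathbb{R}$ satisfying the equation in this sense with $h(t)=f(t,u(t),\mathfrak{D}_{0^+}^{\beta_1}u(t),\mathfrak{D}_{0^+}^{\beta_2}u(t))$, together with the three boundary conditions. Constants (superscripts on $\mu,\nu$ are labels, not powers): $$\mu^{\beta_1}=\frac{\Gamma(3-\beta_1)}{2(a_1\eta^{2-\beta_1}+b_1T^{2-\beta_1})},\quad \mu^{\beta_2}=\frac{\Gamma(3-\beta_2)}{2(a_2\eta^{2-\beta_2}+b_2T^{2-\beta_2})},\quad \nu^{\beta_1}=\frac{\Gamma(2-\beta_1)}{a_1\eta^{1-\beta_1}+b_1T^{1-\beta_1}},$$ $$\rho_0=\frac{1}{|a_0+b_0|},\qquad \rho_1=|\nu^{\beta_1}|\Big(\frac{|b_0|}{|a_0+b_0|}+1\Big)T,$$ $$\rho_2=\frac{|b_0||\mu^{\beta_2}|}{|a_0+b_0|}T^2+\frac{|b_0||\nu^{\beta_1}|}{|a_0+b_0|}\frac{|\mu^{\beta_2}|}{|\mu^{\beta_1}|}T+\frac{|\nu^{\beta_1}||\mu^{\beta_2}|}{|\mu^{\beta_1}|}T+|\mu^{\beta_2}|T^2,$$ $$\widetilde\rho_0=0,\qquad \widetilde\rho_1=\frac{|\nu^{\beta_1}|T^{1-\beta_1}}{\Gamma(2-\beta_1)},\qquad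 \widetilde\rho_2=\frac{|\mu^{\beta_2}||\nu^{\beta_1}|T^{1-\beta_1}}{|\mu^{\beta_1}|\Gamma(2-\beta_1)}+2\frac{|\mu^{\beta_2}|T^{2-\beta_1}}{\Gamma(3-\beta_1)},$$ $$\widehat\rho_0=\widehat\rho_1=0,\qquad \widehat\rho_2=2\frac{|\mu^{\beta_2}|T^{2-\beta_2}}{\Gamma(3-\beta_2)},$$ $$\Delta_0=\frac{T^{\alpha-\tau}}{\Gamma(\alpha)}\Big(\frac{1-\tau}{\alpha-\tau}\Big)^{1-\tau}+\sum_{i=0}^{2}\rho_i\Big(|b_i|\frac{T^{\alpha-\beta_i-\tau}}{\Gamma(\alpha-\beta_i)}+|a_i|\frac{\eta^{\alpha-\beta_i-\tau}}{\Gamma(\alpha-\beta_i)}\Big)\Big(\frac{1-\tau}{\alpha-\beta_i-\tau}\Big)^{1-\tau},$$ $$\Delta_1=\frac{T^{\alpha-\beta_1-\tau}}{\Gamma(\alpha-\beta_1)}\Big(\frac{1-\tau}{\alpha-\beta_1-\tau}\Big)^{1-\tau}+\sum_{i=1}^{2}\widetilde\rho_i\Big(|b_i|\frac{T^{\alpha-\beta_i-\tau}}{\Gamma(\alpha-\beta_i)}+|a_i|\frac{\eta^{\alpha-\beta_i-\tau}}{\Gamma(\alpha-\beta_i)}\Big)\Big(\frac{1-\tau}{\alpha-\beta_i-\tau}\Big)^{1-\tau},$$ $$\Delta_2=\frac{T^{\alpha-\beta_2-\tau}}{\Gamma(\alpha-\beta_2)}\Big(\frac{1-\tau}{\alpha-\beta_2-\tau}\Big)^{1-\tau}+\widehat\rho_2\Big(|b_2|\frac{T^{\alpha-\beta_2-\tau}}{\Gamma(\alpha-\beta_2)}+|a_2|\frac{\eta^{\alpha-\beta_2-\tau}}{\Gamma(\alpha-\beta_2)}\Big)\Big(\frac{1-\tau}{\alpha-\beta_2-\tau}\Big)^{1-\tau}.$$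 *)

theory Defs
  imports "HOL-Analysis.Analysis"
begin

text \<open>Functions on the interval \<open>[0,T]\<close> are represented by total functions on the reals, of which only
  the values on \<open>{0..T}\<close> matter. Derivatives are therefore taken within \<open>{0..T}\<close>, that is, they are
  one-sided at the end points.\<close>

primrec nderiv_on :: "real set \<Rightarrow> nat \<Rightarrow> (real \<Rightarrow> real) \<Rightarrow> real \<Rightarrow> real" where
  "nderiv_on S 0 u = u"
| "nderiv_on S (Suc n) u = (\<lambda>t. vector_derivative (nderiv_on S n u) (at t within S))"

definition C_k_on :: "nat \<Rightarrow> real set \<Rightarrow> (real \<Rightarrow> real) \<Rightarrow> bool" where
  "C_k_on n S u \<longleftrightarrow>
     (\<forall>k<n. \<forall>t\<in>S. (nderiv_on S k u has_real_derivative nderiv_on S (Suc k) u t) (at t within S)) \<and>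
     continuous_on S (nderiv_on S n u)"

definition RL_integral :: "real \<Rightarrow> (real \<Rightarrow> real) \<Rightarrow> real \<Rightarrow> real" where
  "RL_integral \<gamma> h t = 1 / Gamma \<gamma> * integral {0..t} (\<lambda>s. (t - s) powr (\<gamma> - 1) * h s)"

definition caputo :: "real \<Rightarrow> real \<Rightarrow> (real \<Rightarrow> real) \<Rightarrow> real \<Rightarrow> real" where
  "caputo T \<gamma> u t =
     (let n = nat \<lceil>\<gamma>\<rceil> in
      if \<gamma> = real n then nderiv_on {0..T} n u t
      else 1 / Gamma (real n - \<gamma>) *
           integral {0..t} (\<lambda>s. (t - s) powr (real n - \<gamma> - 1) * nderiv_on {0..T} n u s))"

text \<open>The equation \<open>D\<^sup>\<alpha> u = h\<close> for \<open>2 < \<alpha> \<le> 3\<close> and continuous \<open>h\<close> is meant in the integrated sense,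
  as \<open>u\<close> is only required to be twice continuously differentiable.\<close>

definition caputo_equation :: "real \<Rightarrow> real \<Rightarrow> (real \<Rightarrow> real) \<Rightarrow> (real \<Rightarrow> real) \<Rightarrow> bool" where
  "caputo_equation T \<alpha> u h \<longleftrightarrow>
     continuous_on {0..T} h \<and>
     (\<exists>k0 k1 k2. \<forall>t\<in>{0..T}. u t = RL_integral \<alpha> h t - k0 - k1 * t - k2 * t\<^sup>2)"

definition Lp_nonneg :: "real \<Rightarrow> real \<Rightarrow> (real \<Rightarrow> real) set" where
  "Lp_nonneg p T =
     {l. l \<in> borel_measurable (lebesgue_on {0..T}) \<and> (\<forall>t\<in>{0..T}. 0 \<le> l t) \<and>
         integrable (lebesgue_on {0..T}) (\<lambda>t. \<bar>l t\<bar> powr p)}"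

definition Lp_norm :: "real \<Rightarrow> real \<Rightarrow> (real \<Rightarrow> real) \<Rightarrow> real" where
  "Lp_norm p T l = (integral\<^sup>L (lebesgue_on {0..T}) (\<lambda>t. \<bar>l t\<bar> powr p)) powr (1 / p)"

text \<open>In the following constants the data \<open>a\<close>, \<open>b\<close>, \<open>\<beta>\<close> are families indexed by \<open>0, 1, 2\<close>;
  other indices are not used.\<close>

definition mu :: "real \<Rightarrow> real \<Rightarrow> (nat \<Rightarrow> real) \<Rightarrow> (nat \<Rightarrow> real) \<Rightarrow> (nat \<Rightarrow> real) \<Rightarrow> nat \<Rightarrow> real" where
  "mu T \<eta> a b \<beta> i =
     Gamma (3 - \<beta> i) / (2 * (a i * \<eta> powr (2 - \<beta> i) + b i * T powr (2 - \<beta> i)))"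

definition nu :: "real \<Rightarrow> real \<Rightarrow> (nat \<Rightarrow> real) \<Rightarrow> (nat \<Rightarrow> real) \<Rightarrow> (nat \<Rightarrow> real) \<Rightarrow> nat \<Rightarrow> real" where
  "nu T \<eta> a b \<beta> i =
     Gamma (2 - \<beta> i) / (a i * \<eta> powr (1 - \<beta> i) + b i * T powr (1 - \<beta> i))"

definition rho :: "real \<Rightarrow> real \<Rightarrow> (nat \<Rightarrow> real) \<Rightarrow> (nat \<Rightarrow> real) \<Rightarrow> (nat \<Rightarrow> real) \<Rightarrow> nat \<Rightarrow> real" where
  "rho T \<eta> a b \<beta> i =
     (let \<mu>1 = \<bar>mu T \<eta> a b \<beta> 1\<bar>; \<mu>2 = \<bar>mu T \<eta> a b \<beta> 2\<bar>; \<nu>1 = \<bar>nu T \<eta> a b \<beta> 1\<bar>;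
          c = \<bar>a 0 + b 0\<bar> in
      if i = 0 then 1 / c
      else if i = 1 then \<nu>1 * (\<bar>b 0\<bar> / c + 1) * T
      else if i = 2 then
        \<bar>b 0\<bar> * \<mu>2 / c * T\<^sup>2 + \<bar>b 0\<bar> * \<nu>1 / c * (\<mu>2 / \<mu>1) * T + \<nu>1 * \<mu>2 / \<mu>1 * T + \<mu>2 * T\<^sup>2
      else 0)"

definition rho_tilde :: "real \<Rightarrow> real \<Rightarrow> (nat \<Rightarrow> real) \<Rightarrow> (nat \<Rightarrow> real) \<Rightarrow> (nat \<Rightarrow> real) \<Rightarrow> nat \<Rightarrow> real" where
  "rho_tilde T \<eta> a b \<beta> i =
     (let \<mu>1 = \<bar>mu T \<eta> a b \<beta> 1\<bar>; \<mu>2 = \<bar>mu T \<eta> a b \<beta> 2\<bar>; \<nu>1 = \<bar>nu T \<eta> a b \<beta> 1\<bar> in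
      if i = 0 then 0
      else if i = 1 then \<nu>1 * T powr (1 - \<beta> 1) / Gamma (2 - \<beta> 1)
      else if i = 2 then
        \<mu>2 * \<nu>1 * T powr (1 - \<beta> 1) / (\<mu>1 * Gamma (2 - \<beta> 1)) +
        2 * (\<mu>2 * T powr (2 - \<beta> 1) / Gamma (3 - \<beta> 1))
      else 0)"

definition rho_hat :: "real \<Rightarrow> real \<Rightarrow> (nat \<Rightarrow> real) \<Rightarrow> (nat \<Rightarrow> real) \<Rightarrow> (nat \<Rightarrow> real) \<Rightarrow> nat \<Rightarrow> real" where
  "rho_hat T \<eta> a b \<beta> i =
     (if i = 2 then 2 * (\<bar>mu T \<eta> a b \<beta> 2\<bar> * T powr (2 - \<beta> 2) / Gamma (3 - \<beta> 2)) else 0)"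

text \<open>The factor multiplying \<open>rho\<close>, \<open>rho_tilde\<close> and \<open>rho_hat\<close>, respectively, in the sums below.\<close>

definition boundary_factor ::
  "real \<Rightarrow> real \<Rightarrow> real \<Rightarrow> real \<Rightarrow> (nat \<Rightarrow> real) \<Rightarrow> (nat \<Rightarrow> real) \<Rightarrow> (nat \<Rightarrow> real) \<Rightarrow> nat \<Rightarrow> real" where
  "boundary_factor T \<eta> \<alpha> \<tau> a b \<beta> i =
     (\<bar>b i\<bar> * (T powr (\<alpha> - \<beta> i - \<tau>) / Gamma (\<alpha> - \<beta> i)) +
      \<bar>a i\<bar> * (\<eta> powr (\<alpha> - \<beta> i - \<tau>) / Gamma (\<alpha> - \<beta> i))) *
     ((1 - \<tau>) / (\<alpha> - \<beta> i - \<tau>)) powr (1 - \<tau>)"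

definition Delta0 ::
  "real \<Rightarrow> real \<Rightarrow> real \<Rightarrow> real \<Rightarrow> (nat \<Rightarrow> real) \<Rightarrow> (nat \<Rightarrow> real) \<Rightarrow> (nat \<Rightarrow> real) \<Rightarrow> real" where
  "Delta0 T \<eta> \<alpha> \<tau> a b \<beta> =
     T powr (\<alpha> - \<tau>) / Gamma \<alpha> * ((1 - \<tau>) / (\<alpha> - \<tau>)) powr (1 - \<tau>) +
     (\<Sum>i=0..2. rho T \<eta> a b \<beta> i * boundary_factor T \<eta> \<alpha> \<tau> a b \<beta> i)"

definition Delta1 ::
  "real \<Rightarrow> real \<Rightarrow> real \<Rightarrow> real \<Rightarrow> (nat \<Rightarrow> real) \<Rightarrow> (nat \<Rightarrow> real) \<Rightarrow> (nat \<Rightarrow> real) \<Rightarrow> real" where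
  "Delta1 T \<eta> \<alpha> \<tau> a b \<beta> =
     T powr (\<alpha> - \<beta> 1 - \<tau>) / Gamma (\<alpha> - \<beta> 1) * ((1 - \<tau>) / (\<alpha> - \<beta> 1 - \<tau>)) powr (1 - \<tau>) +
     (\<Sum>i=1..2. rho_tilde T \<eta> a b \<beta> i * boundary_factor T \<eta> \<alpha> \<tau> a b \<beta> i)"

definition Delta2 ::
  "real \<Rightarrow> real \<Rightarrow> real \<Rightarrow> real \<Rightarrow> (nat \<Rightarrow> real) \<Rightarrow> (nat \<Rightarrow> real) \<Rightarrow> (nat \<Rightarrow> real) \<Rightarrow> real" where
  "Delta2 T \<eta> \<alpha> \<tau> a b \<beta> =
     T powr (\<alpha> - \<beta> 2 - \<tau>) / Gamma (\<alpha> - \<beta> 2) * ((1 - \<tau>) / (\<alpha> - \<beta> 2 - \<tau>)) powr (1 - \<tau>) +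
     rho_hat T \<eta> a b \<beta> 2 * boundary_factor T \<eta> \<alpha> \<tau> a b \<beta> 2"

end

theory Submission
  imports Defs "HOL-Complex_Analysis.Great_Picard"
begin

text \<open>
The boundary value problem is a fixed point problem for the triple
\<open>y = (u, v, w)\<close>, where \<open>v\<close> and \<open>w\<close> stand for the Caputo derivatives of \<open>u\<close> of orders
\<open>\<beta> 1\<close> and \<open>\<beta> 2\<close>.
Freeze the right-hand sides, that is, put \<open>h t = f t (u t) (v t) (w t)\<close> and let \<open>G i\<close> be \<open>lam i\<close> times
the integral of \<open>g i s (u s)\<close>. The problem becomes linear, and its solution has the form
\<open>I\<^sup>\<alpha> h - k0 - k1 t - k2 t\<^sup>2\<close>. Its two Caputo derivatives follow from the semigroup law
\<open>I\<^sup>a I\<^sup>b = I\<^sup>a\<^sup>+\<^sup>b\<close> (\<open>RL_integral_semigroup\<close>), and the three boundary conditions are a triangular linear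
system for the constants: the condition on the \<open>\<beta> 2\<close> derivative gives \<open>k2\<close>, the one on the \<open>\<beta> 1\<close>
derivative then gives \<open>k1\<close>, and the remaining one gives \<open>k0\<close>.
Sending \<open>y\<close> to this solution together with its two derivatives defines an operator \<open>\<Phi>\<close>, and a fixed
point of \<open>\<Phi>\<close> is a solution of the problem.

The operator acts on the convex set of continuous \<open>y\<close> on \<open>[0,T]\<close> with
\<open>\<bar>u t\<bar> + \<bar>v t\<bar> + \<bar>w t\<bar> \<le> K\<close> for all \<open>t\<close>. On this set \<open>\<bar>h t\<bar> \<le> l_f t * \<phi> K\<close>, so Hoelder's inequality with
exponents \<open>1/\<tau>\<close> and \<open>1/(1-\<tau>)\<close> bounds every fractional integral of \<open>h\<close> by the norm of \<open>l_f\<close>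
(\<open>RL_integral_Hoelder_bound\<close>). Collecting the contributions of \<open>k0\<close>, \<open>k1\<close>, \<open>k2\<close> gives coefficients
that are bounded by the constants \<open>Delta\<close> and \<open>rho\<close>, so that the sum of the moduli of the components of \<open>\<Phi> y\<close> is at most the denominator in
the assumption on \<open>K\<close> (\<open>a_priori_bound\<close>); that assumption says that it is smaller than \<open>K\<close>.
Hence \<open>\<Phi>\<close> maps the set into itself.

On the same set \<open>h\<close> is uniformly bounded, which makes the images under \<open>\<Phi>\<close> equicontinuous
(\<open>UVW_equicontinuous\<close>), and \<open>\<Phi>\<close> is uniformly continuous because the linear problem depends linearly
and boundedly on its data. Schauder's theorem, in the form \<open>schauder_fixpoint_interval\<close>, gives the
fixed point. It is derived here from Kuhn's combinatorial lemma, the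
discrete core of Brouwer's theorem, since the dimension of the approximating simplices has to vary.
\<close>

section \<open>Schauder's fixed point theorem\<close>

text \<open>
A discrete form of Brouwer's theorem on the unit cube of dimension \<open>n\<close>, with points represented by
functions on \<open>nat\<close> so that \<open>n\<close> may vary. A grid point gets label \<open>0\<close> in direction \<open>i\<close> if \<open>G\<close> does not
decrease its \<open>i\<close>-th coordinate and \<open>1\<close> if \<open>G\<close> does not increase it. Kuhn's lemma yields a grid cell in
which both labels occur in every direction, and by uniform continuity \<open>G\<close> moves its corner very little.
\<close>

lemma kuhn_approximate_fixpoint:
  fixes n :: nat and G :: "(nat \<Rightarrow> real) \<Rightarrow> nat \<Rightarrow> real"
  assumes G: "\<And>x i. \<lbrakk>i < n; \<forall>j<n. x j \<in> {0..1}\<rbrakk> \<Longrightarrow> G x i \<in> {0..1}"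
    and unif: "\<And>e. e > 0 \<Longrightarrow> \<exists>d>0. \<forall>x y. (\<forall>j<n. x j \<in> {0..1}) \<longrightarrow> (\<forall>j<n. y j \<in> {0..1}) \<longrightarrow>
                 (\<forall>j<n. \<bar>x j - y j\<bar> \<le> d) \<longrightarrow> (\<forall>i<n. \<bar>G x i - G y i\<bar> \<le> e)"
    and "e > 0"
  obtains x where "\<forall>j<n. x j \<in> {0..1}" "\<forall>i<n. \<bar>G x i - x i\<bar> \<le> e"
proof -
  obtain d where d: "d > 0" "\<And>x y i. \<lbrakk>\<forall>j<n. x j \<in> {0..1}; \<forall>j<n. y j \<in> {0..1};
                 \<forall>j<n. \<bar>x j - y j\<bar> \<le> d; i < n\<rbrakk> \<Longrightarrow> \<bar>G x i - G y i\<bar> \<le> e / 2"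
    using unif[of "e/2"] \<open>e > 0\<close> by (metis half_gt_zero)
  obtain p :: nat where p: "p > 0" "1 / real p < min d (e / 2)"
    using real_arch_invD[of "min d (e/2)"] d(1) \<open>e > 0\<close>
    by (metis bot_nat_0.not_eq_extremum half_gt_zero inverse_eq_divide min_less_iff_conj)
  define pt where "pt = (\<lambda>(z :: nat \<Rightarrow> nat) i. real (z i) / real p)"
  define label where "label = (\<lambda>z i. if z i = 0 then 0 else if z i = p then 1
      else if G (pt z) i \<ge> pt z i then 0 else (1::nat))"
  have pt01: "\<forall>j<n. pt z j \<in> {0..1}" if "\<forall>j<n. z j \<le> p" for z
    using that p by (auto simp: pt_def)
  have label0: "pt z i \<le> G (pt z) i" if "\<forall>j<n. z j \<le> p" "i < n" "label z i = 0" for z i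
    using that G[OF that(2) pt01[OF that(1)]] by (auto simp: label_def pt_def split: if_splits)
  have label1: "G (pt z) i \<le> pt z i" if "\<forall>j<n. z j \<le> p" "i < n" "label z i \<noteq> 0" for z i
    using that G[OF that(2) pt01[OF that(1)]] p by (auto simp: label_def pt_def split: if_splits)
  obtain q where q: "\<forall>i<n. q i < p"
    "\<forall>i<n. \<exists>r s. (\<forall>j<n. q j \<le> r j \<and> r j \<le> q j + 1) \<and> (\<forall>j<n. q j \<le> s j \<and> s j \<le> q j + 1) \<and>
                 label r i \<noteq> label s i"
    by (rule kuhn_lemma[of p n label]) (use p in \<open>auto simp: label_def\<close>)
  have near: "(\<forall>j<n. r j \<le> p) \<and> (\<forall>j<n. \<bar>pt q j - pt r j\<bar> \<le> 1 / p)"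
    if "\<forall>j<n. q j \<le> r j \<and> r j \<le> q j + 1" for r
  proof -
    have "\<bar>pt q j - pt r j\<bar> \<le> 1 / p" if "j < n" for j
    proof -
      have "\<bar>real (q j) - real (r j)\<bar> \<le> 1" using \<open>j < n\<close> \<open>\<forall>j<n. q j \<le> r j \<and> r j \<le> q j + 1\<close> by fastforce
      moreover have "\<bar>pt q j - pt r j\<bar> = \<bar>real (q j) - real (r j)\<bar> / p"
        by (simp add: pt_def abs_divide flip: diff_divide_distrib)
      ultimately show ?thesis by (simp add: divide_right_mono)
    qed
    moreover have "r j \<le> p" if "j < n" for j
      using that \<open>\<forall>j<n. q j \<le> r j \<and> r j \<le> q j + 1\<close> q(1) by fastforce
    ultimately show ?thesis by blast
  qed
  have qp: "\<forall>j<n. q j \<le> p" using q(1) by (simp add: less_imp_le)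
  have "\<bar>G (pt q) i - pt q i\<bar> \<le> e" if "i < n" for i
  proof -
    obtain r s where rs: "\<forall>j<n. q j \<le> r j \<and> r j \<le> q j + 1" "\<forall>j<n. q j \<le> s j \<and> s j \<le> q j + 1"
        "label r i \<noteq> label s i"
      using q(2)[THEN spec, THEN mp, OF \<open>i < n\<close>] by (elim exE conjE) (rule that)
    have close: "\<bar>G (pt q) i - G (pt z) i\<bar> \<le> e / 2" "\<bar>pt q i - pt z i\<bar> \<le> e / 2" "\<forall>j<n. z j \<le> p"
      if z: "\<forall>j<n. q j \<le> z j \<and> z j \<le> q j + 1" for z
    proof -
      have nz: "\<forall>j<n. z j \<le> p" "\<And>j. j < n \<Longrightarrow> \<bar>pt q j - pt z j\<bar> \<le> 1 / p" using near[OF z] by auto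
      show "\<forall>j<n. z j \<le> p" by fact
      show "\<bar>pt q i - pt z i\<bar> \<le> e / 2" using nz(2)[OF \<open>i < n\<close>] p(2) by simp
      have "\<forall>j<n. \<bar>pt q j - pt z j\<bar> \<le> d" using nz(2) p(2) by fastforce
      then show "\<bar>G (pt q) i - G (pt z) i\<bar> \<le> e / 2"
        using d(2)[OF pt01[OF qp] pt01[OF nz(1)]] \<open>i < n\<close> by blast
    qed
    obtain r' s' where "\<forall>j<n. q j \<le> r' j \<and> r' j \<le> q j + 1" "\<forall>j<n. q j \<le> s' j \<and> s' j \<le> q j + 1"
        "label r' i = 0" "label s' i \<noteq> 0"
      using rs by (cases "label r i = 0") (metis, metis label_def)
    note r' = \<open>\<forall>j<n. q j \<le> r' j \<and> r' j \<le> q j + 1\<close> and s' = \<open>\<forall>j<n. q j \<le> s' j \<and> s' j \<le> q j + 1\<close>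
    have "pt r' i \<le> G (pt r') i" by (rule label0) (use close(3)[OF r'] \<open>i < n\<close> \<open>label r' i = 0\<close> in auto)
    moreover have "G (pt s') i \<le> pt s' i" by (rule label1) (use close(3)[OF s'] \<open>i < n\<close> \<open>label s' i \<noteq> 0\<close> in auto)
    ultimately show ?thesis
      using close(1,2)[OF r'] close(1,2)[OF s'] by linarith
  qed
  with pt01[OF qp] show thesis using that by blast
qed

text \<open>
Dividing by \<open>max 1\<close> of the sum of the coefficients turns an arbitrary point of the cube into a
subconvex combination of the \<open>X i\<close>, and does not change true convex combinations. In this way maps
into a simplex can be handled on the cube.
\<close>

lemma schauder_projection_lipschitz:
  fixes X :: "nat \<Rightarrow> 'a::real_normed_vector"
  assumes c: "\<forall>j<n. c j \<in> {0..1}" and c': "\<forall>j<n. c' j \<in> {0..1}"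
    and d: "\<forall>j<n. \<bar>c j - c' j\<bar> \<le> d" and B: "\<forall>j<n. norm (X j) \<le> B"
  shows "norm ((1 / max 1 (\<Sum>i<n. c i)) *\<^sub>R (\<Sum>i<n. c i *\<^sub>R X i) -
               (1 / max 1 (\<Sum>i<n. c' i)) *\<^sub>R (\<Sum>i<n. c' i *\<^sub>R X i)) \<le> real n * (real n + 1) * B * d"
proof -
  define m where "m = (\<lambda>c. max 1 (\<Sum>i<n. c i :: real))"
  have m1: "m z \<ge> 1" for z by (simp add: m_def)
  have "\<bar>(\<Sum>i<n. c i) - (\<Sum>i<n. c' i)\<bar> \<le> (\<Sum>i<n. d)"
    unfolding sum_subtractf[symmetric] by (rule order.trans[OF sum_abs sum_mono]) (use d in auto)
  then have mm: "\<bar>m c - m c'\<bar> \<le> n * d" by (auto simp: m_def)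
  have coef: "\<bar>c j / m c - c' j / m c'\<bar> \<le> (real n + 1) * d" if "j < n" for j
  proof -
    have "c j / m c - c' j / m c' = (c j - c' j) / m c + (c' j / m c') * ((m c' - m c) / m c)"
      using m1[of c] m1[of c'] by (simp add: field_simps)
    moreover have "\<bar>(c j - c' j) / m c\<bar> \<le> d"
    proof -
      have "\<bar>c j - c' j\<bar> / m c \<le> \<bar>c j - c' j\<bar>" using m1[of c]
        by (metis abs_ge_zero div_by_1 frac_le order_refl zero_less_one)
      then show ?thesis using d that m1[of c] by (simp add: abs_divide) (metis order_trans)
    qed
    moreover have "\<bar>(c' j / m c') * ((m c' - m c) / m c)\<bar> \<le> 1 * (n * d)"
      unfolding abs_mult
    proof (rule mult_mono)
      show "\<bar>c' j / m c'\<bar> \<le> 1" using c' that m1[of c'] by (fastforce simp: abs_divide)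
      have "\<bar>m c' - m c\<bar> / m c \<le> \<bar>m c' - m c\<bar>" using m1[of c]
        by (metis abs_ge_zero div_by_1 frac_le order_refl zero_less_one)
      then show "\<bar>(m c' - m c) / m c\<bar> \<le> n * d" using mm m1[of c] by (simp add: abs_divide)
    qed auto
    ultimately have "\<bar>c j / m c - c' j / m c'\<bar> \<le> d + 1 * (n * d)" by linarith
    then show ?thesis by (simp add: algebra_simps)
  qed
  have "norm ((1 / m c) *\<^sub>R (\<Sum>i<n. c i *\<^sub>R X i) - (1 / m c') *\<^sub>R (\<Sum>i<n. c' i *\<^sub>R X i))
      = norm (\<Sum>i<n. (c i / m c - c' i / m c') *\<^sub>R X i)"
    by (simp add: scaleR_sum_right sum_subtractf algebra_simps)
  also have "\<dots> \<le> (\<Sum>i<n. (real n + 1) * d * B)"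
  proof (intro order.trans[OF norm_sum sum_mono])
    fix i assume "i \<in> {..<n}"
    then show "norm ((c i / m c - c' i / m c') *\<^sub>R X i) \<le> (real n + 1) * d * B"
      using coef[of i] B unfolding norm_scaleR
      by (intro mult_mono) (auto intro: order.trans[OF abs_ge_zero])
  qed
  finally show ?thesis by (simp add: m_def algebra_simps)
qed

text \<open>
Schauder's projection: a finite \<open>e\<close>-net \<open>X 0, \<dots>, X (n - 1)\<close> of \<open>S\<close> and a subordinate partition of unity \<open>w\<close>
move the points of \<open>S\<close> by at most \<open>e\<close> into the convex hull of the net. The composition with \<open>F\<close> is a
continuous self-map of a cube in the coefficients, and an approximate fixed point of it
yields one of \<open>F\<close>.
\<close>

lemma schauder_approximate_fixpoint:
  fixes F :: "'a::real_normed_vector \<Rightarrow> 'a"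
  assumes C: "convex C" "C \<noteq> {}" and F: "continuous_on C F" "F ` C \<subseteq> S" and S: "compact S" "S \<subseteq> C"
    and "e > 0"
  obtains x where "x \<in> C" "norm (F x - x) \<le> 2 * e"
proof -
  obtain N where N: "finite N" "N \<subseteq> S" "S \<subseteq> (\<Union>x\<in>N. ball x e)"
    using compactE_image[OF S(1), of S "\<lambda>x. ball x e"] \<open>e > 0\<close> by (metis (no_types, lifting) UN_I centre_in_ball open_ball subsetI)
  obtain n :: nat and X where X: "N = X ` {..<n}"
    using N(1) by (metis finite_imp_nat_seg_image_inj_on lessThan_def)
  obtain x0 where x0: "x0 \<in> C" using C(2) by blast
  define w where "w = (\<lambda>i y. max 0 (e - norm (y - X i)) / (\<Sum>j<n. max 0 (e - norm (y - X j))))"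
  have pos: "(\<Sum>j<n. max 0 (e - norm (y - X j))) > 0" if y: "y \<in> S" for y
  proof -
    obtain i where "i < n" "norm (y - X i) < e"
      using subsetD[OF N(3) y] X by (auto simp: dist_norm norm_minus_commute)
    then show ?thesis by (intro sum_pos2[of _ i]) auto
  qed
  have w0: "w i y \<ge> 0" for i y by (simp add: w_def sum_nonneg)
  have wsum: "(\<Sum>i<n. w i y) = 1" if "y \<in> S" for y
    using pos[OF that] by (simp add: w_def flip: sum_divide_distrib)
  have w1: "w i y \<le> 1" if "y \<in> S" "i < n" for i y
    using member_le_sum[of i "{..<n}" "\<lambda>i. w i y"] w0 wsum[OF that(1)] that(2) by simp
  have wcont: "continuous_on S (w i)" for i
    unfolding w_def using pos by (intro continuous_intros) fastforce
  have wnear: "norm (y - (\<Sum>i<n. w i y *\<^sub>R X i)) \<le> e" if "y \<in> S" for y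
  proof -
    have "y - (\<Sum>i<n. w i y *\<^sub>R X i) = (\<Sum>i<n. w i y *\<^sub>R (y - X i))"
      using wsum[OF that] by (simp add: scaleR_diff_right sum_subtractf flip: scaleR_sum_left)
    also have "norm \<dots> \<le> (\<Sum>i<n. w i y * e)"
    proof (intro order.trans[OF norm_sum sum_mono])
      fix i
      show "norm (w i y *\<^sub>R (y - X i)) \<le> w i y * e"
      proof (cases "norm (y - X i) \<le> e")
        case True
        then show ?thesis using mult_left_mono[OF True w0[of i y]] w0[of i y] by simp
      qed (simp add: w_def)
    qed
    also have "\<dots> = e" using wsum[OF that] by (simp flip: sum_distrib_right)
    finally show ?thesis .
  qed
  \<comment> \<open>The base point \<open>x0\<close> receives the missing weight if the coefficients add up to less than \<open>1\<close>.\<close>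
  define p where "p = (\<lambda>c. x0 + (1 / max 1 (\<Sum>i<n. c i)) *\<^sub>R (\<Sum>i<n. c i *\<^sub>R (X i - x0)))"
  define H where "H = convex hull (insert x0 N)"
  have "compact H"
    unfolding H_def using N(1) by (intro finite_imp_compact_convex_hull) auto
  moreover have "H \<subseteq> C"
    unfolding H_def using N(2) S(2) x0 C(1) by (intro hull_minimal) auto
  ultimately have H: "compact H" "H \<subseteq> C" by auto
  have pH: "p c \<in> H" if c: "\<forall>j<n. c j \<in> {0..1}" for c
  proof -
    define m where "m = max 1 (\<Sum>i<n. c i)"
    have m: "m \<ge> 1" "(\<Sum>i<n. c i) \<le> m" by (auto simp: m_def)
    define a where "a = (\<lambda>i. if i < n then c i / m else 1 - (\<Sum>i<n. c i) / m)"
    define Z where "Z = (\<lambda>i. if i < n then X i else x0)"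
    have "p c = (\<Sum>i\<in>{..<Suc n}. a i *\<^sub>R Z i)"
      unfolding p_def m_def[symmetric]
      by (simp add: a_def Z_def scaleR_diff_right sum_subtractf scaleR_sum_right algebra_simps
          flip: scaleR_sum_left sum_divide_distrib)
    also have "\<dots> \<in> H"
    proof (rule convex_sum)
      show "convex H" by (simp add: H_def)
      show "(\<Sum>i\<in>{..<Suc n}. a i) = 1" by (simp add: a_def flip: sum_divide_distrib)
      show "a i \<ge> 0" for i using m c by (auto simp: a_def)
      show "Z i \<in> H" for i unfolding H_def Z_def using X by (auto intro: hull_inc)
    qed auto
    finally show ?thesis .
  qed
  define B where "B = 1 + (\<Sum>j<n. norm (X j - x0))"
  have B: "\<forall>j<n. norm (X j - x0) \<le> B" and "B > 0"
    using member_le_sum[of _ "{..<n}" "\<lambda>j. norm (X j - x0)"]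
    by (force simp: B_def, simp add: B_def add_pos_nonneg sum_nonneg)
  define L where "L = real n * (real n + 1) * B + 1"
  have "L > 0" using \<open>B > 0\<close> by (auto simp: L_def intro: add_nonneg_pos)
  have plip: "norm (p c - p c') \<le> L * d"
    if "\<forall>j<n. c j \<in> {0..1}" "\<forall>j<n. c' j \<in> {0..1}" "\<forall>j<n. \<bar>c j - c' j\<bar> \<le> d" "d \<ge> 0" for c c' d
    using schauder_projection_lipschitz[OF that(1-3) B] \<open>d \<ge> 0\<close> by (simp add: p_def L_def algebra_simps)
  \<comment> \<open>\<open>G\<close> reads off the barycentric coordinates of the projection of \<open>F (p c)\<close>.\<close>
  define G where "G = (\<lambda>c i. w i (F (p c)))"
  have FS: "F (p c) \<in> S" if "\<forall>j<n. c j \<in> {0..1}" for c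
    using pH[OF that] H(2) F(2) by blast
  have "e / L > 0" using \<open>e > 0\<close> \<open>L > 0\<close> by simp
  obtain c where c: "\<forall>j<n. c j \<in> {0..1}" "\<forall>i<n. \<bar>G c i - c i\<bar> \<le> e / L"
  proof (rule kuhn_approximate_fixpoint[of n G "e / L"])
    show "G x i \<in> {0..1}" if "i < n" "\<forall>j<n. x j \<in> {0..1}" for x i
      using w0 w1 FS[OF that(2)] that(1) by (simp add: G_def)
    show "e / L > 0" by fact
    fix e' :: real assume "e' > 0"
    have "uniformly_continuous_on H (\<lambda>x. w i (F x))" for i
    proof (rule compact_uniformly_continuous[OF _ H(1)])
      show "continuous_on H (\<lambda>x. w i (F x))"
        using continuous_on_compose2[OF wcont F(1) F(2)] H(2) continuous_on_subset by blast
    qed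
    then have "\<forall>i. \<exists>d>0. \<forall>x\<in>H. \<forall>x'\<in>H. dist x' x < d \<longrightarrow> dist (w i (F x')) (w i (F x)) < e'"
      using \<open>e' > 0\<close> by (simp add: uniformly_continuous_on_def)
    then obtain D where D: "\<And>i. D i > 0"
      "\<And>i x x'. \<lbrakk>x \<in> H; x' \<in> H; dist x' x < D i\<rbrakk> \<Longrightarrow> dist (w i (F x')) (w i (F x)) < e'"
      by metis
    define \<delta> where "\<delta> = Min (insert 1 (D ` {..<n})) / (2 * L)"
    have Mpos: "Min (insert 1 (D ` {..<n})) > 0" using D(1) by (subst Min_gr_iff) auto
    then have \<delta>: "\<delta> > 0" using \<open>L > 0\<close> by (simp add: \<delta>_def)
    have \<delta>D: "L * \<delta> < D i" if "i < n" for i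
    proof -
      have "Min (insert 1 (D ` {..<n})) \<le> D i" using that by (intro Min_le) auto
      then show ?thesis using \<open>L > 0\<close> Mpos D(1)[of i] unfolding \<delta>_def by simp
    qed
    show "\<exists>d>0. \<forall>x y. (\<forall>j<n. x j \<in> {0..1}) \<longrightarrow> (\<forall>j<n. y j \<in> {0..1}) \<longrightarrow>
                 (\<forall>j<n. \<bar>x j - y j\<bar> \<le> d) \<longrightarrow> (\<forall>i<n. \<bar>G x i - G y i\<bar> \<le> e')"
    proof (intro exI[of _ \<delta>] conjI allI impI)
      fix x y i assume xy: "\<forall>j<n. x j \<in> {0..1}" "\<forall>j<n. y j \<in> {0..1}" "\<forall>j<n. \<bar>x j - y j\<bar> \<le> \<delta>" "i < n"
      have "dist (p x) (p y) < D i"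
        using plip[OF xy(1-3)] \<delta> \<delta>D[OF xy(4)] by (simp add: dist_norm)
      from D(2)[OF pH[OF xy(2)] pH[OF xy(1)] this]
      show "\<bar>G x i - G y i\<bar> \<le> e'" by (simp add: G_def dist_real_def)
    qed (rule \<delta>)
  qed
  define y where "y = F (p c)"
  have y: "y \<in> S" using FS c(1) by (simp add: y_def)
  have pw: "p (\<lambda>i. w i y) = (\<Sum>i<n. w i y *\<^sub>R X i)"
    using wsum[OF y] by (simp add: p_def scaleR_diff_right sum_subtractf flip: scaleR_sum_left)
  \<comment> \<open>The cube point \<open>c\<close> is close to the true weights, so \<open>p c\<close> is close to the projection of \<open>y\<close>.\<close>
  have "norm (p (\<lambda>i. w i y) - p c) \<le> L * (e / L)"
    using c w0 w1[OF y] \<open>e / L > 0\<close> by (intro plip) (auto simp: G_def y_def)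
  then have "norm ((\<Sum>i<n. w i y *\<^sub>R X i) - p c) \<le> e" using \<open>L > 0\<close> by (simp add: pw)
  with wnear[OF y] have "norm (F (p c) - p c) \<le> 2 * e"
    unfolding y_def[symmetric] using norm_triangle_ineq[of "y - (\<Sum>i<n. w i y *\<^sub>R X i)" "(\<Sum>i<n. w i y *\<^sub>R X i) - p c"]
    by simp
  moreover have "p c \<in> C" using pH c(1) H(2) by blast
  ultimately show thesis using that by blast
qed

text \<open>
The images of approximate fixed points have a limit point in the compact set \<open>S\<close>; it is the limit of the
approximate fixed points themselves, hence fixed by continuity.
\<close>

theorem schauder_fixpoint:
  fixes F :: "'a::real_normed_vector \<Rightarrow> 'a"
  assumes C: "convex C" "C \<noteq> {}" and F: "continuous_on C F" "F ` C \<subseteq> S" and S: "compact S" "S \<subseteq> C"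
  obtains x where "x \<in> C" "F x = x"
proof -
  have "\<forall>k. \<exists>x\<in>C. norm (F x - x) \<le> 2 * (1 / real (Suc k))"
    using schauder_approximate_fixpoint[OF assms] by (metis divide_pos_pos of_nat_0_less_iff zero_less_Suc zero_less_one)
  then obtain x where x: "\<And>k. x k \<in> C" "\<And>k. norm (F (x k) - x k) \<le> 2 * (1 / real (Suc k))" by metis
  have "\<forall>k. F (x k) \<in> S" using x(1) F(2) by blast
  then obtain y r where r: "y \<in> S" "strict_mono r" "((\<lambda>k. F (x k)) \<circ> r) \<longlonglongrightarrow> y"
    using S(1) unfolding compact_def by metis
  have "(\<lambda>k. F (x k) - x k) \<longlonglongrightarrow> 0"
  proof (rule Lim_null_comparison)
    show "\<forall>\<^sub>F k in sequentially. norm (F (x k) - x k) \<le> 2 * (1 / real (Suc k))" using x(2) by simp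
    show "(\<lambda>k. 2 * (1 / real (Suc k))) \<longlonglongrightarrow> 0"
      using LIMSEQ_Suc[OF lim_const_over_n[of 2]] by simp
  qed
  then have "((\<lambda>k. F (x k) - x k) \<circ> r) \<longlonglongrightarrow> 0" using r(2) LIMSEQ_subseq_LIMSEQ by blast
  from tendsto_diff[OF r(3) this] have xr: "(\<lambda>k. x (r k)) \<longlonglongrightarrow> y" by (simp add: o_def)
  have "y \<in> C" using r(1) S(2) by blast
  then have "(\<lambda>k. F (x (r k))) \<longlonglongrightarrow> F y"
    using continuous_on_tendsto_compose[OF F(1) xr] x(1) by simp
  then have "F y = y" using r(3) LIMSEQ_unique by (auto simp: o_def)
  with \<open>y \<in> C\<close> show thesis using that by blast
qed

text \<open>
The theorem of Arzela and Ascoli for a common modulus of continuity \<open>\<delta>\<close>. Functions on \<open>[a,b]\<close> are represented by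
bounded continuous functions on the whole line that are constant outside the interval, because these
form a normed space.
\<close>

lemma compact_equicontinuous_bcontfun:
  fixes B :: "'b::euclidean_space set" and \<delta> :: "real \<Rightarrow> real"
  assumes ab: "a \<le> b" and "compact B" and \<delta>: "\<And>e. e > 0 \<Longrightarrow> \<delta> e > 0"
  shows "compact {z :: real \<Rightarrow>\<^sub>C 'b. (\<forall>t. apply_bcontfun z t \<in> B) \<and> (\<forall>t. apply_bcontfun z t = apply_bcontfun z (max a (min b t))) \<and>
      (\<forall>e>0. \<forall>s\<in>{a..b}. \<forall>t\<in>{a..b}. \<bar>s - t\<bar> < \<delta> e \<longrightarrow> norm (apply_bcontfun z s - apply_bcontfun z t) \<le> e)}" (is "compact ?S")
  unfolding compact_def
proof (intro allI impI)
  fix f :: "nat \<Rightarrow> real \<Rightarrow>\<^sub>C 'b" assume "\<forall>n. f n \<in> ?S"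
  then have f: "\<And>n t. f n t \<in> B" "\<And>n t. f n t = f n (max a (min b t))"
    "\<And>n e s t. \<lbrakk>e > 0; s \<in> {a..b}; t \<in> {a..b}; \<bar>s - t\<bar> < \<delta> e\<rbrakk> \<Longrightarrow> norm (f n s - f n t) \<le> e"
    by blast+
  obtain M where M: "\<And>x. x \<in> B \<Longrightarrow> norm x \<le> M"
    using \<open>compact B\<close> compact_imp_bounded bounded_iff by metis
  obtain g k where k: "strict_mono (k :: nat \<Rightarrow> nat)"
    and g: "\<And>e. 0 < e \<Longrightarrow> \<exists>N. \<forall>n x. n \<ge> N \<and> x \<in> {a..b} \<longrightarrow> norm (f (k n) x - g x) < e"
  proof (rule Arzela_Ascoli[of "{a..b}" "\<lambda>n. apply_bcontfun (f n)" M])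
    fix x e :: real assume "x \<in> {a..b}" "e > 0"
    have "norm (f n x - f n y) < e" if "y \<in> {a..b}" "\<bar>x - y\<bar> < \<delta> (e/2)" for n y
      using f(3)[of "e/2" x y n] that \<open>x \<in> {a..b}\<close> \<open>e > 0\<close> by simp
    then show "\<exists>d>0. \<forall>n y. y \<in> {a..b} \<and> norm (x - y) < d \<longrightarrow> norm (f n x - f n y) < e"
      using \<delta>[of "e/2"] \<open>e > 0\<close> by (intro exI[of _ "\<delta> (e/2)"]) simp
  qed (use M f(1) in auto)
  have c: "max a (min b t) \<in> {a..b}" for t using ab by auto
  have "uniform_limit UNIV (\<lambda>n. f (k n)) (\<lambda>t. g (max a (min b t))) sequentially"
    unfolding uniform_limit_sequentially_iff
  proof (intro allI impI)
    fix e :: real assume "e > 0"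
    from g[OF this] obtain N where "\<forall>n x. n \<ge> N \<and> x \<in> {a..b} \<longrightarrow> norm (f (k n) x - g x) < e" by blast
    then show "\<exists>N. \<forall>n\<ge>N. \<forall>x\<in>UNIV. dist (f (k n) x) (g (max a (min b x))) < e"
      unfolding dist_norm using c by (subst f(2)) blast
  qed
  then obtain l where l: "(f \<circ> k) \<longlonglongrightarrow> l"
    unfolding o_def by (rule uniform_limit_bcontfunE[OF _ sequentially_bot]) blast
  have lim: "(\<lambda>n. f (k n) t) \<longlonglongrightarrow> l t" for t
    using tendsto_bcontfun_uniform_limit[OF l] by (auto simp: o_def intro: tendsto_uniform_limitI)
  have "l t \<in> B" for t
    using closed_sequentially[OF compact_imp_closed[OF \<open>compact B\<close>] _ lim] f(1) by blast
  moreover have "l t = l (max a (min b t))" for t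
    using LIMSEQ_unique[OF lim[of t]] lim[of "max a (min b t)"]
    unfolding f(2)[of "k _" t, symmetric] by blast
  moreover have "norm (l s - l t) \<le> e" if "e > 0" "s \<in> {a..b}" "t \<in> {a..b}" "\<bar>s - t\<bar> < \<delta> e" for e s t
    by (rule Lim_norm_ubound[OF _ tendsto_diff[OF lim lim]]) (use f(3)[OF that] in auto)
  ultimately have "l \<in> ?S" by (intro CollectI conjI allI ballI impI)
  with k l show "\<exists>l\<in>?S. \<exists>r. strict_mono r \<and> (f \<circ> r) \<longlonglongrightarrow> l" by blast
qed

text \<open>
Schauder's theorem for operators on \<open>B\<close>-valued continuous functions on an interval. Equicontinuity of the
images provides the compact set, by Arzela and Ascoli; the operator is transported to bounded continuous functions
on the line by clamping the argument to \<open>[a,b]\<close>.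
\<close>

theorem schauder_fixpoint_interval:
  fixes \<Phi> :: "(real \<Rightarrow> 'b::euclidean_space) \<Rightarrow> real \<Rightarrow> 'b" and a b :: real
  assumes ab: "a \<le> b" and B: "compact B" "convex B" "B \<noteq> {}"
    and Y: "Y = {y. continuous_on {a..b} y \<and> y ` {a..b} \<subseteq> B}"
    and into: "\<And>y t. \<lbrakk>y \<in> Y; t \<in> {a..b}\<rbrakk> \<Longrightarrow> \<Phi> y t \<in> B"
    and equicont: "\<And>e. e > 0 \<Longrightarrow> \<exists>d>0. \<forall>y\<in>Y. \<forall>s\<in>{a..b}. \<forall>t\<in>{a..b}. \<bar>s - t\<bar> < d \<longrightarrow> norm (\<Phi> y s - \<Phi> y t) \<le> e"
    and cont: "\<And>e. e > 0 \<Longrightarrow> \<exists>d>0. \<forall>y\<in>Y. \<forall>z\<in>Y. (\<forall>t\<in>{a..b}. norm (y t - z t) < d) \<longrightarrow>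
                 (\<forall>t\<in>{a..b}. norm (\<Phi> y t - \<Phi> z t) \<le> e)"
  obtains y where "y \<in> Y" "\<And>t. t \<in> {a..b} \<Longrightarrow> \<Phi> y t = y t"
proof -
  have "\<forall>e. \<exists>d. e > 0 \<longrightarrow> d > 0 \<and> (\<forall>y\<in>Y. \<forall>s\<in>{a..b}. \<forall>t\<in>{a..b}. \<bar>s - t\<bar> < d \<longrightarrow> norm (\<Phi> y s - \<Phi> y t) \<le> e)"
    using equicont by meson
  then obtain \<delta> where \<delta>: "\<And>e. e > 0 \<Longrightarrow> \<delta> e > 0"
    "\<And>e y s t. \<lbrakk>e > 0; y \<in> Y; s \<in> {a..b}; t \<in> {a..b}; \<bar>s - t\<bar> < \<delta> e\<rbrakk> \<Longrightarrow> norm (\<Phi> y s - \<Phi> y t) \<le> e"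
    by metis
  define c where "c = (\<lambda>t. max a (min b t))"
  have c: "c t \<in> {a..b}" for t using ab by (auto simp: c_def)
  have cc: "c t = t" if "t \<in> {a..b}" for t using that by (auto simp: c_def)
  have c_eq: "max a (min b t) = c t" for t by (simp add: c_def)
  have contc: "continuous_on UNIV c" unfolding c_def by (intro continuous_intros)
  define C where "C = {z :: real \<Rightarrow>\<^sub>C 'b. \<forall>t. apply_bcontfun z t \<in> B}"
  define S where "S = {z :: real \<Rightarrow>\<^sub>C 'b. (\<forall>t. apply_bcontfun z t \<in> B) \<and>
      (\<forall>t. apply_bcontfun z t = apply_bcontfun z (max a (min b t))) \<and>
      (\<forall>e>0. \<forall>s\<in>{a..b}. \<forall>t\<in>{a..b}. \<bar>s - t\<bar> < \<delta> e \<longrightarrow> norm (apply_bcontfun z s - apply_bcontfun z t) \<le> e)}"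
  have CY: "apply_bcontfun z \<in> Y" if "z \<in> C" for z using that by (auto simp: C_def Y)
  define F where "F = (\<lambda>z. Bcontfun (\<lambda>t. \<Phi> (apply_bcontfun z) (c t)))"
  have F: "apply_bcontfun (F z) t = \<Phi> (apply_bcontfun z) (c t)" if "z \<in> C" for z t
  proof -
    have "continuous_on {a..b} (\<Phi> (apply_bcontfun z))"
      unfolding continuous_on_iff
    proof (intro ballI allI impI)
      fix x e :: real assume x: "x \<in> {a..b}" "e > 0"
      then show "\<exists>d>0. \<forall>x'\<in>{a..b}. dist x' x < d \<longrightarrow> dist (\<Phi> (apply_bcontfun z) x') (\<Phi> (apply_bcontfun z) x) < e"
        using \<delta>(1)[of "e/2"] \<delta>(2)[of "e/2", OF _ CY[OF that] _ x(1)]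
        by (intro exI[of _ "\<delta> (e/2)"]) (force simp: dist_norm)
    qed
    then have "continuous_on UNIV (\<lambda>t. \<Phi> (apply_bcontfun z) (c t))"
      by (rule continuous_on_compose2[OF _ contc]) (use c in auto)
    moreover have "bounded (range (\<lambda>t. \<Phi> (apply_bcontfun z) (c t)))"
      by (rule bounded_subset[OF compact_imp_bounded[OF B(1)]]) (use into[OF CY[OF that]] c in auto)
    ultimately show ?thesis unfolding F_def by (subst Bcontfun_inverse) (auto simp: bcontfun_def)
  qed
  obtain z where z: "z \<in> C" "F z = z"
  proof (rule schauder_fixpoint[of C F S])
    show "convex C"
      unfolding convex_def C_def using B(2) by (auto simp: convex_def)
    obtain x where "x \<in> B" using B(3) by blast
    then have "const_bcontfun x \<in> C" by (simp add: C_def)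
    then show "C \<noteq> {}" by blast
    show "S \<subseteq> C" unfolding S_def C_def by blast
    show "compact S"
      unfolding S_def by (rule compact_equicontinuous_bcontfun[OF ab B(1) \<delta>(1)])
    show "F ` C \<subseteq> S"
    proof safe
      fix z assume z: "z \<in> C"
      show "F z \<in> S"
        unfolding S_def mem_Collect_eq F[OF z] c_eq cc[OF c]
        using into[OF CY[OF z]] c cc \<delta>(2)[OF _ CY[OF z]] by simp
    qed
    show "continuous_on C F"
      unfolding continuous_on_iff
    proof (intro ballI allI impI)
      fix y and e :: real assume y: "y \<in> C" "e > 0"
      obtain d where d: "d > 0" "\<And>y z t. \<lbrakk>y \<in> Y; z \<in> Y; \<forall>t\<in>{a..b}. norm (y t - z t) < d; t \<in> {a..b}\<rbrakk> \<Longrightarrow>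
                 norm (\<Phi> y t - \<Phi> z t) \<le> e / 2"
        using cont[of "e/2"] y(2) by (metis half_gt_zero)
      have "dist (F z) (F y) < e" if z: "z \<in> C" "dist z y < d" for z
      proof -
        have "dist (F z) (F y) \<le> e / 2"
        proof (rule dist_bound)
          fix t
          show "dist (F z t) (F y t) \<le> e / 2"
            unfolding F[OF z(1)] F[OF y(1)] dist_norm
            using dist_fun_lt_imp_dist_val_lt[OF z(2)] c
            by (intro d(2) CY z y) (auto simp: dist_norm)
        qed
        with y(2) show ?thesis by simp
      qed
      with d(1) show "\<exists>d>0. \<forall>x'\<in>C. dist x' y < d \<longrightarrow> dist (F x') (F y) < e" by blast
    qed
  qed
  have "\<Phi> (apply_bcontfun z) t = apply_bcontfun z t" if "t \<in> {a..b}" for t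
    using F[OF z(1), of t] cc[OF that] z(2) by simp
  with CY[OF z(1)] show thesis by (rule that)
qed

section \<open>Riemann-Liouville integrals\<close>

lemma has_integral_kernel:
  fixes \<gamma> r t :: real
  assumes "0 < \<gamma>" "r \<le> t"
  shows "((\<lambda>s. (t - s) powr (\<gamma> - 1)) has_integral (t - r) powr \<gamma> / \<gamma>) {r..t}"
proof -
  have "((\<lambda>x. x powr (\<gamma> - 1)) has_integral ((t - r) powr \<gamma> / \<gamma>)) (cbox 0 (t - r))"
    using has_integral_powr_from_0[of "\<gamma> - 1" "t - r"] assms by simp
  from has_integral_affinity[OF this, of "-1" t] have
    "((\<lambda>s. (t - s) powr (\<gamma> - 1)) has_integral (t - r) powr \<gamma> / \<gamma>) ((\<lambda>x. t - x) ` {0..t - r})"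
    by (simp add: algebra_simps)
  also have "(\<lambda>x. t - x) ` {0..t - r} = {r..t}" using assms(2) by simp
  finally show ?thesis .
qed

text \<open>
The kernel is unbounded near \<open>t\<close> if \<open>\<gamma> < 1\<close>, but integrable, and \<open>h\<close> is bounded.
\<close>

lemma absolutely_integrable_kernel_mult:
  fixes h :: "real \<Rightarrow> real"
  assumes "0 < \<gamma>" "continuous_on {0..t} h"
  shows "(\<lambda>s. (t - s) powr (\<gamma> - 1) * h s) absolutely_integrable_on {0..t}"
proof (cases "0 \<le> t")
  case True
  have "(\<lambda>s. h s * (t - s) powr (\<gamma> - 1)) absolutely_integrable_on {0..t}"
  proof (rule absolutely_integrable_bounded_measurable_product_real)
    show "h \<in> borel_measurable (lebesgue_on {0..t})"
      using assms(2) by (rule continuous_imp_measurable_on_sets_lebesgue) simp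
    show "bounded (h ` {0..t})"
      using assms(2) by (intro compact_imp_bounded compact_continuous_image) auto
    show "(\<lambda>s. (t - s) powr (\<gamma> - 1)) absolutely_integrable_on {0..t}"
      by (rule nonnegative_absolutely_integrable_1)
        (use has_integral_kernel[OF assms(1) True] in \<open>auto simp: integrable_on_def\<close>)
  qed simp
  then show ?thesis by (simp add: mult.commute)
qed simp

lemma integrable_kernel_mult:
  fixes h :: "real \<Rightarrow> real"
  assumes "0 < \<gamma>" "continuous_on {0..t} h"
  shows "(\<lambda>s. (t - s) powr (\<gamma> - 1) * h s) integrable_on {0..t}"
  using absolutely_integrable_kernel_mult[OF assms] set_lebesgue_integral_eq_integral(1) by blast

lemma RL_integral_cong:
  assumes "\<And>s. s \<in> {0..t} \<Longrightarrow> h s = k s"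
  shows "RL_integral \<gamma> h t = RL_integral \<gamma> k t"
  unfolding RL_integral_def using assms by (metis (no_types, lifting) integral_cong)

lemma RL_integral_cmult: "RL_integral \<gamma> (\<lambda>s. c * h s) t = c * RL_integral \<gamma> h t"
proof -
  have "(\<lambda>s. (t - s) powr (\<gamma> - 1) * (c * h s)) = (\<lambda>s. c * ((t - s) powr (\<gamma> - 1) * h s))"
    by (simp add: algebra_simps)
  then show ?thesis by (simp add: RL_integral_def)
qed

lemma RL_integral_add:
  assumes "0 < \<gamma>" "continuous_on {0..t} h" "continuous_on {0..t} k"
  shows "RL_integral \<gamma> (\<lambda>s. h s + k s) t = RL_integral \<gamma> h t + RL_integral \<gamma> k t"
  unfolding RL_integral_def
  using integral_add[OF integrable_kernel_mult[OF assms(1,2)] integrable_kernel_mult[OF assms(1,3)]]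
  by (simp add: distrib_left)

lemma RL_integral_diff:
  assumes "0 < \<gamma>" "continuous_on {0..t} h" "continuous_on {0..t} k"
  shows "RL_integral \<gamma> (\<lambda>s. h s - k s) t = RL_integral \<gamma> h t - RL_integral \<gamma> k t"
  unfolding RL_integral_def
  using integral_diff[OF integrable_kernel_mult[OF assms(1,2)] integrable_kernel_mult[OF assms(1,3)]]
  by (simp add: right_diff_distrib)

lemma RL_integral_at_0 [simp]: "RL_integral \<gamma> h 0 = 0"
  by (simp add: RL_integral_def)

lemma RL_integral_bound:
  assumes "0 < \<gamma>" "0 \<le> t" "continuous_on {0..t} h" "\<And>s. s \<in> {0..t} \<Longrightarrow> \<bar>h s\<bar> \<le> M"
  shows "\<bar>RL_integral \<gamma> h t\<bar> \<le> M * t powr \<gamma> / Gamma (\<gamma> + 1)"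
proof -
  have "norm (integral {0..t} (\<lambda>s. (t - s) powr (\<gamma> - 1) * h s)) \<le> integral {0..t} (\<lambda>s. M * (t - s) powr (\<gamma> - 1))"
  proof (rule integral_norm_bound_integral)
    show "(\<lambda>s. M * (t - s) powr (\<gamma> - 1)) integrable_on {0..t}"
      by (rule has_integral_integrable[OF has_integral_mult_right[OF has_integral_kernel[OF assms(1,2)]]])
  qed (use assms in \<open>auto intro!: integrable_kernel_mult simp: abs_mult mult.commute[of M] mult_left_mono\<close>)
  also have "\<dots> = M * (t powr \<gamma> / \<gamma>)"
    using integral_unique[OF has_integral_kernel[OF assms(1,2)]] by simp
  finally have "\<bar>RL_integral \<gamma> h t\<bar> \<le> 1 / Gamma \<gamma> * (M * (t powr \<gamma> / \<gamma>))"
    unfolding RL_integral_def abs_mult using Gamma_real_pos[OF assms(1)] by (intro mult_mono) auto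
  moreover have "Gamma (\<gamma> + 1) = \<gamma> * Gamma \<gamma>" using assms(1) by (intro Gamma_plus1) auto
  ultimately show ?thesis by (simp add: mult.commute)
qed

text \<open>
Moving the upper limit from \<open>s\<close> to \<open>t\<close> changes the integral over \<open>[0,s]\<close> through the kernel and adds the
integral over \<open>[s,t]\<close>. Both are controlled by the explicit primitive of the kernel, uniformly in all \<open>h\<close>
bounded by \<open>M\<close>; this is the source of equicontinuity.
\<close>

lemma RL_integral_increment:
  assumes "0 < \<gamma>" "0 \<le> s" "s \<le> t" and h: "continuous_on {0..t} h" and M: "\<And>r. r \<in> {0..t} \<Longrightarrow> \<bar>h r\<bar> \<le> M"
  shows "\<bar>RL_integral \<gamma> h t - RL_integral \<gamma> h s\<bar> \<le>
           M / Gamma (\<gamma> + 1) * (\<bar>t powr \<gamma> - s powr \<gamma>\<bar> + 2 * (t - s) powr \<gamma>)"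
proof -
  define k where "k = (\<lambda>t r :: real. (t - r) powr (\<gamma> - 1))"
  have t: "0 \<le> t" using assms by linarith
  have M0: "M \<ge> 0" using M[of 0] t by fastforce
  have hs: "continuous_on {0..s} h" using h \<open>s \<le> t\<close> by (auto intro: continuous_on_subset)
  have kt: "(\<lambda>r. k t r * h r) absolutely_integrable_on {0..t}" and ks: "(\<lambda>r. k s r * h r) integrable_on {0..s}"
    unfolding k_def using absolutely_integrable_kernel_mult[OF assms(1) h] integrable_kernel_mult[OF assms(1) hs] by auto
  have kt': "(\<lambda>r. k t r * h r) integrable_on {0..t}" "(\<lambda>r. k t r * h r) integrable_on {0..s}"
    "(\<lambda>r. k t r * h r) integrable_on {s..t}"
    using absolutely_integrable_on_subinterval[OF kt] assms(2,3)
    by (auto intro!: set_lebesgue_integral_eq_integral(1))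
  have k0: "(k t has_integral (t powr \<gamma> / \<gamma>)) {0..t}" "(k t has_integral ((t - s) powr \<gamma> / \<gamma>)) {s..t}"
    "(k s has_integral (s powr \<gamma> / \<gamma>)) {0..s}"
    unfolding k_def using has_integral_kernel[OF assms(1), of 0 t] has_integral_kernel[OF assms(1), of s t]
      has_integral_kernel[OF assms(1), of 0 s] assms t by auto
  have k1: "(k t has_integral (t powr \<gamma> / \<gamma> - (t - s) powr \<gamma> / \<gamma>)) {0..s}"
  proof -
    have "k t integrable_on {0..s}"
      by (rule integrable_subinterval_real[OF has_integral_integrable[OF k0(1)]]) (use assms(2,3) in auto)
    then obtain i where i: "(k t has_integral i) {0..s}" by (auto simp: integrable_on_def)
    from has_integral_combine[OF assms(2,3) i k0(2)] k0(1) have "i + (t - s) powr \<gamma> / \<gamma> = t powr \<gamma> / \<gamma>"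
      by (rule has_integral_unique)
    then have "i = t powr \<gamma> / \<gamma> - (t - s) powr \<gamma> / \<gamma>" by simp
    with i show ?thesis by simp
  qed
  define D where "D = \<bar>t powr \<gamma> / \<gamma> - (t - s) powr \<gamma> / \<gamma> - s powr \<gamma> / \<gamma>\<bar>"
  \<comment> \<open>The difference of the two kernels has constant sign, so the integral of its modulus is known.\<close>
  have absd: "((\<lambda>r. \<bar>k t r - k s r\<bar>) has_integral D) {0..s}"
  proof (cases "\<gamma> \<ge> 1")
    case True
    have nn: "k t r - k s r \<ge> 0" if "r \<in> {0..s}" for r
      using that assms True by (auto simp: k_def intro!: powr_mono2)
    have *: "((\<lambda>r. k t r - k s r) has_integral (t powr \<gamma> / \<gamma> - (t - s) powr \<gamma> / \<gamma> - s powr \<gamma> / \<gamma>)) {0..s}"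
      by (intro has_integral_diff k1 k0)
    then have "D = t powr \<gamma> / \<gamma> - (t - s) powr \<gamma> / \<gamma> - s powr \<gamma> / \<gamma>"
      using has_integral_nonneg[OF * nn] by (simp add: D_def)
    with has_integral_eq[OF _ *, of "\<lambda>r. \<bar>k t r - k s r\<bar>"] nn show ?thesis by simp
  next
    case False
    have nn: "k s r - k t r \<ge> 0" if "r \<in> {0..s} - {s}" for r
      using that assms False by (auto simp: k_def intro!: powr_mono2')
    have *: "((\<lambda>r. k s r - k t r) has_integral (s powr \<gamma> / \<gamma> - (t powr \<gamma> / \<gamma> - (t - s) powr \<gamma> / \<gamma>))) {0..s}"
      by (intro has_integral_diff k1 k0)
    have **: "((\<lambda>r. \<bar>k t r - k s r\<bar>) has_integral (s powr \<gamma> / \<gamma> - (t powr \<gamma> / \<gamma> - (t - s) powr \<gamma> / \<gamma>))) {0..s}"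
      by (rule has_integral_spike_finite[OF _ _ *, of "{s}"]) (use nn in force)+
    then have "D = s powr \<gamma> / \<gamma> - (t powr \<gamma> / \<gamma> - (t - s) powr \<gamma> / \<gamma>)"
      using has_integral_nonneg[OF **] by (simp add: D_def)
    with ** show ?thesis by simp
  qed
  have "integral {0..t} (\<lambda>r. k t r * h r) - integral {0..s} (\<lambda>r. k s r * h r)
      = integral {0..s} (\<lambda>r. (k t r - k s r) * h r) + integral {s..t} (\<lambda>r. k t r * h r)"
    using Henstock_Kurzweil_Integration.integral_combine[OF assms(2,3) kt'(1)] integral_diff[OF kt'(2) ks]
    by (simp add: left_diff_distrib)
  moreover have "norm (integral {0..s} (\<lambda>r. (k t r - k s r) * h r)) \<le> integral {0..s} (\<lambda>r. M * \<bar>k t r - k s r\<bar>)"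
  proof (rule integral_norm_bound_integral)
    show "(\<lambda>r. (k t r - k s r) * h r) integrable_on {0..s}"
      using integrable_diff[OF kt'(2) ks] by (simp add: left_diff_distrib)
    show "(\<lambda>r. M * \<bar>k t r - k s r\<bar>) integrable_on {0..s}"
      by (rule has_integral_integrable[OF has_integral_mult_right[OF absd]])
  qed (use M assms in \<open>auto simp: abs_mult mult.commute[of M] mult_left_mono\<close>)
  moreover have "integral {0..s} (\<lambda>r. M * \<bar>k t r - k s r\<bar>) = M * D"
    using integral_unique[OF absd] by simp
  moreover have "norm (integral {s..t} (\<lambda>r. k t r * h r)) \<le> integral {s..t} (\<lambda>r. M * k t r)"
  proof (rule integral_norm_bound_integral)
    show "(\<lambda>r. M * k t r) integrable_on {s..t}"
      by (rule has_integral_integrable[OF has_integral_mult_right[OF k0(2)]])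
  qed (use M assms kt' in \<open>auto simp: abs_mult mult.commute[of M] mult_left_mono k_def\<close>)
  moreover have "integral {s..t} (\<lambda>r. M * k t r) = M * ((t - s) powr \<gamma> / \<gamma>)"
    using integral_unique[OF k0(2)] by simp
  ultimately have "\<bar>integral {0..t} (\<lambda>r. k t r * h r) - integral {0..s} (\<lambda>r. k s r * h r)\<bar>
      \<le> M * D + M * ((t - s) powr \<gamma> / \<gamma>)"
    unfolding real_norm_def by linarith
  also have "\<dots> = M * (D + (t - s) powr \<gamma> / \<gamma>)" by (simp add: distrib_left)
  also have "\<dots> \<le> M * ((\<bar>t powr \<gamma> - s powr \<gamma>\<bar> + 2 * (t - s) powr \<gamma>) / \<gamma>)"
  proof (rule mult_left_mono[OF _ M0])
    have "D = \<bar>t powr \<gamma> - (t - s) powr \<gamma> - s powr \<gamma>\<bar> / \<gamma>"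
      using assms(1) by (simp add: D_def abs_divide flip: diff_divide_distrib)
    also have "\<dots> \<le> (\<bar>t powr \<gamma> - s powr \<gamma>\<bar> + (t - s) powr \<gamma>) / \<gamma>"
      using assms(1) powr_ge_zero[of "t - s" \<gamma>] by (intro divide_right_mono) linarith+
    finally show "D + (t - s) powr \<gamma> / \<gamma> \<le> (\<bar>t powr \<gamma> - s powr \<gamma>\<bar> + 2 * (t - s) powr \<gamma>) / \<gamma>"
      by (simp add: add_divide_distrib)
  qed
  finally have "\<bar>RL_integral \<gamma> h t - RL_integral \<gamma> h s\<bar> \<le>
      1 / Gamma \<gamma> * (M * ((\<bar>t powr \<gamma> - s powr \<gamma>\<bar> + 2 * (t - s) powr \<gamma>) / \<gamma>))"
    unfolding RL_integral_def k_def right_diff_distrib[symmetric] abs_mult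
    using Gamma_real_pos[OF assms(1)] by (intro mult_mono) auto
  moreover have "Gamma (\<gamma> + 1) = \<gamma> * Gamma \<gamma>" using assms(1) by (intro Gamma_plus1) auto
  ultimately show ?thesis by (simp add: mult.commute)
qed

lemma RL_integral_equicontinuous:
  assumes "0 < \<gamma>" "0 < e"
  shows "\<exists>d>0. \<forall>h. continuous_on {0..T} h \<longrightarrow> (\<forall>r\<in>{0..T}. \<bar>h r\<bar> \<le> M) \<longrightarrow>
           (\<forall>s\<in>{0..T}. \<forall>t\<in>{0..T}. \<bar>s - t\<bar> < d \<longrightarrow> \<bar>RL_integral \<gamma> h s - RL_integral \<gamma> h t\<bar> \<le> e)"
proof (cases "M \<ge> 0 \<and> T \<ge> 0")
  case True
  define c where "c = M / Gamma (\<gamma> + 1) + 1"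
  have Gp: "Gamma (\<gamma> + 1) > 0" using assms(1) by (intro Gamma_real_pos) auto
  have c: "c \<ge> 1" "M / Gamma (\<gamma> + 1) \<le> c" using True Gp by (auto simp: c_def)
  have "uniformly_continuous_on {0..T} (\<lambda>t :: real. t powr \<gamma>)"
    using assms(1) by (intro compact_uniformly_continuous continuous_on_powr' continuous_intros) auto
  moreover have "e / (3 * c) > 0" using assms(2) c(1) by simp
  ultimately have "\<exists>d>0. \<forall>s\<in>{0..T}. \<forall>t\<in>{0..T}. dist t s < d \<longrightarrow> dist (t powr \<gamma>) (s powr \<gamma>) < e / (3 * c)"
    unfolding uniformly_continuous_on_def by blast
  then obtain d where d: "d > 0" "\<And>s t. \<lbrakk>s \<in> {0..T}; t \<in> {0..T}; dist t s < d\<rbrakk> \<Longrightarrow> dist (t powr \<gamma>) (s powr \<gamma>) < e / (3 * c)"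
    by blast
  show ?thesis
  proof (intro exI[of _ d] conjI allI impI ballI)
    fix h s t
    assume h: "continuous_on {0..T} h" "\<forall>r\<in>{0..T}. \<bar>h r\<bar> \<le> M" and st: "s \<in> {0..T}" "t \<in> {0..T}" "\<bar>s - t\<bar> < d"
    have *: "\<bar>RL_integral \<gamma> h v - RL_integral \<gamma> h u\<bar> \<le> e"
      if uv: "0 \<le> u" "u \<le> v" "v \<le> T" "v - u < d" for u v
    proof -
      have "\<bar>v powr \<gamma> - u powr \<gamma>\<bar> \<le> e / (3 * c)" using d(2)[of u v] uv by (auto simp: dist_real_def)
      moreover have "(v - u) powr \<gamma> \<le> e / (3 * c)"
        using d(2)[of 0 "v - u"] uv by (auto simp: dist_real_def)
      ultimately have "\<bar>v powr \<gamma> - u powr \<gamma>\<bar> + 2 * (v - u) powr \<gamma> \<le> e / c" by (simp add: field_simps)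
      then have "M / Gamma (\<gamma> + 1) * (\<bar>v powr \<gamma> - u powr \<gamma>\<bar> + 2 * (v - u) powr \<gamma>) \<le> c * (e / c)"
        using c True Gp by (intro mult_mono) auto
      moreover have "continuous_on {0..v} h" by (rule continuous_on_subset[OF h(1)]) (use uv in auto)
      ultimately show ?thesis
        using RL_integral_increment[OF assms(1) uv(1,2), of h M] h(2) uv c(1) by simp
    qed
    show "\<bar>RL_integral \<gamma> h s - RL_integral \<gamma> h t\<bar> \<le> e"
    proof (cases "s \<le> t")
      case True
      with *[of s t] st show ?thesis by (simp add: abs_minus_commute)
    next
      case False
      with *[of t s] st show ?thesis by simp
    qed
  qed (rule d(1))
next
  case False
  have "\<not> ((\<forall>r\<in>{0..T}. \<bar>h r\<bar> \<le> M) \<and> s \<in> {0..T})" for h :: "real \<Rightarrow> real" and s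
  proof
    assume *: "(\<forall>r\<in>{0..T}. \<bar>h r\<bar> \<le> M) \<and> s \<in> {0..T}"
    then have "\<bar>h s\<bar> \<le> M" by blast
    then have "0 \<le> M" by (rule order_trans[OF abs_ge_zero])
    with * False show False by simp
  qed
  then show ?thesis by (intro exI[of _ 1] conjI zero_less_one) blast
qed

lemma continuous_on_RL_integral:
  assumes "0 < \<gamma>" "continuous_on {0..T} h"
  shows "continuous_on {0..T} (RL_integral \<gamma> h)"
  unfolding continuous_on_iff
proof (intro ballI allI impI)
  fix t e :: real assume t: "t \<in> {0..T}" "e > 0"
  have "bounded (h ` {0..T})"
    using assms(2) by (intro compact_imp_bounded compact_continuous_image) auto
  then obtain M where "\<forall>r\<in>{0..T}. \<bar>h r\<bar> \<le> M" by (auto simp: bounded_iff)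
  then obtain d where d: "d > 0" "\<And>s t. \<lbrakk>s \<in> {0..T}; t \<in> {0..T}; \<bar>s - t\<bar> < d\<rbrakk> \<Longrightarrow> \<bar>RL_integral \<gamma> h s - RL_integral \<gamma> h t\<bar> \<le> e / 2"
    using RL_integral_equicontinuous[OF assms(1), of "e / 2" T M] t(2) assms(2) by (metis half_gt_zero)
  have "dist (RL_integral \<gamma> h s) (RL_integral \<gamma> h t) < e" if "s \<in> {0..T}" "dist s t < d" for s
    using d(2)[OF that(1) t(1)] that(2) t(2) by (simp add: dist_real_def)
  with d(1) show "\<exists>d>0. \<forall>s\<in>{0..T}. dist s t < d \<longrightarrow> dist (RL_integral \<gamma> h s) (RL_integral \<gamma> h t) < e"
    by blast
qed

text \<open>
After scaling to \<open>[0,1]\<close> this is Euler's Beta integral.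
\<close>

lemma RL_integral_powr:
  assumes "0 < \<gamma>" "-1 < p" "0 \<le> t"
  shows "RL_integral \<gamma> (\<lambda>s. s powr p) t = Gamma (p + 1) / Gamma (p + 1 + \<gamma>) * t powr (p + \<gamma>)"
proof (cases "t = 0")
  case False
  then have t: "t > 0" using assms(3) by simp
  have "((\<lambda>x. x powr (p + 1 - 1) * (1 - x) powr (\<gamma> - 1)) has_integral Beta (p + 1) \<gamma>) {0..1}"
    using assms by (intro has_integral_Beta_real) auto
  then have "((\<lambda>x. t powr (p + \<gamma> - 1) * (x powr p * (1 - x) powr (\<gamma> - 1))) has_integral t powr (p + \<gamma> - 1) * Beta (p + 1) \<gamma>) {0..1}"
    by (intro has_integral_mult_right) simp
  from has_integral_stretch_real[OF this, of "1 / t"] t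
  have "((\<lambda>s. t powr (p + \<gamma> - 1) * ((s / t) powr p * (1 - s / t) powr (\<gamma> - 1))) has_integral
      t * (t powr (p + \<gamma> - 1) * Beta (p + 1) \<gamma>)) ((\<lambda>x. x * t) ` {0..1})"
    by simp
  moreover have "(\<lambda>x. x * t) ` {0..1} = {0..t}" unfolding mult.commute[of _ t] using t by (subst image_mult_atLeastAtMost) auto
  moreover have "t powr (p + \<gamma> - 1) * ((s / t) powr p * (1 - s / t) powr (\<gamma> - 1)) = (t - s) powr (\<gamma> - 1) * s powr p"
    if "s \<in> {0..t}" for s
  proof -
    have "(s / t) powr p = s powr p / t powr p" using that t by (simp add: powr_divide)
    moreover have "1 - s / t = (t - s) / t" using t by (simp add: field_simps)
    then have "(1 - s / t) powr (\<gamma> - 1) = (t - s) powr (\<gamma> - 1) / t powr (\<gamma> - 1)"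
      using that t by (simp add: powr_divide)
    moreover have "t powr (p + \<gamma> - 1) = t powr p * t powr (\<gamma> - 1)" by (simp flip: powr_add add: algebra_simps)
    ultimately show ?thesis using t by simp
  qed
  ultimately have "((\<lambda>s. (t - s) powr (\<gamma> - 1) * s powr p) has_integral t * (t powr (p + \<gamma> - 1) * Beta (p + 1) \<gamma>)) {0..t}"
    by (metis (no_types, lifting) has_integral_cong)
  moreover have "t * t powr (p + \<gamma> - 1) = t powr (p + \<gamma>)" using t by (simp add: powr_mult_base)
  moreover have "Gamma \<gamma> \<noteq> 0" using Gamma_real_pos[OF assms(1)] by simp
  ultimately show ?thesis
    by (simp add: RL_integral_def integral_unique Beta_def mult.assoc[symmetric])
qed simp

lemma RL_integral_power:
  assumes "0 < \<gamma>" "0 \<le> t"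
  shows "RL_integral \<gamma> (\<lambda>s. s ^ n) t = fact n / Gamma (real n + 1 + \<gamma>) * t powr (real n + \<gamma>)"
proof -
  \<comment> \<open>The two integrands may differ at \<open>0\<close>, where \<open>0 powr 0 = 0\<close>.\<close>
  have "RL_integral \<gamma> (\<lambda>s. s ^ n) t = RL_integral \<gamma> (\<lambda>s. s powr real n) t"
    unfolding RL_integral_def
    by (intro arg_cong2[of _ _ _ _ "(*)"] refl integral_spike[of "{0}"]) (auto simp: powr_realpow)
  also have "\<dots> = Gamma (real n + 1) / Gamma (real n + 1 + \<gamma>) * t powr (real n + \<gamma>)"
    using assms by (intro RL_integral_powr) auto
  also have "Gamma (real n + 1) = fact n"
    by (metis Gamma_fact add.commute)
  finally show ?thesis .
qed

lemma RL_integral_semigroup_power: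
  assumes "0 < a" "0 < b" "0 \<le> t"
  shows "RL_integral a (RL_integral b (\<lambda>s. s ^ n)) t = RL_integral (a + b) (\<lambda>s. s ^ n) t"
proof -
  have "RL_integral a (RL_integral b (\<lambda>s. s ^ n)) t =
      RL_integral a (\<lambda>s. fact n / Gamma (real n + 1 + b) * s powr (real n + b)) t"
    using assms by (intro RL_integral_cong) (auto simp: RL_integral_power)
  also have "\<dots> = fact n / Gamma (real n + 1 + b) * (Gamma (real n + b + 1) / Gamma (real n + b + 1 + a) * t powr (real n + b + a))"
    unfolding RL_integral_cmult using assms by (subst RL_integral_powr) auto
  also have "\<dots> = fact n / Gamma (real n + 1 + (a + b)) * t powr (real n + (a + b))"
  proof -
    have "Gamma (1 + (b + real n)) > 0" using assms by (intro Gamma_real_pos) auto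
    then show ?thesis by (simp add: algebra_simps)
  qed
  finally show ?thesis using assms by (simp add: RL_integral_power)
qed

lemma RL_integral_semigroup_polynomial:
  assumes "0 < a" "0 < b" "0 \<le> t"
  shows "RL_integral a (RL_integral b (\<lambda>s. \<Sum>i\<le>n. c i * s ^ i)) t = RL_integral (a + b) (\<lambda>s. \<Sum>i\<le>n. c i * s ^ i) t"
proof (induction n)
  case 0
  have *: "RL_integral b (\<lambda>s. c 0 * s ^ 0) = (\<lambda>s. c 0 * RL_integral b (\<lambda>s. s ^ 0) s)"
    by (intro ext RL_integral_cmult)
  show ?case
    unfolding atMost_0 sum.insert_if[OF finite.emptyI] * RL_integral_cmult
    by (simp add: * RL_integral_cmult RL_integral_semigroup_power[OF assms] del: power_0)
next
  case (Suc n)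
  define p where "p = (\<lambda>s :: real. \<Sum>i\<le>n. c i * s ^ i)"
  define q where "q = (\<lambda>s :: real. s ^ Suc n)"
  have cont: "continuous_on X p" "continuous_on X q" "continuous_on X (\<lambda>s. c (Suc n) * q s)" for X
    by (auto simp: p_def q_def intro!: continuous_intros)
  have "RL_integral b (\<lambda>s. p s + c (Suc n) * q s) = (\<lambda>s. RL_integral b p s + c (Suc n) * RL_integral b q s)"
    using assms by (intro ext) (simp add: RL_integral_add cont RL_integral_cmult)
  then have "RL_integral a (RL_integral b (\<lambda>s. p s + c (Suc n) * q s)) t
      = RL_integral a (RL_integral b p) t + c (Suc n) * RL_integral a (RL_integral b q) t"
    using assms by (simp add: RL_integral_add cont RL_integral_cmult continuous_on_RL_integral continuous_on_mult_left)
  also have "\<dots> = RL_integral (a + b) p t + c (Suc n) * RL_integral (a + b) q t"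
    using Suc RL_integral_semigroup_power[OF assms, of "Suc n"] by (simp add: p_def q_def)
  also have "\<dots> = RL_integral (a + b) (\<lambda>s. p s + c (Suc n) * q s) t"
    using assms by (simp add: RL_integral_add cont RL_integral_cmult)
  finally show ?case by (simp add: p_def q_def)
qed

text \<open>
On polynomials the law is the power rule. Both sides are bounded by a constant times the supremum of \<open>h\<close>, so
the Weierstrass approximation theorem extends it to continuous \<open>h\<close>, without interchanging integrals.
\<close>

theorem RL_integral_semigroup:
  assumes ab: "0 < a" "0 < b" and t: "0 \<le> t" and h: "continuous_on {0..t} h"
  shows "RL_integral a (RL_integral b h) t = RL_integral (a + b) h t"
proof -
  define C where "C = t powr b / Gamma (b + 1) * t powr a / Gamma (a + 1) + t powr (a + b) / Gamma (a + b + 1)"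
  have G: "Gamma (a + 1) > 0" "Gamma (b + 1) > 0" "Gamma (a + b + 1) > 0" using ab by (auto intro!: Gamma_real_pos)
  have C: "C \<ge> 0" using G by (auto simp: C_def)
  have le: "\<bar>RL_integral a (RL_integral b h) t - RL_integral (a + b) h t\<bar> \<le> e * C" if "e > 0" for e
  proof -
    obtain p where "real_polynomial_function p" and he: "\<And>s. s \<in> {0..t} \<Longrightarrow> \<bar>h s - p s\<bar> < e"
      using Stone_Weierstrass_real_polynomial_function[OF _ h \<open>e > 0\<close>] by auto
    then obtain c n where p: "p = (\<lambda>s. \<Sum>i\<le>n. c i * s ^ i)" by (auto simp: real_polynomial_function_iff_sum)
    define r where "r = (\<lambda>s. h s - p s)"
    have cp: "continuous_on X p" for X by (auto simp: p intro!: continuous_intros)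
    have hs: "continuous_on {0..s} h" if "s \<le> t" for s by (rule continuous_on_subset[OF h]) (use that in auto)
    have cr: "continuous_on {0..s} r" if "s \<le> t" for s unfolding r_def by (intro continuous_intros hs cp that)
    have rb: "\<bar>RL_integral b r s\<bar> \<le> e * t powr b / Gamma (b + 1)" if "s \<in> {0..t}" for s
    proof -
      have "\<bar>RL_integral b r s\<bar> \<le> e * s powr b / Gamma (b + 1)"
        using ab that he by (intro RL_integral_bound cr) (auto simp: r_def intro: less_imp_le)
      also have "\<dots> \<le> e * t powr b / Gamma (b + 1)"
        using that ab G \<open>e > 0\<close> by (intro divide_right_mono mult_left_mono powr_mono2) auto
      finally show ?thesis .
    qed
    have "RL_integral a (RL_integral b r) t = RL_integral a (\<lambda>s. RL_integral b h s - RL_integral b p s) t"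
      using ab hs cp by (intro RL_integral_cong) (simp add: r_def RL_integral_diff)
    also have "\<dots> = RL_integral a (RL_integral b h) t - RL_integral a (RL_integral b p) t"
      using ab by (intro RL_integral_diff continuous_on_RL_integral h cp)
    finally have 1: "RL_integral a (RL_integral b h) t - RL_integral (a + b) p t = RL_integral a (RL_integral b r) t"
      using RL_integral_semigroup_polynomial[OF ab t, of c n] by (simp add: p)
    have 2: "RL_integral (a + b) r t = RL_integral (a + b) h t - RL_integral (a + b) p t"
      unfolding r_def using ab by (intro RL_integral_diff h cp) auto
    have "\<bar>RL_integral a (RL_integral b r) t\<bar> \<le> (e * t powr b / Gamma (b + 1)) * t powr a / Gamma (a + 1)"
      using ab t rb by (intro RL_integral_bound continuous_on_RL_integral cr) auto
    moreover have "\<bar>RL_integral (a + b) r t\<bar> \<le> e * t powr (a + b) / Gamma (a + b + 1)"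
      using ab t he by (intro RL_integral_bound cr) (auto simp: r_def intro: less_imp_le)
    moreover have "RL_integral a (RL_integral b h) t - RL_integral (a + b) h t = RL_integral a (RL_integral b r) t - RL_integral (a + b) r t"
      using 1 2 by simp
    moreover have "(e * t powr b / Gamma (b + 1)) * t powr a / Gamma (a + 1) + e * t powr (a + b) / Gamma (a + b + 1) = e * C"
      by (simp add: C_def algebra_simps)
    ultimately show ?thesis by linarith
  qed
  have "\<bar>RL_integral a (RL_integral b h) t - RL_integral (a + b) h t\<bar> \<le> 0 + e" if "e > 0" for e
  proof -
    have "e / (C + 1) * C \<le> e" using C that by (simp add: field_simps)
    then show ?thesis using le[of "e / (C + 1)"] C that by fastforce
  qed
  then show ?thesis using field_le_epsilon[of "\<bar>RL_integral a (RL_integral b h) t - RL_integral (a + b) h t\<bar>" 0] by simp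
qed

lemma RL_integral_order_1: "RL_integral 1 h t = integral {0..t} h"
  unfolding RL_integral_def by (simp, rule integral_spike[of "{t}"]) auto

text \<open>
By the semigroup law, \<open>I\<^sup>1\<^sup>+\<^sup>\<gamma> h\<close> is the ordinary integral of the continuous function \<open>I\<^sup>\<gamma> h\<close>.
\<close>

lemma RL_integral_has_derivative:
  assumes "0 < \<gamma>" "continuous_on {0..T} h" "t \<in> {0..T}"
  shows "(RL_integral (1 + \<gamma>) h has_real_derivative RL_integral \<gamma> h t) (at t within {0..T})"
proof -
  have "((\<lambda>x. integral {0..x} (RL_integral \<gamma> h)) has_real_derivative RL_integral \<gamma> h t) (at t within {0..T})"
    using assms by (intro integral_has_real_derivative continuous_on_RL_integral)
  then show ?thesis
  proof (rule has_field_derivative_transform_within[OF _ zero_less_one assms(3)])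
    fix x assume "x \<in> {0..T}"
    then have "RL_integral 1 (RL_integral \<gamma> h) x = RL_integral (1 + \<gamma>) h x"
      using assms(1,2) by (intro RL_integral_semigroup) (auto intro: continuous_on_subset)
    then show "integral {0..x} (RL_integral \<gamma> h) = RL_integral (1 + \<gamma>) h x"
      by (simp add: RL_integral_order_1)
  qed
qed

text \<open>
The solutions of the linear boundary value problem and their Caputo derivatives have this form, with coefficients \<open>c1\<close> and \<open>c2\<close> that are bounded by the data;
the constant term \<open>c0\<close> cancels in increments.
\<close>

lemma RL_integral_affine_equicontinuous:
  fixes p q :: "real \<Rightarrow> real"
  assumes "0 < \<gamma>" "0 < e" "continuous_on {0..T} p" "continuous_on {0..T} q"
  obtains d where "d > 0" and
    "\<And>h c0 c1 c2 s t. \<lbrakk>continuous_on {0..T} h; \<forall>r\<in>{0..T}. \<bar>h r\<bar> \<le> M; \<bar>c1\<bar> \<le> C; \<bar>c2\<bar> \<le> C;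
        s \<in> {0..T}; t \<in> {0..T}; \<bar>s - t\<bar> < d\<rbrakk> \<Longrightarrow>
      \<bar>(RL_integral \<gamma> h s - c0 - c1 * p s - c2 * q s) - (RL_integral \<gamma> h t - c0 - c1 * p t - c2 * q t)\<bar> \<le> e"
proof -
  define e' where "e' = e / (3 * (\<bar>C\<bar> + 1))"
  have e': "e' > 0" "\<bar>C\<bar> * e' \<le> e / 3" using assms(2) by (auto simp: e'_def field_simps)
  have uc: "\<exists>d>0. \<forall>s\<in>{0..T}. \<forall>t\<in>{0..T}. \<bar>s - t\<bar> < d \<longrightarrow> \<bar>v s - v t\<bar> \<le> e'"
    if "continuous_on {0..T} v" for v :: "real \<Rightarrow> real"
  proof -
    have "uniformly_continuous_on {0..T} v" using that by (intro compact_uniformly_continuous) auto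
    then show ?thesis using e'(1) unfolding uniformly_continuous_on_def dist_real_def
      by (meson less_imp_le)
  qed
  from uc[OF assms(3)] obtain d1 where d1: "d1 > 0" "\<And>s t. \<lbrakk>s \<in> {0..T}; t \<in> {0..T}; \<bar>s - t\<bar> < d1\<rbrakk> \<Longrightarrow> \<bar>p s - p t\<bar> \<le> e'"
    by blast
  from uc[OF assms(4)] obtain d2 where d2: "d2 > 0" "\<And>s t. \<lbrakk>s \<in> {0..T}; t \<in> {0..T}; \<bar>s - t\<bar> < d2\<rbrakk> \<Longrightarrow> \<bar>q s - q t\<bar> \<le> e'"
    by blast
  have "e / 3 > 0" using assms(2) by simp
  from RL_integral_equicontinuous[OF assms(1) this, of T M] obtain d3 where d3: "d3 > 0"
    "\<And>h s t. \<lbrakk>continuous_on {0..T} h; \<forall>r\<in>{0..T}. \<bar>h r\<bar> \<le> M; s \<in> {0..T}; t \<in> {0..T}; \<bar>s - t\<bar> < d3\<rbrakk> \<Longrightarrow>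
        \<bar>RL_integral \<gamma> h s - RL_integral \<gamma> h t\<bar> \<le> e / 3"
    by blast
  show thesis
  proof (rule that[of "min d1 (min d2 d3)"])
    fix h c0 c1 c2 s t
    assume h: "continuous_on {0..T} h" "\<forall>r\<in>{0..T}. \<bar>h r\<bar> \<le> M" and c: "\<bar>c1\<bar> \<le> C" "\<bar>c2\<bar> \<le> C"
      and st: "s \<in> {0..T}" "t \<in> {0..T}" "\<bar>s - t\<bar> < min d1 (min d2 d3)"
    have small: "\<bar>x * y\<bar> \<le> e / 3" if "\<bar>x\<bar> \<le> C" "\<bar>y\<bar> \<le> e'" for x y
    proof -
      have "\<bar>x * y\<bar> \<le> \<bar>C\<bar> * e'" unfolding abs_mult by (rule mult_mono) (use that in auto)
      with e'(2) show ?thesis by linarith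
    qed
    have "\<bar>c1 * (p s - p t)\<bar> \<le> e / 3"
      by (rule small[OF c(1) d1(2)[OF st(1,2)]]) (use st(3) in simp)
    moreover have "\<bar>c2 * (q s - q t)\<bar> \<le> e / 3"
      by (rule small[OF c(2) d2(2)[OF st(1,2)]]) (use st(3) in simp)
    moreover have "\<bar>RL_integral \<gamma> h s - RL_integral \<gamma> h t\<bar> \<le> e / 3"
      by (rule d3(2)[OF h st(1,2)]) (use st(3) in simp)
    ultimately show "\<bar>(RL_integral \<gamma> h s - c0 - c1 * p s - c2 * q s) - (RL_integral \<gamma> h t - c0 - c1 * p t - c2 * q t)\<bar> \<le> e"
      unfolding right_diff_distrib by linarith
  qed (use d1 d2 d3 in auto)
qed

section \<open>Estimates by Lebesgue norms\<close>

text \<open>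
Young's inequality applied to the two functions divided by their norms, and integrated.
\<close>

lemma Hoelder_inequality:
  fixes f g :: "'a \<Rightarrow> real"
  assumes pq: "p > 1" "q > 1" "1 / p + 1 / q = 1"
    and meas: "f \<in> borel_measurable M" "g \<in> borel_measurable M"
    and nonneg: "\<And>x. x \<in> space M \<Longrightarrow> 0 \<le> f x" "\<And>x. x \<in> space M \<Longrightarrow> 0 \<le> g x"
    and int: "integrable M (\<lambda>x. f x powr p)" "integrable M (\<lambda>x. g x powr q)"
  shows "integrable M (\<lambda>x. f x * g x)"
    and "(\<integral>x. f x * g x \<partial>M) \<le> (\<integral>x. f x powr p \<partial>M) powr (1 / p) * (\<integral>x. g x powr q \<partial>M) powr (1 / q)"
proof -
  have young: "f x * g x \<le> f x powr p / p + g x powr q / q" if "x \<in> space M" for x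
    using Youngs_inequality[OF pq nonneg(1)[OF that] nonneg(2)[OF that]] .
  show fg: "integrable M (\<lambda>x. f x * g x)"
  proof (rule Bochner_Integration.integrable_bound)
    show "integrable M (\<lambda>x. f x powr p / p + g x powr q / q)" using int by simp
    show "(\<lambda>x. f x * g x) \<in> borel_measurable M" using meas by simp
    show "AE x in M. norm (f x * g x) \<le> norm (f x powr p / p + g x powr q / q)"
      using young nonneg pq by (intro AE_I2) (smt (verit) mult_nonneg_nonneg real_norm_def)
  qed
  define A where "A = (\<integral>x. f x powr p \<partial>M)"
  define B where "B = (\<integral>x. g x powr q \<partial>M)"
  have AB: "A \<ge> 0" "B \<ge> 0" by (simp_all add: A_def B_def)
  show "(\<integral>x. f x * g x \<partial>M) \<le> (\<integral>x. f x powr p \<partial>M) powr (1 / p) * (\<integral>x. g x powr q \<partial>M) powr (1 / q)"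
    unfolding A_def[symmetric] B_def[symmetric]
  proof (cases "A = 0 \<or> B = 0")
    case True
    then have "(AE x in M. f x powr p = 0) \<or> (AE x in M. g x powr q = 0)"
      using integral_nonneg_eq_0_iff_AE[OF int(1)] integral_nonneg_eq_0_iff_AE[OF int(2)]
      by (auto simp: A_def B_def)
    then have "AE x in M. f x * g x = 0" by (auto elim!: AE_mp)
    then have "(\<integral>x. f x * g x \<partial>M) = 0" by (simp cong: integral_cong_AE add: integral_eq_zero_AE)
    then show "(\<integral>x. f x * g x \<partial>M) \<le> A powr (1 / p) * B powr (1 / q)" by simp
  next
    case False
    with AB have pos: "A > 0" "B > 0" by auto
    define C where "C = A powr (1 / p) * B powr (1 / q)"
    have C: "C > 0" using pos by (simp add: C_def)
    have "(\<integral>x. f x * g x / C \<partial>M) \<le> (\<integral>x. f x powr p / A / p + g x powr q / B / q \<partial>M)"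
    proof (rule integral_mono)
      show "integrable M (\<lambda>x. f x * g x / C)" using fg by simp
      show "integrable M (\<lambda>x. f x powr p / A / p + g x powr q / B / q)" using int by simp
      fix x assume x: "x \<in> space M"
      have "(f x / A powr (1 / p)) * (g x / B powr (1 / q)) \<le>
          (f x / A powr (1 / p)) powr p / p + (g x / B powr (1 / q)) powr q / q"
        using nonneg x by (intro Youngs_inequality pq) auto
      also have "(f x / A powr (1 / p)) powr p = f x powr p / A"
        using nonneg(1)[OF x] pq pos by (simp add: powr_divide powr_powr)
      also have "(g x / B powr (1 / q)) powr q = g x powr q / B"
        using nonneg(2)[OF x] pq pos by (simp add: powr_divide powr_powr)
      finally show "f x * g x / C \<le> f x powr p / A / p + g x powr q / B / q"
        by (simp add: C_def)
    qed
    also have "\<dots> = (\<integral>x. f x powr p \<partial>M) / A / p + (\<integral>x. g x powr q \<partial>M) / B / q" using int by simp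
    also have "\<dots> = 1" using pos pq(3) by (simp add: A_def[symmetric] B_def[symmetric])
    finally show "(\<integral>x. f x * g x \<partial>M) \<le> A powr (1 / p) * B powr (1 / q)"
      using C by (simp add: C_def[symmetric] field_simps)
  qed
qed

text \<open>
The exponent conjugate to \<open>1 / \<tau>\<close> is \<open>p = 1 / (1 - \<tau>)\<close>, and the \<open>p\<close>-th power of the kernel is again a
Riemann-Liouville kernel, of order \<open>\<kappa> = (\<gamma> - \<tau>) / (1 - \<tau>)\<close>; it is integrable because \<open>\<tau> < \<gamma>\<close>.
\<close>

lemma RL_integral_Hoelder_bound:
  assumes \<tau>: "0 < \<tau>" "\<tau> < 1" "\<tau> < \<gamma>" and t: "0 \<le> t" "t \<le> T"
    and l: "l \<in> Lp_nonneg (1 / \<tau>) T" and h: "continuous_on {0..t} h"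
    and P: "0 \<le> P" and hl: "\<And>s. s \<in> {0..t} \<Longrightarrow> \<bar>h s\<bar> \<le> l s * P"
  shows "\<bar>RL_integral \<gamma> h t\<bar> \<le>
    P * Lp_norm (1 / \<tau>) T l * (t powr (\<gamma> - \<tau>) / Gamma \<gamma> * ((1 - \<tau>) / (\<gamma> - \<tau>)) powr (1 - \<tau>))"
proof -
  define p where "p = 1 / (1 - \<tau>)"
  define q where "q = 1 / \<tau>"
  have pq: "p > 1" "q > 1" "1 / p + 1 / q = 1" using \<tau> by (auto simp: p_def q_def)
  define M where "M = lebesgue_on {0..t}"
  define k where "k = (\<lambda>s. (t - s) powr (\<gamma> - 1))"
  have \<gamma>: "\<gamma> > 0" using \<tau> by simp
  have l0: "0 \<le> l s" if "s \<in> {0..T}" for s using l that by (auto simp: Lp_nonneg_def)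
  have lm: "l \<in> borel_measurable (lebesgue_on {0..T})" and li: "integrable (lebesgue_on {0..T}) (\<lambda>s. \<bar>l s\<bar> powr q)"
    using l by (auto simp: Lp_nonneg_def q_def)
  have lmt: "l \<in> borel_measurable M"
    unfolding M_def using lm t by (auto intro: measurable_restrict_mono)
  have "(\<lambda>s. \<bar>l s\<bar> powr q) absolutely_integrable_on {0..T}"
    using li by (simp add: set_integrable_def integrable_restrict_space)
  then have "(\<lambda>s. \<bar>l s\<bar> powr q) absolutely_integrable_on {0..t}"
    by (rule absolutely_integrable_on_subinterval) (use t in auto)
  then have lit': "integrable M (\<lambda>s. \<bar>l s\<bar> powr q)"
    unfolding M_def by (rule absolutely_integrable_imp_integrable) simp
  have le: "(\<integral>s. \<bar>l s\<bar> powr q \<partial>M) \<le> (\<integral>s. \<bar>l s\<bar> powr q \<partial>lebesgue_on {0..T})"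
    using lebesgue_integral_eq_integral[OF li] lebesgue_integral_eq_integral[OF lit'[unfolded M_def]]
      integrable_on_lebesgue_on[OF li] integrable_on_lebesgue_on[OF lit'[unfolded M_def]] t
    by (auto simp: M_def intro!: integral_subset_le)
  have lit: "integrable M (\<lambda>s. l s powr q)" "(\<integral>s. l s powr q \<partial>M) = (\<integral>s. \<bar>l s\<bar> powr q \<partial>M)"
  proof -
    have "\<bar>l s\<bar> = l s" if "s \<in> space M" for s using that l0 t by (auto simp: M_def)
    then show "integrable M (\<lambda>s. l s powr q)" "(\<integral>s. l s powr q \<partial>M) = (\<integral>s. \<bar>l s\<bar> powr q \<partial>M)"
      using lit' by (auto cong: Bochner_Integration.integrable_cong Bochner_Integration.integral_cong)
  qed
  define \<kappa> where "\<kappa> = (\<gamma> - \<tau>) / (1 - \<tau>)"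
  have \<kappa>: "\<kappa> > 0" using \<tau> by (simp add: \<kappa>_def)
  have kp: "k s powr p = (t - s) powr (\<kappa> - 1)" for s
  proof -
    have "(\<gamma> - 1) * p = \<kappa> - 1" using \<tau> by (simp add: p_def \<kappa>_def field_simps)
    then show ?thesis by (simp add: k_def powr_powr)
  qed
  have hi: "((\<lambda>s. k s powr p) has_integral t powr \<kappa> / \<kappa>) {0..t}"
    unfolding kp using has_integral_kernel[OF \<kappa> t(1)] by simp
  have ki: "integrable M (\<lambda>s. k s powr p)"
    unfolding M_def using hi
    by (intro absolutely_integrable_imp_integrable nonnegative_absolutely_integrable_1) (auto simp: integrable_on_def)
  have kint: "(\<integral>s. k s powr p \<partial>M) = t powr \<kappa> / \<kappa>"
    using lebesgue_integral_eq_integral[OF ki[unfolded M_def]] integral_unique[OF hi] by (simp add: M_def)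
  have km: "k \<in> borel_measurable M"
  proof -
    have "k absolutely_integrable_on {0..t}"
      unfolding k_def using has_integral_kernel[OF \<gamma> t(1)]
      by (intro nonnegative_absolutely_integrable_1) (auto simp: integrable_on_def)
    then show ?thesis unfolding M_def by (intro borel_measurable_integrable absolutely_integrable_imp_integrable) auto
  qed
  have kn: "0 \<le> k s" for s by (simp add: k_def)
  have ln: "0 \<le> l s" if "s \<in> space M" for s using that l0 t by (auto simp: M_def)
  note H = Hoelder_inequality[OF pq km lmt kn ln ki lit(1)]
  define N where "N = (\<integral>s. \<bar>l s\<bar> powr q \<partial>lebesgue_on {0..T})"
  have "(\<integral>s. k s * l s \<partial>M) \<le> (t powr \<kappa> / \<kappa>) powr (1 / p) * (\<integral>s. \<bar>l s\<bar> powr q \<partial>M) powr (1 / q)"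
    using H(2) by (simp add: kint lit(2))
  also have "\<dots> \<le> (t powr \<kappa> / \<kappa>) powr (1 / p) * N powr (1 / q)"
    using le pq by (intro mult_left_mono powr_mono2) (auto simp: N_def)
  also have "N powr (1 / q) = Lp_norm (1 / \<tau>) T l" using \<tau> by (simp add: Lp_norm_def N_def q_def)
  also have "(t powr \<kappa> / \<kappa>) powr (1 / p) = t powr (\<gamma> - \<tau>) * ((1 - \<tau>) / (\<gamma> - \<tau>)) powr (1 - \<tau>)"
  proof -
    have "(t powr \<kappa> / \<kappa>) powr (1 / p) = (t powr \<kappa> * (1 / \<kappa>)) powr (1 - \<tau>)" by (simp add: p_def)
    also have "\<dots> = t powr (\<kappa> * (1 - \<tau>)) * (1 / \<kappa>) powr (1 - \<tau>)"
      using \<kappa> by (subst powr_mult) (auto simp: powr_powr)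
    also have "\<kappa> * (1 - \<tau>) = \<gamma> - \<tau>" using \<tau> by (simp add: \<kappa>_def)
    also have "1 / \<kappa> = (1 - \<tau>) / (\<gamma> - \<tau>)" by (simp add: \<kappa>_def)
    finally show ?thesis .
  qed
  finally have main: "(\<integral>s. k s * l s \<partial>M) \<le> t powr (\<gamma> - \<tau>) * ((1 - \<tau>) / (\<gamma> - \<tau>)) powr (1 - \<tau>) * Lp_norm (1 / \<tau>) T l" .
  have kl: "(\<lambda>s. k s * l s) integrable_on {0..t}" "(\<integral>s. k s * l s \<partial>M) = integral {0..t} (\<lambda>s. k s * l s)"
    using integrable_on_lebesgue_on[OF H(1)[unfolded M_def]] lebesgue_integral_eq_integral[OF H(1)[unfolded M_def]]
    by (auto simp: M_def)
  have "norm (integral {0..t} (\<lambda>s. k s * h s)) \<le> integral {0..t} (\<lambda>s. P * (k s * l s))"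
  proof (rule integral_norm_bound_integral)
    show "(\<lambda>s. k s * h s) integrable_on {0..t}" unfolding k_def by (rule integrable_kernel_mult[OF \<gamma> h])
    show "(\<lambda>s. P * (k s * l s)) integrable_on {0..t}"
      by (rule has_integral_integrable[OF has_integral_mult_right[OF integrable_integral[OF kl(1)]]])
    fix s assume "s \<in> {0..t}"
    then have "k s * \<bar>h s\<bar> \<le> k s * (l s * P)" by (intro mult_left_mono hl kn)
    then show "norm (k s * h s) \<le> P * (k s * l s)" using kn[of s] by (simp add: abs_mult algebra_simps)
  qed
  also have "\<dots> = P * (\<integral>s. k s * l s \<partial>M)" using kl by simp
  also have "\<dots> \<le> P * (t powr (\<gamma> - \<tau>) * ((1 - \<tau>) / (\<gamma> - \<tau>)) powr (1 - \<tau>) * Lp_norm (1 / \<tau>) T l)"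
    using main P by (rule mult_left_mono)
  finally have "1 / Gamma \<gamma> * \<bar>integral {0..t} (\<lambda>s. k s * h s)\<bar> \<le> 1 / Gamma \<gamma> * \<dots>"
    using Gamma_real_pos[OF \<gamma>] by (intro mult_left_mono) auto
  then show ?thesis
    using Gamma_real_pos[OF \<gamma>] by (simp add: RL_integral_def k_def abs_mult algebra_simps)
qed

lemma abs_integral_le_Lp_norm_1:
  assumes l: "l \<in> Lp_nonneg 1 T" and k: "continuous_on {0..T} k" and kl: "\<And>s. s \<in> {0..T} \<Longrightarrow> \<bar>k s\<bar> \<le> l s * P"
  shows "\<bar>integral {0..T} k\<bar> \<le> P * Lp_norm 1 T l"
proof -
  have l0: "0 \<le> l s" if "s \<in> {0..T}" for s using l that by (auto simp: Lp_nonneg_def)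
  have "integrable (lebesgue_on {0..T}) (\<lambda>s. \<bar>l s\<bar> powr 1)" using l by (auto simp: Lp_nonneg_def)
  then have i: "integrable (lebesgue_on {0..T}) (\<lambda>s. \<bar>l s\<bar>)" by simp
  then have int: "(\<lambda>s. \<bar>l s\<bar>) integrable_on {0..T}" by (rule integrable_on_lebesgue_on) simp
  have "norm (integral {0..T} k) \<le> integral {0..T} (\<lambda>s. P * \<bar>l s\<bar>)"
  proof (rule integral_norm_bound_integral)
    show "k integrable_on {0..T}" using k by (rule integrable_continuous_real)
    show "(\<lambda>s. P * \<bar>l s\<bar>) integrable_on {0..T}"
      by (rule has_integral_integrable[OF has_integral_mult_right[OF integrable_integral[OF int]]])
    show "norm (k s) \<le> P * \<bar>l s\<bar>" if "s \<in> {0..T}" for s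
      using kl[OF that] l0[OF that] by (simp add: mult.commute)
  qed
  also have "\<dots> = P * integral {0..T} (\<lambda>s. \<bar>l s\<bar>)" by simp
  also have "integral {0..T} (\<lambda>s. \<bar>l s\<bar>) = Lp_norm 1 T l"
    using lebesgue_integral_eq_integral[OF i] integral_nonneg[OF int] by (simp add: Lp_norm_def)
  finally show ?thesis by simp
qed

section \<open>Caputo derivatives as fractional integrals\<close>

text \<open>
The Riemann-Liouville integral, extended to order \<open>0\<close> by the identity. In this way Caputo derivatives of
integer and of fractional order have the same form.
\<close>

definition frac_int :: "real \<Rightarrow> (real \<Rightarrow> real) \<Rightarrow> real \<Rightarrow> real" where
  "frac_int \<gamma> h t = (if \<gamma> = 0 then h t else RL_integral \<gamma> h t)"

text \<open>
The power \<open>t\<^sup>p\<close> with the convention \<open>0\<^sup>0 = 1\<close>, whereas \<open>0 powr 0 = 0\<close>. It matters at \<open>t = 0\<close> for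
\<open>\<beta> 1 = 1\<close> and \<open>\<beta> 2 = 2\<close>.
\<close>

definition frac_mono :: "real \<Rightarrow> real \<Rightarrow> real" where
  "frac_mono p t = (if p = 0 then 1 else t powr p)"

lemma frac_int_RL_integral:
  assumes "0 \<le> a" "0 < b" "0 \<le> t" "continuous_on {0..t} h"
  shows "frac_int a (RL_integral b h) t = RL_integral (a + b) h t"
  using assms by (auto simp: frac_int_def RL_integral_semigroup)

lemma frac_int_power:
  assumes "0 \<le> \<gamma>" "0 \<le> t"
  shows "frac_int \<gamma> (\<lambda>s. s ^ n) t = fact n / Gamma (real n + 1 + \<gamma>) * frac_mono (real n + \<gamma>) t"
proof (cases "\<gamma> = 0")
  case True
  have "Gamma (real n + 1) = fact n" by (metis Gamma_fact add.commute)
  moreover have "t powr real n = t ^ n" if "n > 0"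
    using that assms(2) by (cases "t = 0") (auto simp: powr_realpow)
  ultimately show ?thesis using True by (auto simp: frac_int_def frac_mono_def)
qed (use assms in \<open>auto simp: frac_int_def frac_mono_def RL_integral_power\<close>)

lemma frac_int_add:
  assumes "0 \<le> \<gamma>" "continuous_on {0..t} h" "continuous_on {0..t} k"
  shows "frac_int \<gamma> (\<lambda>s. h s + k s) t = frac_int \<gamma> h t + frac_int \<gamma> k t"
  using assms by (auto simp: frac_int_def RL_integral_add)

lemma frac_int_cmult: "frac_int \<gamma> (\<lambda>s. c * h s) t = c * frac_int \<gamma> h t"
  by (auto simp: frac_int_def RL_integral_cmult)

lemma frac_int_cong:
  assumes "0 \<le> t" "\<And>s. s \<in> {0..t} \<Longrightarrow> h s = k s"
  shows "frac_int \<gamma> h t = frac_int \<gamma> k t"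
  using assms RL_integral_cong[of t h k \<gamma>] by (auto simp: frac_int_def)

lemma frac_mono_le:
  assumes "0 \<le> p" "0 \<le> t" "t \<le> T" "0 < T"
  shows "0 \<le> frac_mono p t" "frac_mono p t \<le> T powr p"
  using assms by (auto simp: frac_mono_def powr_mono2)

lemma continuous_on_frac_mono:
  assumes "0 \<le> p"
  shows "continuous_on {0..T} (frac_mono p)"
proof (cases "p = 0")
  case False
  then have "continuous_on {0..T} (\<lambda>t :: real. t powr p)"
    using assms by (intro continuous_on_powr' continuous_intros) auto
  with False show ?thesis by (simp add: frac_mono_def[abs_def])
qed (simp add: frac_mono_def[abs_def])

lemma caputo_eq_frac_int:
  assumes "0 < \<gamma>" "n = nat \<lceil>\<gamma>\<rceil>"
  shows "caputo T \<gamma> u t = frac_int (real n - \<gamma>) (nderiv_on {0..T} n u) t"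
  using assms by (auto simp: caputo_def frac_int_def RL_integral_def Let_def)

text \<open>
One-sided derivatives at the end points are unique because the interval is nondegenerate; this identifies
the iterated \<open>vector_derivative\<close> with the given functions.
\<close>

lemma C_2_onI:
  assumes "0 < T"
    and u1: "\<And>t. t \<in> {0..T} \<Longrightarrow> (u has_real_derivative u1 t) (at t within {0..T})"
    and u2: "\<And>t. t \<in> {0..T} \<Longrightarrow> (u1 has_real_derivative u2 t) (at t within {0..T})"
    and cont: "continuous_on {0..T} u2"
  shows "C_k_on 2 {0..T} u"
    and "\<And>t. t \<in> {0..T} \<Longrightarrow> nderiv_on {0..T} 1 u t = u1 t"
    and "\<And>t. t \<in> {0..T} \<Longrightarrow> nderiv_on {0..T} 2 u t = u2 t"
proof -
  have vd: "vector_derivative v (at t within {0..T}) = v'"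
    if "(v has_real_derivative v') (at t within {0..T})" "t \<in> {0..T}" for v :: "real \<Rightarrow> real" and v' t
    using that assms(1) vector_derivative_within_closed_interval[of 0 T t v v']
    by (simp add: has_real_derivative_iff_has_vector_derivative)
  show n1: "nderiv_on {0..T} 1 u t = u1 t" if "t \<in> {0..T}" for t
    using vd[OF u1 that] that by simp
  have d1: "(nderiv_on {0..T} 1 u has_real_derivative u2 t) (at t within {0..T})" if "t \<in> {0..T}" for t
    by (rule has_field_derivative_transform_within[OF u2[OF that] zero_less_one that]) (use n1 in simp)
  show n2: "nderiv_on {0..T} 2 u t = u2 t" if "t \<in> {0..T}" for t
    using vd[OF d1 that] that by (simp add: numeral_2_eq_2)
  show "C_k_on 2 {0..T} u"
    unfolding C_k_on_def
  proof (intro conjI allI impI ballI)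
    show "continuous_on {0..T} (nderiv_on {0..T} 2 u)"
      by (rule iffD2[OF continuous_on_cong[OF refl n2] cont])
    fix k t assume "k < (2::nat)" and t: "t \<in> {0..T}"
    then consider "k = 0" | "k = 1" by linarith
    then show "(nderiv_on {0..T} k u has_real_derivative nderiv_on {0..T} (Suc k) u t) (at t within {0..T})"
    proof cases
      case 1
      then show ?thesis using u1[OF t] n1[OF t] by simp
    next
      case 2
      then show ?thesis using d1[OF t] n2[OF t] by (simp add: numeral_2_eq_2)
    qed
  qed
qed

section \<open>The linear boundary value problem\<close>

locale fractional_bvp =
  fixes T \<eta> \<alpha> :: real and a b \<beta> :: "nat \<Rightarrow> real"
  assumes T: "0 < T" and \<eta>: "0 < \<eta>" "\<eta> < T"
    and \<alpha>: "2 < \<alpha>" "\<alpha> \<le> 3"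
    and \<beta>0: "\<beta> 0 = 0" and \<beta>1: "0 < \<beta> 1" "\<beta> 1 \<le> 1" and \<beta>2: "1 < \<beta> 2" "\<beta> 2 \<le> 2"
    and nz0: "a 0 + b 0 \<noteq> 0"
    and nz1: "a 1 * \<eta> powr (1 - \<beta> 1) + b 1 * T powr (1 - \<beta> 1) \<noteq> 0"
    and nz2: "a 1 * \<eta> powr (2 - \<beta> 1) + b 1 * T powr (2 - \<beta> 1) \<noteq> 0"
      "a 2 * \<eta> powr (2 - \<beta> 2) + b 2 * T powr (2 - \<beta> 2) \<noteq> 0"
begin

definition "\<mu>1 = mu T \<eta> a b \<beta> 1"
definition "\<mu>2 = mu T \<eta> a b \<beta> 2"
definition "\<nu>1 = nu T \<eta> a b \<beta> 1"

text \<open>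
The contribution of \<open>I\<^sup>\<alpha> h\<close> to the left-hand side of the \<open>i\<close>-th boundary condition. For \<open>i = 0\<close> the first
condition point is \<open>0\<close>, where \<open>I\<^sup>\<alpha> h\<close> vanishes.
\<close>

definition bdry :: "(real \<Rightarrow> real) \<Rightarrow> nat \<Rightarrow> real" where
  "bdry h i = (if i = 0 then 0 else a i * RL_integral (\<alpha> - \<beta> i) h \<eta>) + b i * RL_integral (\<alpha> - \<beta> i) h T"

text \<open>
The constants of integration that make the boundary values equal to \<open>G\<close>, obtained by solving the boundary
conditions in the order \<open>2\<close>, \<open>1\<close>, \<open>0\<close>.
\<close>

definition k2 :: "(real \<Rightarrow> real) \<Rightarrow> (nat \<Rightarrow> real) \<Rightarrow> real" where
  "k2 h G = \<mu>2 * (bdry h 2 - G 2)"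

definition k1 :: "(real \<Rightarrow> real) \<Rightarrow> (nat \<Rightarrow> real) \<Rightarrow> real" where
  "k1 h G = \<nu>1 * (bdry h 1 - G 1 - k2 h G / \<mu>1)"

definition k0 :: "(real \<Rightarrow> real) \<Rightarrow> (nat \<Rightarrow> real) \<Rightarrow> real" where
  "k0 h G = (bdry h 0 - G 0 - b 0 * (k1 h G * T + k2 h G * T\<^sup>2)) / (a 0 + b 0)"

text \<open>
\<open>U\<close> is the solution of the linear problem with right-hand side \<open>h\<close> and boundary values \<open>G\<close>; \<open>V\<close> and \<open>W\<close>
are its Caputo derivatives of orders \<open>\<beta> 1\<close> and \<open>\<beta> 2\<close>, see \<open>caputo_U_1\<close> and \<open>caputo_U_2\<close>.
\<close>

definition U :: "(real \<Rightarrow> real) \<Rightarrow> (nat \<Rightarrow> real) \<Rightarrow> real \<Rightarrow> real" where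
  "U h G t = RL_integral \<alpha> h t - k0 h G - k1 h G * t - k2 h G * t\<^sup>2"

definition V :: "(real \<Rightarrow> real) \<Rightarrow> (nat \<Rightarrow> real) \<Rightarrow> real \<Rightarrow> real" where
  "V h G t = RL_integral (\<alpha> - \<beta> 1) h t - k1 h G * (frac_mono (1 - \<beta> 1) t / Gamma (2 - \<beta> 1)) -
     k2 h G * (2 * frac_mono (2 - \<beta> 1) t / Gamma (3 - \<beta> 1))"

definition W :: "(real \<Rightarrow> real) \<Rightarrow> (nat \<Rightarrow> real) \<Rightarrow> real \<Rightarrow> real" where
  "W h G t = RL_integral (\<alpha> - \<beta> 2) h t - k2 h G * (2 * frac_mono (2 - \<beta> 2) t / Gamma (3 - \<beta> 2))"

lemma Gamma_pos: "Gamma (2 - \<beta> 1) > 0" "Gamma (3 - \<beta> 1) > 0" "Gamma (3 - \<beta> 2) > 0"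
  using \<beta>1 \<beta>2 by (auto intro!: Gamma_real_pos)

lemma mu_nu_nonzero: "\<mu>1 \<noteq> 0" "\<mu>2 \<noteq> 0" "\<nu>1 \<noteq> 0"
  using nz1 nz2 Gamma_pos by (auto simp: \<mu>1_def \<mu>2_def \<nu>1_def mu_def nu_def)

lemma continuous_on_subinterval:
  "continuous_on {0..T} h \<Longrightarrow> t \<in> {0..T} \<Longrightarrow> continuous_on {0..t} h" for h :: "real \<Rightarrow> real"
  by (auto intro: continuous_on_subset)

lemma order_pos: "i \<le> 2 \<Longrightarrow> 0 < \<alpha> - \<beta> i"
  using \<alpha> \<beta>0 \<beta>1 \<beta>2 by (cases "i = 0"; cases "i = 1"; cases "i = 2") auto

text \<open>
Each derivative lowers the order of the fractional integral by one. Two steps are possible since \<open>\<alpha> > 2\<close>, and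
the second derivative still contains an integral of the positive order \<open>\<alpha> - 2\<close>, so it is continuous.
\<close>

lemma U_derivatives:
  assumes h: "continuous_on {0..T} h"
  shows "C_k_on 2 {0..T} (U h G)"
    and "\<And>t. t \<in> {0..T} \<Longrightarrow> nderiv_on {0..T} 1 (U h G) t = RL_integral (\<alpha> - 1) h t - k1 h G - 2 * k2 h G * t"
    and "\<And>t. t \<in> {0..T} \<Longrightarrow> nderiv_on {0..T} 2 (U h G) t = RL_integral (\<alpha> - 2) h t - 2 * k2 h G"
proof -
  have d1: "(U h G has_real_derivative RL_integral (\<alpha> - 1) h t - k1 h G - 2 * k2 h G * t) (at t within {0..T})"
    if "t \<in> {0..T}" for t
    unfolding U_def[abs_def] using RL_integral_has_derivative[of "\<alpha> - 1" T h t] \<alpha> h that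
    by (auto intro!: derivative_eq_intros)
  have d2: "((\<lambda>t. RL_integral (\<alpha> - 1) h t - k1 h G - 2 * k2 h G * t) has_real_derivative
      RL_integral (\<alpha> - 2) h t - 2 * k2 h G) (at t within {0..T})"
    if "t \<in> {0..T}" for t
    using RL_integral_has_derivative[of "\<alpha> - 2" T h t] \<alpha> h that
    by (auto intro!: derivative_eq_intros)
  have cont: "continuous_on {0..T} (\<lambda>t. RL_integral (\<alpha> - 2) h t - 2 * k2 h G)"
    using \<alpha> h by (intro continuous_intros continuous_on_RL_integral) auto
  note * = C_2_onI[OF T d1 d2 cont]
  show "C_k_on 2 {0..T} (U h G)" by (rule *(1))
  show "nderiv_on {0..T} 1 (U h G) t = RL_integral (\<alpha> - 1) h t - k1 h G - 2 * k2 h G * t"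
    if "t \<in> {0..T}" for t by (rule *(2)) (use that in auto)
  show "nderiv_on {0..T} 2 (U h G) t = RL_integral (\<alpha> - 2) h t - 2 * k2 h G"
    if "t \<in> {0..T}" for t by (rule *(3)) (use that in auto)
qed

text \<open>
The Caputo derivative is the fractional integral of order \<open>1 - \<beta> 1\<close> of \<open>u'\<close>; the semigroup law treats the term
\<open>I\<^sup>\<alpha>\<^sup>-\<^sup>1 h\<close> and the power rule the affine remainder.
\<close>

lemma caputo_U_1:
  assumes h: "continuous_on {0..T} h" and t: "t \<in> {0..T}"
  shows "caputo T (\<beta> 1) (U h G) t = V h G t"
proof -
  have ht: "continuous_on {0..t} h" by (rule continuous_on_subinterval[OF h t])
  have "\<lceil>\<beta> 1\<rceil> = 1" using \<beta>1 by (intro ceiling_unique) auto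
  then have "caputo T (\<beta> 1) (U h G) t = frac_int (1 - \<beta> 1) (nderiv_on {0..T} 1 (U h G)) t"
    using caputo_eq_frac_int[of "\<beta> 1" 1 T "U h G" t] \<beta>1 by simp
  also have "\<dots> = frac_int (1 - \<beta> 1) (\<lambda>s. RL_integral (\<alpha> - 1) h s + ((- k1 h G) * s ^ 0 + (- 2 * k2 h G) * s ^ 1)) t"
    using t U_derivatives(2)[OF h] by (intro frac_int_cong) auto
  also have "\<dots> = frac_int (1 - \<beta> 1) (RL_integral (\<alpha> - 1) h) t +
      ((- k1 h G) * frac_int (1 - \<beta> 1) (\<lambda>s. s ^ 0) t + (- 2 * k2 h G) * frac_int (1 - \<beta> 1) (\<lambda>s. s ^ 1) t)"
    unfolding frac_int_cmult[symmetric] using \<beta>1 \<alpha> ht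
    by (subst frac_int_add, simp, (intro continuous_intros continuous_on_RL_integral; simp)+,
        subst frac_int_add) (auto intro!: continuous_intros)
  also have "frac_int (1 - \<beta> 1) (RL_integral (\<alpha> - 1) h) t = RL_integral (\<alpha> - \<beta> 1) h t"
    using \<alpha> \<beta>1 t ht by (subst frac_int_RL_integral) auto
  also have "frac_int (1 - \<beta> 1) (\<lambda>s. s ^ 0) t = frac_mono (1 - \<beta> 1) t / Gamma (2 - \<beta> 1)"
    using \<beta>1 t by (subst frac_int_power) auto
  also have "frac_int (1 - \<beta> 1) (\<lambda>s. s ^ 1) t = frac_mono (2 - \<beta> 1) t / Gamma (3 - \<beta> 1)"
    using \<beta>1 t by (subst frac_int_power) auto
  finally show ?thesis
    by (rule trans) (simp add: V_def)
qed

lemma caputo_U_2: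
  assumes h: "continuous_on {0..T} h" and t: "t \<in> {0..T}"
  shows "caputo T (\<beta> 2) (U h G) t = W h G t"
proof -
  have ht: "continuous_on {0..t} h" by (rule continuous_on_subinterval[OF h t])
  have "\<lceil>\<beta> 2\<rceil> = 2" using \<beta>2 by (intro ceiling_unique) auto
  then have "caputo T (\<beta> 2) (U h G) t = frac_int (2 - \<beta> 2) (nderiv_on {0..T} 2 (U h G)) t"
    using caputo_eq_frac_int[of "\<beta> 2" 2 T "U h G" t] \<beta>2 by simp
  also have "\<dots> = frac_int (2 - \<beta> 2) (\<lambda>s. RL_integral (\<alpha> - 2) h s + (- 2 * k2 h G) * s ^ 0) t"
    using t U_derivatives(3)[OF h] by (intro frac_int_cong) auto
  also have "\<dots> = frac_int (2 - \<beta> 2) (RL_integral (\<alpha> - 2) h) t + (- 2 * k2 h G) * frac_int (2 - \<beta> 2) (\<lambda>s. s ^ 0) t"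
    unfolding frac_int_cmult[symmetric] using \<beta>2 \<alpha> ht
    by (subst frac_int_add) (auto intro!: continuous_intros continuous_on_RL_integral)
  also have "frac_int (2 - \<beta> 2) (RL_integral (\<alpha> - 2) h) t = RL_integral (\<alpha> - \<beta> 2) h t"
    using \<alpha> \<beta>2 t ht by (subst frac_int_RL_integral) auto
  also have "frac_int (2 - \<beta> 2) (\<lambda>s. s ^ 0) t = frac_mono (2 - \<beta> 2) t / Gamma (3 - \<beta> 2)"
    using \<beta>2 t by (subst frac_int_power) auto
  finally show ?thesis
    by (rule trans) (simp add: W_def)
qed

lemma frac_mono_pos: "t > 0 \<Longrightarrow> frac_mono p t = t powr p"
  by (simp add: frac_mono_def)

text \<open>
The three boundary conditions hold by the choice of \<open>k0\<close>, \<open>k1\<close> and \<open>k2\<close>: up to sign, \<open>1 / \<nu>1\<close> is the coefficient of \<open>k1\<close>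
in the condition on the \<open>\<beta> 1\<close> derivative, and \<open>1 / \<mu>1\<close>, \<open>1 / \<mu>2\<close> are the coefficients of \<open>k2\<close> in the conditions on
the \<open>\<beta> 1\<close> and the \<open>\<beta> 2\<close> derivative.
\<close>

lemma boundary_0: "a 0 * U h G 0 + b 0 * U h G T = G 0"
proof -
  have "a 0 * U h G 0 + b 0 * U h G T = bdry h 0 - b 0 * (k1 h G * T + k2 h G * T\<^sup>2) - (a 0 + b 0) * k0 h G"
    by (simp add: U_def bdry_def \<beta>0 algebra_simps)
  also have "\<dots> = G 0" using nz0 by (simp add: k0_def)
  finally show ?thesis .
qed

lemma boundary_1: "a 1 * V h G \<eta> + b 1 * V h G T = G 1"
proof -
  have 1: "(a 1 * \<eta> powr (1 - \<beta> 1) + b 1 * T powr (1 - \<beta> 1)) / Gamma (2 - \<beta> 1) = 1 / \<nu>1"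
    by (simp add: \<nu>1_def nu_def)
  have 2: "2 * (a 1 * \<eta> powr (2 - \<beta> 1) + b 1 * T powr (2 - \<beta> 1)) / Gamma (3 - \<beta> 1) = 1 / \<mu>1"
    by (simp add: \<mu>1_def mu_def)
  have "a 1 * V h G \<eta> + b 1 * V h G T = bdry h 1
      - k1 h G * ((a 1 * \<eta> powr (1 - \<beta> 1) + b 1 * T powr (1 - \<beta> 1)) / Gamma (2 - \<beta> 1))
      - k2 h G * (2 * (a 1 * \<eta> powr (2 - \<beta> 1) + b 1 * T powr (2 - \<beta> 1)) / Gamma (3 - \<beta> 1))"
    using T \<eta> by (simp add: V_def bdry_def frac_mono_pos algebra_simps add_divide_distrib)
  also have "\<dots> = bdry h 1 - k1 h G / \<nu>1 - k2 h G / \<mu>1" unfolding 1 2 by simp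
  also have "\<dots> = G 1" using mu_nu_nonzero by (simp add: k1_def)
  finally show ?thesis .
qed

lemma boundary_2: "a 2 * W h G \<eta> + b 2 * W h G T = G 2"
proof -
  have 2: "2 * (a 2 * \<eta> powr (2 - \<beta> 2) + b 2 * T powr (2 - \<beta> 2)) / Gamma (3 - \<beta> 2) = 1 / \<mu>2"
    by (simp add: \<mu>2_def mu_def)
  have "a 2 * W h G \<eta> + b 2 * W h G T = bdry h 2
      - k2 h G * (2 * (a 2 * \<eta> powr (2 - \<beta> 2) + b 2 * T powr (2 - \<beta> 2)) / Gamma (3 - \<beta> 2))"
    using T \<eta> by (simp add: W_def bdry_def frac_mono_pos algebra_simps add_divide_distrib)
  also have "\<dots> = bdry h 2 - k2 h G / \<mu>2" unfolding 2 by simp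
  also have "\<dots> = G 2" using mu_nu_nonzero by (simp add: k2_def)
  finally show ?thesis .
qed

section \<open>Bounds for the linear problem\<close>

text \<open>
The constants \<open>k0\<close>, \<open>k1\<close>, \<open>k2\<close> are linear in the differences \<open>bdry h i - G i\<close>, so all estimates go through
these quantities. Their coefficients in the bounds \<open>abs_U\<close>, \<open>abs_V\<close> and \<open>abs_W\<close> are \<open>rho\<close>, \<open>rho_tilde\<close>
and \<open>rho_hat\<close>.
\<close>

definition load :: "(real \<Rightarrow> real) \<Rightarrow> (nat \<Rightarrow> real) \<Rightarrow> nat \<Rightarrow> real" where
  "load h G i = \<bar>bdry h i\<bar> + \<bar>G i\<bar>"

lemma abs_k2: "\<bar>k2 h G\<bar> \<le> \<bar>\<mu>2\<bar> * load h G 2"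
  unfolding k2_def load_def abs_mult by (intro mult_left_mono) auto

lemma abs_k1: "\<bar>k1 h G\<bar> \<le> \<bar>\<nu>1\<bar> * load h G 1 + \<bar>\<nu>1\<bar> * \<bar>\<mu>2\<bar> / \<bar>\<mu>1\<bar> * load h G 2"
proof -
  have "\<bar>k1 h G\<bar> \<le> \<bar>\<nu>1\<bar> * (load h G 1 + \<bar>k2 h G\<bar> / \<bar>\<mu>1\<bar>)"
    unfolding k1_def load_def abs_mult abs_divide[symmetric] by (intro mult_left_mono) linarith+
  also have "\<dots> \<le> \<bar>\<nu>1\<bar> * (load h G 1 + \<bar>\<mu>2\<bar> * load h G 2 / \<bar>\<mu>1\<bar>)"
    by (intro mult_left_mono add_left_mono divide_right_mono abs_k2) auto
  finally show ?thesis by (simp add: algebra_simps)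
qed

lemma abs_k0:
  "\<bar>k0 h G\<bar> \<le> load h G 0 / \<bar>a 0 + b 0\<bar> + \<bar>b 0\<bar> / \<bar>a 0 + b 0\<bar> * (\<bar>k1 h G\<bar> * T + \<bar>k2 h G\<bar> * T\<^sup>2)"
proof -
  have "\<bar>k1 h G * T + k2 h G * T\<^sup>2\<bar> \<le> \<bar>k1 h G\<bar> * T + \<bar>k2 h G\<bar> * T\<^sup>2"
    using T by (intro order.trans[OF abs_triangle_ineq]) (simp add: abs_mult)
  then have "\<bar>b 0 * (k1 h G * T + k2 h G * T\<^sup>2)\<bar> \<le> \<bar>b 0\<bar> * (\<bar>k1 h G\<bar> * T + \<bar>k2 h G\<bar> * T\<^sup>2)"
    unfolding abs_mult by (intro mult_left_mono) auto
  then have "\<bar>bdry h 0 - G 0 - b 0 * (k1 h G * T + k2 h G * T\<^sup>2)\<bar> \<le> load h G 0 + \<bar>b 0\<bar> * (\<bar>k1 h G\<bar> * T + \<bar>k2 h G\<bar> * T\<^sup>2)"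
    unfolding load_def by linarith
  then have "\<bar>k0 h G\<bar> \<le> (load h G 0 + \<bar>b 0\<bar> * (\<bar>k1 h G\<bar> * T + \<bar>k2 h G\<bar> * T\<^sup>2)) / \<bar>a 0 + b 0\<bar>"
    unfolding k0_def abs_divide by (rule divide_right_mono) simp
  then show ?thesis by (simp add: add_divide_distrib)
qed

text \<open>
The terms \<open>k1 t\<close> and \<open>k2 t\<^sup>2\<close> enter twice, directly and through \<open>k0\<close>; this is the factor
\<open>\<bar>b 0\<bar> / \<bar>a 0 + b 0\<bar> + 1\<close> hidden in \<open>rho\<close>.
\<close>

lemma abs_U:
  assumes "t \<in> {0..T}"
  shows "\<bar>U h G t\<bar> \<le> \<bar>RL_integral \<alpha> h t\<bar> + (\<Sum>i=0..2. rho T \<eta> a b \<beta> i * load h G i)"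
proof -
  define c where "c = \<bar>b 0\<bar> / \<bar>a 0 + b 0\<bar> + 1"
  have c: "c \<ge> 0" by (simp add: c_def)
  have "\<bar>k1 h G * t\<bar> \<le> \<bar>k1 h G\<bar> * T" "\<bar>k2 h G * t\<^sup>2\<bar> \<le> \<bar>k2 h G\<bar> * T\<^sup>2"
    using assms by (auto simp: abs_mult intro!: mult_left_mono power_mono)
  then have "\<bar>U h G t\<bar> \<le> \<bar>RL_integral \<alpha> h t\<bar> + \<bar>k0 h G\<bar> + \<bar>k1 h G\<bar> * T + \<bar>k2 h G\<bar> * T\<^sup>2"
    unfolding U_def by linarith
  also have "\<dots> \<le> \<bar>RL_integral \<alpha> h t\<bar> + load h G 0 / \<bar>a 0 + b 0\<bar> + c * (\<bar>k1 h G\<bar> * T + \<bar>k2 h G\<bar> * T\<^sup>2)"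
    using abs_k0[of h G] by (simp add: c_def algebra_simps)
  also have "\<dots> \<le> \<bar>RL_integral \<alpha> h t\<bar> + load h G 0 / \<bar>a 0 + b 0\<bar> +
      c * ((\<bar>\<nu>1\<bar> * load h G 1 + \<bar>\<nu>1\<bar> * \<bar>\<mu>2\<bar> / \<bar>\<mu>1\<bar> * load h G 2) * T + (\<bar>\<mu>2\<bar> * load h G 2) * T\<^sup>2)"
    using T c by (intro add_left_mono mult_left_mono add_mono mult_right_mono abs_k1 abs_k2) auto
  also have "\<dots> = \<bar>RL_integral \<alpha> h t\<bar> + (\<Sum>i=0..2. rho T \<eta> a b \<beta> i * load h G i)"
    by (simp add: numeral_2_eq_2 rho_def Let_def c_def flip: \<mu>1_def \<mu>2_def \<nu>1_def)
      (simp add: numeral_2_eq_2 \<mu>1_def \<mu>2_def \<nu>1_def algebra_simps add_divide_distrib)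
  finally show ?thesis .
qed

lemma abs_V:
  assumes "t \<in> {0..T}"
  shows "\<bar>V h G t\<bar> \<le> \<bar>RL_integral (\<alpha> - \<beta> 1) h t\<bar> + (\<Sum>i=1..2. rho_tilde T \<eta> a b \<beta> i * load h G i)"
proof -
  define p where "p = T powr (1 - \<beta> 1) / Gamma (2 - \<beta> 1)"
  define q where "q = 2 * T powr (2 - \<beta> 1) / Gamma (3 - \<beta> 1)"
  have pq: "p \<ge> 0" "q \<ge> 0" using Gamma_pos by (auto simp: p_def q_def)
  have e: "\<bar>frac_mono (1 - \<beta> 1) t / Gamma (2 - \<beta> 1)\<bar> \<le> p" "\<bar>2 * frac_mono (2 - \<beta> 1) t / Gamma (3 - \<beta> 1)\<bar> \<le> q"
    using frac_mono_le[of "1 - \<beta> 1" t T] frac_mono_le[of "2 - \<beta> 1" t T] assms \<beta>1 T Gamma_pos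
    by (auto simp: p_def q_def abs_divide intro!: divide_right_mono)
  have "\<bar>k1 h G * (frac_mono (1 - \<beta> 1) t / Gamma (2 - \<beta> 1))\<bar> \<le> \<bar>k1 h G\<bar> * p"
    "\<bar>k2 h G * (2 * frac_mono (2 - \<beta> 1) t / Gamma (3 - \<beta> 1))\<bar> \<le> \<bar>k2 h G\<bar> * q"
    unfolding abs_mult[of "k1 h G"] abs_mult[of "k2 h G"] by (rule mult_left_mono[OF e(1) abs_ge_zero] mult_left_mono[OF e(2) abs_ge_zero])+
  then have "\<bar>V h G t\<bar> \<le> \<bar>RL_integral (\<alpha> - \<beta> 1) h t\<bar> + (\<bar>k1 h G\<bar> * p + \<bar>k2 h G\<bar> * q)"
    unfolding V_def by linarith
  also have "\<dots> \<le> \<bar>RL_integral (\<alpha> - \<beta> 1) h t\<bar> +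
      ((\<bar>\<nu>1\<bar> * load h G 1 + \<bar>\<nu>1\<bar> * \<bar>\<mu>2\<bar> / \<bar>\<mu>1\<bar> * load h G 2) * p + (\<bar>\<mu>2\<bar> * load h G 2) * q)"
    using pq by (intro add_left_mono add_mono mult_right_mono abs_k1 abs_k2) auto
  also have "\<dots> = \<bar>RL_integral (\<alpha> - \<beta> 1) h t\<bar> + (\<Sum>i=1..2. rho_tilde T \<eta> a b \<beta> i * load h G i)"
    by (simp add: numeral_2_eq_2 rho_tilde_def Let_def p_def q_def \<mu>1_def \<mu>2_def \<nu>1_def algebra_simps)
  finally show ?thesis .
qed

lemma abs_W:
  assumes "t \<in> {0..T}"
  shows "\<bar>W h G t\<bar> \<le> \<bar>RL_integral (\<alpha> - \<beta> 2) h t\<bar> + rho_hat T \<eta> a b \<beta> 2 * load h G 2"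
proof -
  define q where "q = 2 * T powr (2 - \<beta> 2) / Gamma (3 - \<beta> 2)"
  have q: "q \<ge> 0" using Gamma_pos by (auto simp: q_def)
  have e: "\<bar>2 * frac_mono (2 - \<beta> 2) t / Gamma (3 - \<beta> 2)\<bar> \<le> q"
    using frac_mono_le[of "2 - \<beta> 2" t T] assms \<beta>2 T Gamma_pos
    by (auto simp: q_def abs_divide intro!: divide_right_mono)
  have "\<bar>k2 h G * (2 * frac_mono (2 - \<beta> 2) t / Gamma (3 - \<beta> 2))\<bar> \<le> \<bar>k2 h G\<bar> * q"
    unfolding abs_mult[of "k2 h G"] by (rule mult_left_mono[OF e abs_ge_zero])
  then have "\<bar>W h G t\<bar> \<le> \<bar>RL_integral (\<alpha> - \<beta> 2) h t\<bar> + \<bar>k2 h G\<bar> * q"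
    unfolding W_def by linarith
  also have "\<dots> \<le> \<bar>RL_integral (\<alpha> - \<beta> 2) h t\<bar> + (\<bar>\<mu>2\<bar> * load h G 2) * q"
    using q by (intro add_left_mono mult_right_mono abs_k2) auto
  also have "\<dots> = \<bar>RL_integral (\<alpha> - \<beta> 2) h t\<bar> + rho_hat T \<eta> a b \<beta> 2 * load h G 2"
    by (simp add: rho_hat_def q_def \<mu>2_def)
  finally show ?thesis .
qed

lemma bdry_diff:
  assumes "continuous_on {0..T} h" "continuous_on {0..T} h'" "i \<le> 2"
  shows "bdry (\<lambda>s. h s - h' s) i = bdry h i - bdry h' i"
proof -
  have "continuous_on {0..\<eta>} h" "continuous_on {0..\<eta>} h'"
    using assms \<eta> by (auto intro: continuous_on_subset)
  then show ?thesis
    unfolding bdry_def using assms order_pos[of i] by (simp add: RL_integral_diff algebra_simps)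
qed

lemma k_diff:
  assumes "continuous_on {0..T} h" "continuous_on {0..T} h'"
  shows "k2 (\<lambda>s. h s - h' s) (\<lambda>i. G i - G' i) = k2 h G - k2 h' G'"
    and "k1 (\<lambda>s. h s - h' s) (\<lambda>i. G i - G' i) = k1 h G - k1 h' G'"
    and "k0 (\<lambda>s. h s - h' s) (\<lambda>i. G i - G' i) = k0 h G - k0 h' G'"
proof -
  show 2: "k2 (\<lambda>s. h s - h' s) (\<lambda>i. G i - G' i) = k2 h G - k2 h' G'"
    by (simp add: k2_def bdry_diff[OF assms] algebra_simps)
  show 1: "k1 (\<lambda>s. h s - h' s) (\<lambda>i. G i - G' i) = k1 h G - k1 h' G'"
    unfolding k1_def 2 by (simp add: bdry_diff[OF assms] algebra_simps diff_divide_distrib)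
  show "k0 (\<lambda>s. h s - h' s) (\<lambda>i. G i - G' i) = k0 h G - k0 h' G'"
    unfolding k0_def 1 2 diff_divide_distrib[symmetric]
    by (simp add: bdry_diff[OF assms] algebra_simps)
qed

lemma UVW_diff:
  assumes "continuous_on {0..T} h" "continuous_on {0..T} h'" "t \<in> {0..T}"
  shows "U (\<lambda>s. h s - h' s) (\<lambda>i. G i - G' i) t = U h G t - U h' G' t"
    and "V (\<lambda>s. h s - h' s) (\<lambda>i. G i - G' i) t = V h G t - V h' G' t"
    and "W (\<lambda>s. h s - h' s) (\<lambda>i. G i - G' i) t = W h G t - W h' G' t"
proof -
  have c: "continuous_on {0..t} h" "continuous_on {0..t} h'"
    using assms by (auto intro: continuous_on_subset)
  show "U (\<lambda>s. h s - h' s) (\<lambda>i. G i - G' i) t = U h G t - U h' G' t"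
    using RL_integral_diff[OF _ c, of \<alpha>] \<alpha> by (simp add: U_def k_diff[OF assms(1,2)] left_diff_distrib)
  show "V (\<lambda>s. h s - h' s) (\<lambda>i. G i - G' i) t = V h G t - V h' G' t"
    using RL_integral_diff[OF order_pos[of 1] c] by (simp add: V_def k_diff[OF assms(1,2)] algebra_simps diff_divide_distrib)
  show "W (\<lambda>s. h s - h' s) (\<lambda>i. G i - G' i) t = W h G t - W h' G' t"
    using RL_integral_diff[OF order_pos[of 2] c] by (simp add: W_def k_diff[OF assms(1,2)] algebra_simps diff_divide_distrib)
qed

lemma rho_nonneg: "0 \<le> rho T \<eta> a b \<beta> i" "0 \<le> rho_tilde T \<eta> a b \<beta> i" "0 \<le> rho_hat T \<eta> a b \<beta> i"
  using T Gamma_pos by (auto simp: rho_def rho_tilde_def rho_hat_def Let_def)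

lemma RL_integral_sup_bound:
  assumes "0 < \<gamma>" "continuous_on {0..T} h" "t \<in> {0..T}" "\<And>s. s \<in> {0..T} \<Longrightarrow> \<bar>h s\<bar> \<le> M"
  shows "\<bar>RL_integral \<gamma> h t\<bar> \<le> T powr \<gamma> / Gamma (\<gamma> + 1) * M"
proof -
  have "M \<ge> 0" using assms(4)[OF assms(3)] by (rule order_trans[OF abs_ge_zero])
  have "\<bar>RL_integral \<gamma> h t\<bar> \<le> M * t powr \<gamma> / Gamma (\<gamma> + 1)"
    by (rule RL_integral_bound[OF assms(1) _ continuous_on_subinterval[OF assms(2,3)] assms(4)])
      (use assms(3) in auto)
  also have "\<dots> \<le> M * T powr \<gamma> / Gamma (\<gamma> + 1)"
    using assms(1,3) \<open>M \<ge> 0\<close> Gamma_real_pos[of "\<gamma> + 1"]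
    by (intro divide_right_mono mult_left_mono powr_mono2) auto
  finally show ?thesis by (simp add: mult.commute)
qed

lemma load_sup_bound:
  assumes "continuous_on {0..T} h" "\<And>s. s \<in> {0..T} \<Longrightarrow> \<bar>h s\<bar> \<le> M" "\<bar>G i\<bar> \<le> M" "i \<le> 2"
  shows "load h G i \<le> ((\<bar>a i\<bar> + \<bar>b i\<bar>) * (T powr (\<alpha> - \<beta> i) / Gamma (\<alpha> - \<beta> i + 1)) + 1) * M"
proof -
  define c where "c = T powr (\<alpha> - \<beta> i) / Gamma (\<alpha> - \<beta> i + 1)"
  have "\<bar>RL_integral (\<alpha> - \<beta> i) h \<eta>\<bar> \<le> c * M" "\<bar>RL_integral (\<alpha> - \<beta> i) h T\<bar> \<le> c * M"
    unfolding c_def by (rule RL_integral_sup_bound[OF order_pos[OF assms(4)] assms(1) _ assms(2)]; use T \<eta> in simp)+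
  then have "\<bar>a i * RL_integral (\<alpha> - \<beta> i) h \<eta>\<bar> \<le> \<bar>a i\<bar> * (c * M)" "\<bar>b i * RL_integral (\<alpha> - \<beta> i) h T\<bar> \<le> \<bar>b i\<bar> * (c * M)"
    unfolding abs_mult by (auto intro!: mult_left_mono[OF _ abs_ge_zero] simp del: mult_le_cancel_left)
  moreover from this(1) have "0 \<le> \<bar>a i\<bar> * (c * M)" by (rule order_trans[OF abs_ge_zero])
  ultimately have "\<bar>bdry h i\<bar> \<le> \<bar>a i\<bar> * (c * M) + \<bar>b i\<bar> * (c * M)"
    unfolding bdry_def by (cases "i = 0") auto
  with assms(3) show ?thesis unfolding load_def c_def[symmetric] by (simp add: algebra_simps)
qed

text \<open>
Together with \<open>UVW_diff\<close>, this makes the solution of the linear problem depend on the data in a Lipschitz way.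
\<close>

lemma UVW_sup_bound:
  obtains C where "C \<ge> 0"
    "\<And>h G M t. \<lbrakk>continuous_on {0..T} h; \<And>s. s \<in> {0..T} \<Longrightarrow> \<bar>h s\<bar> \<le> M; \<And>i. i \<le> 2 \<Longrightarrow> \<bar>G i\<bar> \<le> M; t \<in> {0..T}\<rbrakk> \<Longrightarrow>
      \<bar>U h G t\<bar> + \<bar>V h G t\<bar> + \<bar>W h G t\<bar> \<le> C * M"
proof -
  define c where "c = (\<lambda>i. T powr (\<alpha> - \<beta> i) / Gamma (\<alpha> - \<beta> i + 1))"
  define d where "d = (\<lambda>i. (\<bar>a i\<bar> + \<bar>b i\<bar>) * c i + 1)"
  define C where "C = c 0 + c 1 + c 2 + (\<Sum>i=0..2. rho T \<eta> a b \<beta> i * d i) +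
    (\<Sum>i=1..2. rho_tilde T \<eta> a b \<beta> i * d i) + rho_hat T \<eta> a b \<beta> 2 * d 2"
  have c0: "0 \<le> c i" if "i \<le> 2" for i
    using order_pos[OF that] unfolding c_def by (intro divide_nonneg_nonneg less_imp_le[OF Gamma_real_pos]) auto
  have d0: "0 \<le> d i" if "i \<le> 2" for i using c0[OF that] by (simp add: d_def)
  have "C \<ge> 0" unfolding C_def using c0 d0 rho_nonneg by (intro add_nonneg_nonneg sum_nonneg mult_nonneg_nonneg) auto
  moreover have "\<bar>U h G t\<bar> + \<bar>V h G t\<bar> + \<bar>W h G t\<bar> \<le> C * M"
    if h: "continuous_on {0..T} h" "\<And>s. s \<in> {0..T} \<Longrightarrow> \<bar>h s\<bar> \<le> M" and G: "\<And>i. i \<le> 2 \<Longrightarrow> \<bar>G i\<bar> \<le> M" and t: "t \<in> {0..T}"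
    for h G M t
  proof -
    have r: "\<bar>RL_integral (\<alpha> - \<beta> i) h t\<bar> \<le> c i * M" if "i \<le> 2" for i
      unfolding c_def by (rule RL_integral_sup_bound[OF order_pos[OF that] h(1) t h(2)])
    have l: "load h G i \<le> d i * M" if "i \<le> 2" for i
      unfolding d_def c_def by (rule load_sup_bound[where G = G and i = i, OF h(1) _ G[OF that] that]) (rule h(2))
    have "(\<Sum>i=0..2. rho T \<eta> a b \<beta> i * load h G i) \<le> (\<Sum>i=0..2. rho T \<eta> a b \<beta> i * (d i * M))"
      "(\<Sum>i=1..2. rho_tilde T \<eta> a b \<beta> i * load h G i) \<le> (\<Sum>i=1..2. rho_tilde T \<eta> a b \<beta> i * (d i * M))"
      "rho_hat T \<eta> a b \<beta> 2 * load h G 2 \<le> rho_hat T \<eta> a b \<beta> 2 * (d 2 * M)"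
      by (intro sum_mono mult_left_mono l rho_nonneg; simp)+
    with abs_U[OF t, of h G] abs_V[OF t, of h G] abs_W[OF t, of h G] r[of 0] r[of 1] r[of 2]
    have "\<bar>U h G t\<bar> + \<bar>V h G t\<bar> + \<bar>W h G t\<bar> \<le> c 0 * M + c 1 * M + c 2 * M +
        (\<Sum>i=0..2. rho T \<eta> a b \<beta> i * (d i * M)) + (\<Sum>i=1..2. rho_tilde T \<eta> a b \<beta> i * (d i * M)) + rho_hat T \<eta> a b \<beta> 2 * (d 2 * M)"
      unfolding \<beta>0 by simp
    also have "\<dots> = C * M"
      unfolding C_def by (simp only: distrib_right sum_distrib_right mult.assoc)
    finally show ?thesis .
  qed
  ultimately show thesis by (rule that)
qed

text \<open>
The assumption on \<open>h\<close> is the conclusion of \<open>RL_integral_Hoelder_bound\<close>, with \<open>N\<close> in place of the product of the two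
norm factors.
\<close>

lemma load_Hoelder_bound:
  assumes "i \<le> 2" "\<tau> < \<alpha> - \<beta> i"
    and R: "\<And>\<gamma> t. \<lbrakk>\<tau> < \<gamma>; t \<in> {0..T}\<rbrakk> \<Longrightarrow> \<bar>RL_integral \<gamma> h t\<bar> \<le> N * (t powr (\<gamma> - \<tau>) / Gamma \<gamma> * ((1 - \<tau>) / (\<gamma> - \<tau>)) powr (1 - \<tau>))"
  shows "load h G i \<le> N * boundary_factor T \<eta> \<alpha> \<tau> a b \<beta> i + \<bar>G i\<bar>"
proof -
  define r where "r = (\<lambda>t. N * (t powr (\<alpha> - \<beta> i - \<tau>) / Gamma (\<alpha> - \<beta> i) * ((1 - \<tau>) / (\<alpha> - \<beta> i - \<tau>)) powr (1 - \<tau>)))"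
  have "\<bar>RL_integral (\<alpha> - \<beta> i) h \<eta>\<bar> \<le> r \<eta>" "\<bar>RL_integral (\<alpha> - \<beta> i) h T\<bar> \<le> r T"
    unfolding r_def by (rule R[OF assms(2)]; use T \<eta> in simp)+
  then have "\<bar>a i * RL_integral (\<alpha> - \<beta> i) h \<eta>\<bar> \<le> \<bar>a i\<bar> * r \<eta>" "\<bar>b i * RL_integral (\<alpha> - \<beta> i) h T\<bar> \<le> \<bar>b i\<bar> * r T"
    unfolding abs_mult by (auto intro!: mult_left_mono[OF _ abs_ge_zero] simp del: mult_le_cancel_left)
  moreover from this(1) have "0 \<le> \<bar>a i\<bar> * r \<eta>" by (rule order_trans[OF abs_ge_zero])
  ultimately have "\<bar>bdry h i\<bar> \<le> \<bar>a i\<bar> * r \<eta> + \<bar>b i\<bar> * r T"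
    unfolding bdry_def by (cases "i = 0") auto
  also have "\<dots> = N * boundary_factor T \<eta> \<alpha> \<tau> a b \<beta> i"
    by (simp add: boundary_factor_def r_def algebra_simps add_divide_distrib)
  finally show ?thesis unfolding load_def by simp
qed

text \<open>
With \<open>N = \<phi> K\<close> times the norm of \<open>l_f\<close> and \<open>g i\<close> the bound on the \<open>i\<close>-th boundary integral, the right-hand
side is the denominator that the existence theorem compares with \<open>K\<close>.
\<close>

lemma a_priori_bound:
  assumes \<tau>: "0 < \<tau>" "\<tau> < \<alpha> - \<beta> 2" and t: "t \<in> {0..T}" and N: "0 \<le> N"
    and R: "\<And>\<gamma> t. \<lbrakk>\<tau> < \<gamma>; t \<in> {0..T}\<rbrakk> \<Longrightarrow> \<bar>RL_integral \<gamma> h t\<bar> \<le> N * (t powr (\<gamma> - \<tau>) / Gamma \<gamma> * ((1 - \<tau>) / (\<gamma> - \<tau>)) powr (1 - \<tau>))"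
    and G: "\<And>i. i \<le> 2 \<Longrightarrow> \<bar>G i\<bar> \<le> g i"
  shows "\<bar>U h G t\<bar> + \<bar>V h G t\<bar> + \<bar>W h G t\<bar> \<le>
    N * (Delta0 T \<eta> \<alpha> \<tau> a b \<beta> + Delta1 T \<eta> \<alpha> \<tau> a b \<beta> + Delta2 T \<eta> \<alpha> \<tau> a b \<beta>) +
    (\<Sum>i=0..2. (rho T \<eta> a b \<beta> i + rho_tilde T \<eta> a b \<beta> i + rho_hat T \<eta> a b \<beta> i) * g i)"
proof -
  have \<tau>i: "\<tau> < \<alpha> - \<beta> i" if "i \<le> 2" for i
  proof -
    from that consider "i = 0" | "i = 1" | "i = 2" by linarith
    then show ?thesis using \<tau> \<beta>0 \<beta>1 \<beta>2 by cases auto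
  qed
  define F where "F = boundary_factor T \<eta> \<alpha> \<tau> a b \<beta>"
  define r where "r = (\<lambda>i. T powr (\<alpha> - \<beta> i - \<tau>) / Gamma (\<alpha> - \<beta> i) * ((1 - \<tau>) / (\<alpha> - \<beta> i - \<tau>)) powr (1 - \<tau>))"
  have r: "\<bar>RL_integral (\<alpha> - \<beta> i) h t\<bar> \<le> N * r i" if "i \<le> 2" for i
  proof -
    have "\<bar>RL_integral (\<alpha> - \<beta> i) h t\<bar> \<le> N * (t powr (\<alpha> - \<beta> i - \<tau>) / Gamma (\<alpha> - \<beta> i) * ((1 - \<tau>) / (\<alpha> - \<beta> i - \<tau>)) powr (1 - \<tau>))"
      by (rule R[OF \<tau>i[OF that] t])
    also have "\<dots> \<le> N * r i"
      unfolding r_def using N t \<tau>i[OF that] Gamma_real_pos[OF order_pos[OF that]]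
      by (intro mult_left_mono mult_right_mono divide_right_mono powr_mono2) auto
    finally show ?thesis .
  qed
  have l: "load h G i \<le> N * F i + g i" if "i \<le> 2" for i
  proof -
    have "load h G i \<le> N * F i + \<bar>G i\<bar>"
      unfolding F_def by (rule load_Hoelder_bound[OF that \<tau>i[OF that]]) (rule R)
    with G[OF that] show ?thesis by simp
  qed
  have "(\<Sum>i=0..2. rho T \<eta> a b \<beta> i * load h G i) \<le> (\<Sum>i=0..2. rho T \<eta> a b \<beta> i * (N * F i + g i))"
    "(\<Sum>i=1..2. rho_tilde T \<eta> a b \<beta> i * load h G i) \<le> (\<Sum>i=1..2. rho_tilde T \<eta> a b \<beta> i * (N * F i + g i))"
    "rho_hat T \<eta> a b \<beta> 2 * load h G 2 \<le> rho_hat T \<eta> a b \<beta> 2 * (N * F 2 + g 2)"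
    by (intro sum_mono mult_left_mono l rho_nonneg; simp)+
  with abs_U[OF t, of h G] abs_V[OF t, of h G] abs_W[OF t, of h G] r[of 0] r[of 1] r[of 2]
  have "\<bar>U h G t\<bar> + \<bar>V h G t\<bar> + \<bar>W h G t\<bar> \<le> N * r 0 + N * r 1 + N * r 2 +
      (\<Sum>i=0..2. rho T \<eta> a b \<beta> i * (N * F i + g i)) + (\<Sum>i=1..2. rho_tilde T \<eta> a b \<beta> i * (N * F i + g i)) +
      rho_hat T \<eta> a b \<beta> 2 * (N * F 2 + g 2)"
    unfolding \<beta>0 by simp
  also have "\<dots> = N * (Delta0 T \<eta> \<alpha> \<tau> a b \<beta> + Delta1 T \<eta> \<alpha> \<tau> a b \<beta> + Delta2 T \<eta> \<alpha> \<tau> a b \<beta>) +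
    (\<Sum>i=0..2. (rho T \<eta> a b \<beta> i + rho_tilde T \<eta> a b \<beta> i + rho_hat T \<eta> a b \<beta> i) * g i)"
  proof -
    have z: "rho_tilde T \<eta> a b \<beta> 0 = 0" "rho_hat T \<eta> a b \<beta> 0 = 0" "rho_hat T \<eta> a b \<beta> 1 = 0"
      by (auto simp: rho_tilde_def rho_hat_def Let_def)
    have D: "Delta0 T \<eta> \<alpha> \<tau> a b \<beta> = r 0 + (\<Sum>i=0..2. rho T \<eta> a b \<beta> i * F i)"
      "Delta1 T \<eta> \<alpha> \<tau> a b \<beta> = r 1 + (\<Sum>i=1..2. rho_tilde T \<eta> a b \<beta> i * F i)"
      "Delta2 T \<eta> \<alpha> \<tau> a b \<beta> = r 2 + rho_hat T \<eta> a b \<beta> 2 * F 2"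
      by (simp_all add: Delta0_def Delta1_def Delta2_def r_def F_def \<beta>0)
    have S0: "(\<Sum>i=0..2. v i) = v 0 + v 1 + v 2" and S1: "(\<Sum>i=1..2. v i) = v 1 + v 2" for v :: "nat \<Rightarrow> real"
      by (simp_all add: numeral_2_eq_2)
    show ?thesis unfolding D S0 S1 by (simp add: z z(3)[unfolded One_nat_def] algebra_simps)
  qed
  finally show ?thesis .
qed

text \<open>
The coefficients \<open>k1\<close> and \<open>k2\<close> stay bounded when \<open>h\<close> and \<open>G\<close> are bounded by \<open>M\<close>.
\<close>

lemma UVW_equicontinuous:
  assumes "0 < e"
  obtains d where "d > 0" and
    "\<And>h G s t. \<lbrakk>continuous_on {0..T} h; \<forall>r\<in>{0..T}. \<bar>h r\<bar> \<le> M; \<forall>i\<le>2. \<bar>G i\<bar> \<le> M;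
        s \<in> {0..T}; t \<in> {0..T}; \<bar>s - t\<bar> < d\<rbrakk> \<Longrightarrow> \<bar>U h G s - U h G t\<bar> \<le> e"
    "\<And>h G s t. \<lbrakk>continuous_on {0..T} h; \<forall>r\<in>{0..T}. \<bar>h r\<bar> \<le> M; \<forall>i\<le>2. \<bar>G i\<bar> \<le> M;
        s \<in> {0..T}; t \<in> {0..T}; \<bar>s - t\<bar> < d\<rbrakk> \<Longrightarrow> \<bar>V h G s - V h G t\<bar> \<le> e"
    "\<And>h G s t. \<lbrakk>continuous_on {0..T} h; \<forall>r\<in>{0..T}. \<bar>h r\<bar> \<le> M; \<forall>i\<le>2. \<bar>G i\<bar> \<le> M;
        s \<in> {0..T}; t \<in> {0..T}; \<bar>s - t\<bar> < d\<rbrakk> \<Longrightarrow> \<bar>W h G s - W h G t\<bar> \<le> e"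
proof -
  define L where "L = (\<lambda>i. ((\<bar>a i\<bar> + \<bar>b i\<bar>) * (T powr (\<alpha> - \<beta> i) / Gamma (\<alpha> - \<beta> i + 1)) + 1) * M)"
  define C1 where "C1 = \<bar>\<nu>1\<bar> * L 1 + \<bar>\<nu>1\<bar> * \<bar>\<mu>2\<bar> / \<bar>\<mu>1\<bar> * L 2"
  define C2 where "C2 = \<bar>\<mu>2\<bar> * L 2"
  define C where "C = max C1 C2"
  have C: "\<bar>k1 h G\<bar> \<le> C" "\<bar>k2 h G\<bar> \<le> C"
    if hG: "continuous_on {0..T} h" "\<forall>r\<in>{0..T}. \<bar>h r\<bar> \<le> M" "\<forall>i\<le>2. \<bar>G i\<bar> \<le> M" for h G
  proof -
    have l: "load h G i \<le> L i" if "i \<le> 2" for i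
      unfolding L_def by (rule load_sup_bound) (use hG that in auto)
    have "\<bar>\<nu>1\<bar> * load h G 1 + \<bar>\<nu>1\<bar> * \<bar>\<mu>2\<bar> / \<bar>\<mu>1\<bar> * load h G 2 \<le> C1"
      unfolding C1_def by (intro add_mono mult_left_mono l) auto
    with abs_k1[of h G] show "\<bar>k1 h G\<bar> \<le> C" unfolding C_def by linarith
    have "\<bar>\<mu>2\<bar> * load h G 2 \<le> C2"
      unfolding C2_def by (intro mult_left_mono l) auto
    with abs_k2[of h G] show "\<bar>k2 h G\<bar> \<le> C" unfolding C_def by linarith
  qed
  define p where "p = (\<lambda>t. frac_mono (1 - \<beta> 1) t / Gamma (2 - \<beta> 1))"
  define q where "q = (\<lambda>t. 2 * frac_mono (2 - \<beta> 1) t / Gamma (3 - \<beta> 1))"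
  define r where "r = (\<lambda>t. 2 * frac_mono (2 - \<beta> 2) t / Gamma (3 - \<beta> 2))"
  have cont: "continuous_on {0..T} p" "continuous_on {0..T} q" "continuous_on {0..T} r"
    unfolding p_def q_def r_def using \<beta>1 \<beta>2
    by (auto simp only: divide_inverse intro!: continuous_on_mult continuous_on_const continuous_on_frac_mono)
  have V: "V h G t = RL_integral (\<alpha> - \<beta> 1) h t - 0 - k1 h G * p t - k2 h G * q t" for h G t
    by (simp add: V_def p_def q_def)
  have W: "W h G t = RL_integral (\<alpha> - \<beta> 2) h t - 0 - k1 h G * 0 - k2 h G * r t" for h G t
    by (simp add: W_def r_def)
  have U: "U h G t = RL_integral \<alpha> h t - k0 h G - k1 h G * t - k2 h G * t\<^sup>2" for h G t
    by (simp add: U_def)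
  have "\<alpha> > 0" using \<alpha> by simp
  obtain d1 where d1: "d1 > 0" "\<And>h c0 c1 c2 s t. \<lbrakk>continuous_on {0..T} h; \<forall>r\<in>{0..T}. \<bar>h r\<bar> \<le> M; \<bar>c1\<bar> \<le> C; \<bar>c2\<bar> \<le> C;
        s \<in> {0..T}; t \<in> {0..T}; \<bar>s - t\<bar> < d1\<rbrakk> \<Longrightarrow>
      \<bar>(RL_integral \<alpha> h s - c0 - c1 * s - c2 * s\<^sup>2) - (RL_integral \<alpha> h t - c0 - c1 * t - c2 * t\<^sup>2)\<bar> \<le> e"
    by (rule RL_integral_affine_equicontinuous[OF \<open>\<alpha> > 0\<close> assms, of T "\<lambda>t. t" "\<lambda>t. t\<^sup>2" M C])
      (auto intro!: continuous_intros)
  obtain d2 where d2: "d2 > 0" "\<And>h c0 c1 c2 s t. \<lbrakk>continuous_on {0..T} h; \<forall>r\<in>{0..T}. \<bar>h r\<bar> \<le> M; \<bar>c1\<bar> \<le> C; \<bar>c2\<bar> \<le> C;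
        s \<in> {0..T}; t \<in> {0..T}; \<bar>s - t\<bar> < d2\<rbrakk> \<Longrightarrow>
      \<bar>(RL_integral (\<alpha> - \<beta> 1) h s - c0 - c1 * p s - c2 * q s) - (RL_integral (\<alpha> - \<beta> 1) h t - c0 - c1 * p t - c2 * q t)\<bar> \<le> e"
    by (rule RL_integral_affine_equicontinuous[OF order_pos[of 1] assms cont(1,2), of M C]) auto
  obtain d3 where d3: "d3 > 0" "\<And>h c0 c1 c2 s t. \<lbrakk>continuous_on {0..T} h; \<forall>r\<in>{0..T}. \<bar>h r\<bar> \<le> M; \<bar>c1\<bar> \<le> C; \<bar>c2\<bar> \<le> C;
        s \<in> {0..T}; t \<in> {0..T}; \<bar>s - t\<bar> < d3\<rbrakk> \<Longrightarrow>
      \<bar>(RL_integral (\<alpha> - \<beta> 2) h s - c0 - c1 * 0 - c2 * r s) - (RL_integral (\<alpha> - \<beta> 2) h t - c0 - c1 * 0 - c2 * r t)\<bar> \<le> e"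
    by (rule RL_integral_affine_equicontinuous[OF order_pos[of 2] assms continuous_on_const cont(3), of M C 0]) auto
  show thesis
  proof (rule that[of "min d1 (min d2 d3)"])
    show "min d1 (min d2 d3) > 0" using d1(1) d2(1) d3(1) by simp
    fix h s t and G :: "nat \<Rightarrow> real"
    assume h: "continuous_on {0..T} h" "\<forall>r\<in>{0..T}. \<bar>h r\<bar> \<le> M" "\<forall>i\<le>2. \<bar>G i\<bar> \<le> M"
      and st: "s \<in> {0..T}" "t \<in> {0..T}" "\<bar>s - t\<bar> < min d1 (min d2 d3)"
    note k = C[OF h]
    show "\<bar>U h G s - U h G t\<bar> \<le> e" unfolding U by (rule d1(2)[OF h(1,2) k st(1,2)]) (use st(3) in simp)
    show "\<bar>V h G s - V h G t\<bar> \<le> e" unfolding V by (rule d2(2)[OF h(1,2) k st(1,2)]) (use st(3) in simp)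
    show "\<bar>W h G s - W h G t\<bar> \<le> e" unfolding W by (rule d3(2)[OF h(1,2) k st(1,2)]) (use st(3) in simp)
  qed
qed

end

section \<open>The nonlinear problem\<close>

lemma norm_triple_le:
  fixes x :: "real \<times> real \<times> real"
  shows "norm x \<le> \<bar>fst x\<bar> + \<bar>fst (snd x)\<bar> + \<bar>snd (snd x)\<bar>"
  using norm_Pair_le[of "fst x" "snd x"] norm_Pair_le[of "fst (snd x)" "snd (snd x)"] by simp

text \<open>
This norm on triples is the one in which the growth condition on \<open>f\<close> and the final estimate are formulated.
\<close>

lemma compact_convex_l1_ball3:
  "compact {(u, v, w). \<bar>u\<bar> + \<bar>v\<bar> + \<bar>w\<bar> \<le> (K :: real)}" "convex {(u, v, w). \<bar>u\<bar> + \<bar>v\<bar> + \<bar>w\<bar> \<le> (K :: real)}"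
proof -
  define N where "N = (\<lambda>x :: real \<times> real \<times> real. \<bar>fst x\<bar> + \<bar>fst (snd x)\<bar> + \<bar>snd (snd x)\<bar>)"
  have B: "{(u, v, w). \<bar>u\<bar> + \<bar>v\<bar> + \<bar>w\<bar> \<le> K} = {x. N x \<le> K}" by (auto simp: N_def)
  have "norm x \<le> N x" for x
    unfolding N_def by (rule norm_triple_le)
  then have "bounded {x. N x \<le> K}" unfolding bounded_iff by (meson mem_Collect_eq order_trans)
  moreover have "closed {x. N x \<le> K}"
    unfolding N_def by (intro closed_Collect_le continuous_intros)
  ultimately show "compact {(u, v, w). \<bar>u\<bar> + \<bar>v\<bar> + \<bar>w\<bar> \<le> K}"
    unfolding B by (simp add: compact_eq_bounded_closed)
  have "N (s *\<^sub>R x + t *\<^sub>R y) \<le> K" if "N x \<le> K" "N y \<le> K" "0 \<le> s" "0 \<le> t" "s + t = 1" for s t x y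
  proof -
    have *: "\<bar>s * x + t * y\<bar> \<le> s * \<bar>x\<bar> + t * \<bar>y\<bar>" for x y
      using that(3,4) by (intro order.trans[OF abs_triangle_ineq]) (simp add: abs_mult)
    have "N (s *\<^sub>R x + t *\<^sub>R y) \<le> s * N x + t * N y"
      using *[of "fst x" "fst y"] *[of "fst (snd x)" "fst (snd y)"] *[of "snd (snd x)" "snd (snd y)"]
      unfolding N_def by (simp add: distrib_left)
    also have "\<dots> \<le> s * K + t * K" using that by (intro add_mono mult_left_mono)
    also have "\<dots> = K" using that(5) by (metis distrib_right mult_1)
    finally show ?thesis .
  qed
  then show "convex {(u, v, w). \<bar>u\<bar> + \<bar>v\<bar> + \<bar>w\<bar> \<le> K}"
    unfolding B convex_def by blast
qed

text \<open>
For substitution operators: applying \<open>F\<close> pointwise is uniformly continuous for the supremum norm.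
\<close>

lemma uniformly_continuous_in_second_argument:
  fixes F :: "'a::metric_space \<times> 'b::real_normed_vector \<Rightarrow> real"
  assumes "compact A" "compact B" "continuous_on (A \<times> B) F" "0 < e"
  obtains d where "d > 0" "\<And>t x y. \<lbrakk>t \<in> A; x \<in> B; y \<in> B; norm (x - y) < d\<rbrakk> \<Longrightarrow> \<bar>F (t, x) - F (t, y)\<bar> \<le> e"
proof -
  have "uniformly_continuous_on (A \<times> B) F"
    using assms by (intro compact_uniformly_continuous compact_Times)
  then obtain d where d: "d > 0" "\<And>p q. \<lbrakk>p \<in> A \<times> B; q \<in> A \<times> B; dist q p < d\<rbrakk> \<Longrightarrow> dist (F q) (F p) < e"
    using assms(4) unfolding uniformly_continuous_on_def by blast
  show thesis
  proof (rule that[OF d(1)])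
    fix t x y assume "t \<in> A" "x \<in> B" "y \<in> B" "norm (x - y) < d"
    then have "dist (F (t, x)) (F (t, y)) < e" by (intro d(2)) (auto simp: dist_Pair_Pair dist_norm)
    then show "\<bar>F (t, x) - F (t, y)\<bar> \<le> e" by (simp add: dist_real_def)
  qed
qed

lemma abs_integral_diff_le:
  fixes k k' :: "real \<Rightarrow> real"
  assumes "continuous_on {0..T} k" "continuous_on {0..T} k'" "0 \<le> T" "\<And>s. s \<in> {0..T} \<Longrightarrow> \<bar>k s - k' s\<bar> \<le> e"
  shows "\<bar>integral {0..T} k - integral {0..T} k'\<bar> \<le> T * e"
proof -
  have "norm (integral {0..T} (\<lambda>s. k s - k' s)) \<le> integral {0..T} (\<lambda>s. e)"
    using assms by (intro integral_norm_bound_integral integrable_continuous_real continuous_intros) auto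
  also have "\<dots> = T * e" using assms(3) by simp
  also have "integral {0..T} (\<lambda>s. k s - k' s) = integral {0..T} k - integral {0..T} k'"
    using assms by (intro integral_diff integrable_continuous_real)
  finally show ?thesis by simp
qed

text \<open>
The operator \<open>\<Phi>\<close> sends \<open>y\<close> to the solution, with its two Caputo derivatives, of the linear problem whose data \<open>H y\<close> and
\<open>G y\<close> are frozen along \<open>y\<close>. It remains to check the hypotheses of Schauder's theorem and to read off the
solution from the fixed point.
\<close>

theorem theorem10:
  fixes T \<eta> \<alpha> \<tau> K :: real
    and a b lam \<beta> :: "nat \<Rightarrow> real"
    and f :: "real \<Rightarrow> real \<Rightarrow> real \<Rightarrow> real \<Rightarrow> real"
    and g :: "nat \<Rightarrow> real \<Rightarrow> real \<Rightarrow> real"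
    and \<phi> l_f :: "real \<Rightarrow> real"
    and \<psi> l_g :: "nat \<Rightarrow> real \<Rightarrow> real"
  assumes "0 < T" and "0 < \<eta>" and "\<eta> < T"
    and "2 < \<alpha>" and "\<alpha> \<le> 3"
    and "\<beta> 0 = 0" and "0 < \<beta> 1" and "\<beta> 1 \<le> 1" and "1 < \<beta> 2" and "\<beta> 2 \<le> 2"
    and "a 0 + b 0 \<noteq> 0"
    and "a 1 * \<eta> powr (1 - \<beta> 1) + b 1 * T powr (1 - \<beta> 1) \<noteq> 0"
    and "\<forall>i\<in>{1,2}. a i * \<eta> powr (2 - \<beta> i) + b i * T powr (2 - \<beta> i) \<noteq> 0"
    and "continuous_on ({0..T} \<times> UNIV) (\<lambda>(t, u, v, w). f t u v w)"
    and "\<forall>i\<in>{0,1,2}. continuous_on ({0..T} \<times> UNIV) (\<lambda>(t, u). g i t u)"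
    and "mono_on {0..} \<phi>" and "\<forall>x\<ge>0. 0 \<le> \<phi> x"
    and "\<forall>i\<in>{0,1,2}. mono_on {0..} (\<psi> i) \<and> (\<forall>x\<ge>0. 0 \<le> \<psi> i x)"
    and "0 < \<tau>" and "\<tau> < min 1 (\<alpha> - \<beta> 2)"
    and "l_f \<in> Lp_nonneg (1 / \<tau>) T"
    and "\<forall>i\<in>{0,1,2}. l_g i \<in> Lp_nonneg 1 T"
    and "\<forall>t\<in>{0..T}. \<forall>u v w. \<bar>f t u v w\<bar> \<le> l_f t * \<phi> (\<bar>u\<bar> + \<bar>v\<bar> + \<bar>w\<bar>)"
    and "\<forall>i\<in>{0,1,2}. \<forall>t\<in>{0..T}. \<forall>u. \<bar>g i t u\<bar> \<le> l_g i t * \<psi> i \<bar>u\<bar>"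
    and "0 < K"
    and "K / (\<phi> K * Lp_norm (1 / \<tau>) T l_f *
                (Delta0 T \<eta> \<alpha> \<tau> a b \<beta> + Delta1 T \<eta> \<alpha> \<tau> a b \<beta> + Delta2 T \<eta> \<alpha> \<tau> a b \<beta>) +
              (\<Sum>i=0..2. (rho T \<eta> a b \<beta> i + rho_tilde T \<eta> a b \<beta> i + rho_hat T \<eta> a b \<beta> i) *
                 \<bar>lam i\<bar> * \<psi> i K * Lp_norm 1 T (l_g i))) > 1"
  shows "\<exists>u :: real \<Rightarrow> real.
    C_k_on 2 {0..T} u \<and>
    caputo_equation T \<alpha> u (\<lambda>t. f t (u t) (caputo T (\<beta> 1) u t) (caputo T (\<beta> 2) u t)) \<and>
    a 0 * u 0 + b 0 * u T = lam 0 * integral {0..T} (\<lambda>s. g 0 s (u s)) \<and>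
    a 1 * caputo T (\<beta> 1) u \<eta> + b 1 * caputo T (\<beta> 1) u T = lam 1 * integral {0..T} (\<lambda>s. g 1 s (u s)) \<and>
    a 2 * caputo T (\<beta> 2) u \<eta> + b 2 * caputo T (\<beta> 2) u T = lam 2 * integral {0..T} (\<lambda>s. g 2 s (u s))"
proof -
  interpret fractional_bvp T \<eta> \<alpha> a b \<beta>
    using assms(1-13) by unfold_locales auto
  define B where "B = {(u, v, w). \<bar>u\<bar> + \<bar>v\<bar> + \<bar>w\<bar> \<le> K}"
  define Y where "Y = {y. continuous_on {0..T} y \<and> y ` {0..T} \<subseteq> B}"
  define F where "F = (\<lambda>(t, u, v, w). f t u v w)"
  define H where "H = (\<lambda>y t. F (t, y t))"
  define G where "G = (\<lambda>(y :: real \<Rightarrow> real \<times> real \<times> real) i. lam i * integral {0..T} (\<lambda>s. g i s (fst (y s))))"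
  define \<Phi> where "\<Phi> = (\<lambda>y t. (U (H y) (G y) t, V (H y) (G y) t, W (H y) (G y) t))"
  have contF: "continuous_on ({0..T} \<times> UNIV) F" using assms(14) by (simp add: F_def)
  have contg: "continuous_on ({0..T} \<times> UNIV) (\<lambda>(t, u). g i t u)" if "i \<le> 2" for i
    using assms(15) that by (auto simp: le_Suc_eq numeral_2_eq_2)
  have \<psi>: "mono_on {0..} (\<psi> i)" "l_g i \<in> Lp_nonneg 1 T"
    "\<And>t u. t \<in> {0..T} \<Longrightarrow> \<bar>g i t u\<bar> \<le> l_g i t * \<psi> i \<bar>u\<bar>" if "i \<le> 2" for i
    using assms(18,22,24) that by (auto simp: le_Suc_eq numeral_2_eq_2)
  have l_f: "0 \<le> l_f t" if "t \<in> {0..T}" for t using assms(21) that by (auto simp: Lp_nonneg_def)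
  have l_g: "0 \<le> l_g i t" if "t \<in> {0..T}" "i \<le> 2" for i t using \<psi>(2)[OF that(2)] that by (auto simp: Lp_nonneg_def)
  have YB: "y t \<in> B" if "y \<in> Y" "t \<in> {0..T}" for y t using that by (auto simp: Y_def)
  have contY: "continuous_on {0..T} y" if "y \<in> Y" for y using that by (simp add: Y_def)
  have contH: "continuous_on {0..T} (H y)" if "y \<in> Y" for y
    unfolding H_def
    by (rule continuous_on_compose2[OF contF]) (use contY[OF that] in \<open>auto intro!: continuous_intros\<close>)
  have contG: "continuous_on {0..T} (\<lambda>s. g i s (fst (y s)))" if "y \<in> Y" "i \<le> 2" for y i
  proof -
    have "continuous_on {0..T} (\<lambda>s. (s, fst (y s)))" by (intro continuous_intros contY that)
    from continuous_on_compose2[OF contg[OF that(2)] this] show ?thesis by force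
  qed
  have fstB: "\<bar>fst x\<bar> \<le> K" if "x \<in> B" for x using that by (auto simp: B_def)
  have H_le: "\<bar>H y s\<bar> \<le> l_f s * \<phi> K" if "y \<in> Y" "s \<in> {0..T}" for y s
  proof -
    obtain u v w where y: "y s = (u, v, w)" by (cases "y s")
    then have "\<bar>u\<bar> + \<bar>v\<bar> + \<bar>w\<bar> \<le> K" using YB[OF that] by (simp add: B_def)
    then have "\<phi> (\<bar>u\<bar> + \<bar>v\<bar> + \<bar>w\<bar>) \<le> \<phi> K"
      using assms(25) by (intro mono_onD[OF assms(16)]) auto
    then have "l_f s * \<phi> (\<bar>u\<bar> + \<bar>v\<bar> + \<bar>w\<bar>) \<le> l_f s * \<phi> K" by (intro mult_left_mono l_f that)
    moreover have "\<bar>f s u v w\<bar> \<le> l_f s * \<phi> (\<bar>u\<bar> + \<bar>v\<bar> + \<bar>w\<bar>)" using assms(23) that by blast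
    ultimately show ?thesis by (simp add: H_def F_def y)
  qed
  have G_le: "\<bar>G y i\<bar> \<le> \<bar>lam i\<bar> * (\<psi> i K * Lp_norm 1 T (l_g i))" if "y \<in> Y" "i \<le> 2" for y i
  proof -
    have "\<bar>g i s (fst (y s))\<bar> \<le> l_g i s * \<psi> i K" if s: "s \<in> {0..T}" for s
    proof -
      have "\<psi> i \<bar>fst (y s)\<bar> \<le> \<psi> i K"
        using assms(25) fstB[OF YB[OF \<open>y \<in> Y\<close> s]] by (intro mono_onD[OF \<psi>(1)[OF \<open>i \<le> 2\<close>]]) auto
      then have "l_g i s * \<psi> i \<bar>fst (y s)\<bar> \<le> l_g i s * \<psi> i K"
        by (intro mult_left_mono l_g s \<open>i \<le> 2\<close>)
      with \<psi>(3)[OF \<open>i \<le> 2\<close> s, of "fst (y s)"] show ?thesis by linarith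
    qed
    then have "\<bar>integral {0..T} (\<lambda>s. g i s (fst (y s)))\<bar> \<le> \<psi> i K * Lp_norm 1 T (l_g i)"
      by (rule abs_integral_le_Lp_norm_1[OF \<psi>(2)[OF that(2)] contG[OF that]])
    then show ?thesis unfolding G_def abs_mult by (intro mult_left_mono) auto
  qed
  define N where "N = \<phi> K * Lp_norm (1 / \<tau>) T l_f"
  have \<phi>K: "0 \<le> \<phi> K" using assms(17,25) by simp
  then have N: "0 \<le> N" by (simp add: N_def Lp_norm_def)
  have RL: "\<bar>RL_integral \<gamma> (H y) t\<bar> \<le> N * (t powr (\<gamma> - \<tau>) / Gamma \<gamma> * ((1 - \<tau>) / (\<gamma> - \<tau>)) powr (1 - \<tau>))"
    if "y \<in> Y" "\<tau> < \<gamma>" "t \<in> {0..T}" for y \<gamma> t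
    unfolding N_def
    by (rule RL_integral_Hoelder_bound[OF assms(19) _ that(2) _ _ assms(21) continuous_on_subinterval[OF contH[OF that(1)] that(3)] \<phi>K H_le[OF that(1)]])
      (use that(3) assms(20) in auto)
  \<comment> \<open>\<open>D\<close> is the denominator in the assumption on \<open>K\<close>.\<close>
  define D where "D = N * (Delta0 T \<eta> \<alpha> \<tau> a b \<beta> + Delta1 T \<eta> \<alpha> \<tau> a b \<beta> + Delta2 T \<eta> \<alpha> \<tau> a b \<beta>) +
    (\<Sum>i=0..2. (rho T \<eta> a b \<beta> i + rho_tilde T \<eta> a b \<beta> i + rho_hat T \<eta> a b \<beta> i) * (\<bar>lam i\<bar> * (\<psi> i K * Lp_norm 1 T (l_g i))))"
  have "K / D > 1" using assms(26) by (simp add: D_def N_def mult.assoc)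
  \<comment> \<open>A quotient with denominator \<open>D \<le> 0\<close> would not be positive, in particular because \<open>K / 0 = 0\<close>.\<close>
  then have DK: "D < K" using assms(25)
    by (cases "D > 0") (auto simp: divide_simps not_less split: if_splits)
  have self: "\<Phi> y t \<in> B" if "y \<in> Y" "t \<in> {0..T}" for y t
  proof -
    have "\<bar>U (H y) (G y) t\<bar> + \<bar>V (H y) (G y) t\<bar> + \<bar>W (H y) (G y) t\<bar> \<le> D"
      unfolding D_def
      by (rule a_priori_bound[OF assms(19) _ that(2) N RL[OF that(1)] G_le[OF that(1)]]) (use assms(20) in auto)
    with DK show ?thesis by (simp add: \<Phi>_def B_def)
  qed
  have compB: "compact B" and convB: "convex B" unfolding B_def by (rule compact_convex_l1_ball3)+
  have norm3: "norm (x - y) \<le> \<bar>fst x - fst y\<bar> + \<bar>fst (snd x) - fst (snd y)\<bar> + \<bar>snd (snd x) - snd (snd y)\<bar>"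
    for x y :: "real \<times> real \<times> real"
    using norm_triple_le[of "x - y"] by simp
  have contFB: "continuous_on ({0..T} \<times> B) F" using contF by (rule continuous_on_subset) auto
  have "bounded (F ` ({0..T} \<times> B))"
    by (intro compact_imp_bounded compact_continuous_image contFB compact_Times compB) auto
  then obtain M0 where M0: "\<And>t x. \<lbrakk>t \<in> {0..T}; x \<in> B\<rbrakk> \<Longrightarrow> \<bar>F (t, x)\<bar> \<le> M0"
    unfolding bounded_iff by (metis SigmaI imageI real_norm_def)
  \<comment> \<open>For equicontinuity a crude bound on the data suffices, common to all \<open>y\<close> in \<open>Y\<close>.\<close>
  define M where "M = \<bar>M0\<bar> + (\<Sum>i=0..2. \<bar>\<bar>lam i\<bar> * (\<psi> i K * Lp_norm 1 T (l_g i))\<bar>)"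
  have HM: "\<forall>r\<in>{0..T}. \<bar>H y r\<bar> \<le> M" if "y \<in> Y" for y
  proof
    fix r assume r: "r \<in> {0..T}"
    have "\<bar>H y r\<bar> \<le> M0" unfolding H_def by (rule M0[OF r YB[OF that r]])
    moreover have "0 \<le> (\<Sum>i=0..2. \<bar>\<bar>lam i\<bar> * (\<psi> i K * Lp_norm 1 T (l_g i))\<bar>)" by (rule sum_nonneg) simp
    ultimately show "\<bar>H y r\<bar> \<le> M" unfolding M_def by linarith
  qed
  have GM: "\<forall>i\<le>2. \<bar>G y i\<bar> \<le> M" if "y \<in> Y" for y
  proof (intro allI impI)
    fix i :: nat assume i: "i \<le> 2"
    have "\<bar>\<bar>lam i\<bar> * (\<psi> i K * Lp_norm 1 T (l_g i))\<bar> \<le> (\<Sum>i=0..2. \<bar>\<bar>lam i\<bar> * (\<psi> i K * Lp_norm 1 T (l_g i))\<bar>)"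
      by (rule member_le_sum[where f = "\<lambda>i. \<bar>\<bar>lam i\<bar> * (\<psi> i K * Lp_norm 1 T (l_g i))\<bar>"]) (use i in auto)
    with G_le[OF that i] show "\<bar>G y i\<bar> \<le> M" unfolding M_def by linarith
  qed
  obtain y where y: "y \<in> Y" and fp: "\<And>t. t \<in> {0..T} \<Longrightarrow> \<Phi> y t = y t"
  proof (rule schauder_fixpoint_interval[of 0 T B Y \<Phi>])
    show "0 \<le> T" using T by simp
    show "compact B" "convex B" by fact+
    have "(0, 0, 0) \<in> B" using assms(25) by (simp add: B_def)
    then show "B \<noteq> {}" by blast
    show "Y = {y. continuous_on {0..T} y \<and> y ` {0..T} \<subseteq> B}" by (rule Y_def)
    show "\<Phi> y t \<in> B" if "y \<in> Y" "t \<in> {0..T}" for y t by (rule self[OF that])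
  next
    fix e :: real assume "e > 0"
    then have "e / 3 > 0" by simp
    then obtain d where d: "d > 0"
      "\<And>h G s t. \<lbrakk>continuous_on {0..T} h; \<forall>r\<in>{0..T}. \<bar>h r\<bar> \<le> M; \<forall>i\<le>2. \<bar>G i\<bar> \<le> M;
        s \<in> {0..T}; t \<in> {0..T}; \<bar>s - t\<bar> < d\<rbrakk> \<Longrightarrow> \<bar>U h G s - U h G t\<bar> \<le> e / 3"
      "\<And>h G s t. \<lbrakk>continuous_on {0..T} h; \<forall>r\<in>{0..T}. \<bar>h r\<bar> \<le> M; \<forall>i\<le>2. \<bar>G i\<bar> \<le> M;
        s \<in> {0..T}; t \<in> {0..T}; \<bar>s - t\<bar> < d\<rbrakk> \<Longrightarrow> \<bar>V h G s - V h G t\<bar> \<le> e / 3"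
      "\<And>h G s t. \<lbrakk>continuous_on {0..T} h; \<forall>r\<in>{0..T}. \<bar>h r\<bar> \<le> M; \<forall>i\<le>2. \<bar>G i\<bar> \<le> M;
        s \<in> {0..T}; t \<in> {0..T}; \<bar>s - t\<bar> < d\<rbrakk> \<Longrightarrow> \<bar>W h G s - W h G t\<bar> \<le> e / 3"
      by (rule UVW_equicontinuous[where M = M]) blast
    have "norm (\<Phi> y s - \<Phi> y t) \<le> e" if y: "y \<in> Y" and st: "s \<in> {0..T}" "t \<in> {0..T}" "\<bar>s - t\<bar> < d" for y s t
      using d(2-4)[OF contH[OF y] HM[OF y] GM[OF y] st] norm3[of "\<Phi> y s" "\<Phi> y t"] by (simp add: \<Phi>_def)
    with d(1) show "\<exists>d>0. \<forall>y\<in>Y. \<forall>s\<in>{0..T}. \<forall>t\<in>{0..T}. \<bar>s - t\<bar> < d \<longrightarrow> norm (\<Phi> y s - \<Phi> y t) \<le> e"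
      by blast
  next
    fix e :: real assume "e > 0"
    obtain C where C: "C \<ge> 0"
      "\<And>h G M t. \<lbrakk>continuous_on {0..T} h; \<And>s. s \<in> {0..T} \<Longrightarrow> \<bar>h s\<bar> \<le> M; \<And>i. i \<le> 2 \<Longrightarrow> \<bar>G i\<bar> \<le> M; t \<in> {0..T}\<rbrakk> \<Longrightarrow>
        \<bar>U h G t\<bar> + \<bar>V h G t\<bar> + \<bar>W h G t\<bar> \<le> C * M"
      by (rule UVW_sup_bound) blast
    \<comment> \<open>Data that differ by \<open>\<epsilon>\<close> give solutions that differ by at most \<open>C * \<epsilon>\<close>.\<close>
    define \<epsilon> where "\<epsilon> = e / (C + 1)"
    have \<epsilon>: "\<epsilon> > 0" "C * \<epsilon> \<le> e" using C(1) \<open>e > 0\<close> by (auto simp: \<epsilon>_def field_simps)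
    obtain d where d: "d > 0" "\<And>t x y. \<lbrakk>t \<in> {0..T}; x \<in> B; y \<in> B; norm (x - y) < d\<rbrakk> \<Longrightarrow> \<bar>F (t, x) - F (t, y)\<bar> \<le> \<epsilon>"
      by (rule uniformly_continuous_in_second_argument[OF _ compB contFB \<epsilon>(1)]) auto
    have "\<exists>d>0. \<forall>t\<in>{0..T}. \<forall>u\<in>{-K..K}. \<forall>v\<in>{-K..K}. norm (u - v) < d \<longrightarrow> \<bar>lam i\<bar> * (T * \<bar>g i t u - g i t v\<bar>) \<le> \<epsilon>" if "i \<le> 2" for i
    proof -
      define \<epsilon>' where "\<epsilon>' = \<epsilon> / (\<bar>lam i\<bar> * T + 1)"
      have lT: "\<bar>lam i\<bar> * T \<ge> 0" using T by simp
      have \<epsilon>': "\<epsilon>' > 0" "\<bar>lam i\<bar> * T * \<epsilon>' \<le> \<epsilon>" using lT \<epsilon>(1) by (auto simp: \<epsilon>'_def field_simps)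
      have "continuous_on ({0..T} \<times> {-K..K}) (\<lambda>(t, u). g i t u)"
        using contg[OF that] by (rule continuous_on_subset) auto
      then obtain d where d: "d > 0" "\<And>t u v. \<lbrakk>t \<in> {0..T}; u \<in> {-K..K}; v \<in> {-K..K}; norm (u - v) < d\<rbrakk> \<Longrightarrow>
          \<bar>g i t u - g i t v\<bar> \<le> \<epsilon>'"
        using uniformly_continuous_in_second_argument[OF _ _ _ \<epsilon>'(1), of "{0..T}" "{-K..K}" "\<lambda>(t, u). g i t u"] by auto
      have "\<bar>lam i\<bar> * (T * \<bar>g i t u - g i t v\<bar>) \<le> \<epsilon>"
        if "t \<in> {0..T}" "u \<in> {-K..K}" "v \<in> {-K..K}" "norm (u - v) < d" for t u v
        using mult_left_mono[OF d(2)[OF that] lT] \<epsilon>'(2) by (simp add: mult.assoc)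
      with d(1) show ?thesis by blast
    qed
    then obtain dg where dg: "\<And>i. i \<le> 2 \<Longrightarrow> dg i > 0"
      "\<And>i t u v. \<lbrakk>i \<le> 2; t \<in> {0..T}; u \<in> {-K..K}; v \<in> {-K..K}; norm (u - v) < dg i\<rbrakk> \<Longrightarrow> \<bar>lam i\<bar> * (T * \<bar>g i t u - g i t v\<bar>) \<le> \<epsilon>"
      by metis
    define \<delta> where "\<delta> = Min (insert d (dg ` {..2}))"
    have "\<delta> > 0" unfolding \<delta>_def using d(1) dg(1) by (subst Min_gr_iff) auto
    moreover have "\<delta> \<le> d" unfolding \<delta>_def by (rule Min_le) auto
    moreover have "\<delta> \<le> dg i" if "i \<le> 2" for i unfolding \<delta>_def using that by (intro Min_le) auto
    ultimately have \<delta>: "\<delta> > 0" "\<delta> \<le> d" "\<And>i. i \<le> 2 \<Longrightarrow> \<delta> \<le> dg i" by blast+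
    have "norm (\<Phi> y t - \<Phi> z t) \<le> e"
      if yz: "y \<in> Y" "z \<in> Y" and close: "\<forall>t\<in>{0..T}. norm (y t - z t) < \<delta>" and t: "t \<in> {0..T}" for y z t
    proof -
      have h: "\<bar>H y s - H z s\<bar> \<le> \<epsilon>" if "s \<in> {0..T}" for s
        unfolding H_def using close that \<delta>(2) by (intro d(2) YB yz) fastforce+
      have g: "\<bar>G y i - G z i\<bar> \<le> \<epsilon>" if i: "i \<le> 2" for i
      proof (cases "lam i = 0")
        case False
        have "\<bar>g i s (fst (y s)) - g i s (fst (z s))\<bar> \<le> \<epsilon> / (\<bar>lam i\<bar> * T)" if s: "s \<in> {0..T}" for s
        proof -
          have "norm (fst (y s) - fst (z s)) \<le> norm (y s - z s)"
            unfolding fst_diff[symmetric] by (metis norm_fst_le prod.collapse)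
          also have "\<dots> < dg i" using close s \<delta>(3)[OF i] by fastforce
          finally have "\<bar>lam i\<bar> * (T * \<bar>g i s (fst (y s)) - g i s (fst (z s))\<bar>) \<le> \<epsilon>"
            using fstB[OF YB[OF yz(1) s]] fstB[OF YB[OF yz(2) s]] by (intro dg(2) i s) auto
          then show ?thesis using False T by (simp add: field_simps)
        qed
        then have "\<bar>integral {0..T} (\<lambda>s. g i s (fst (y s))) - integral {0..T} (\<lambda>s. g i s (fst (z s)))\<bar> \<le> T * (\<epsilon> / (\<bar>lam i\<bar> * T))"
          using T by (intro abs_integral_diff_le contG yz i) auto
        then have "\<bar>lam i\<bar> * \<bar>integral {0..T} (\<lambda>s. g i s (fst (y s))) - integral {0..T} (\<lambda>s. g i s (fst (z s)))\<bar> \<le> \<bar>lam i\<bar> * (T * (\<epsilon> / (\<bar>lam i\<bar> * T)))"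
          by (rule mult_left_mono) simp
        also have "\<dots> = \<epsilon>" using False T by simp
        finally show ?thesis unfolding G_def right_diff_distrib[symmetric] abs_mult .
      qed (use \<epsilon>(1) in \<open>simp add: G_def\<close>)
      have "\<bar>U (\<lambda>s. H y s - H z s) (\<lambda>i. G y i - G z i) t\<bar> + \<bar>V (\<lambda>s. H y s - H z s) (\<lambda>i. G y i - G z i) t\<bar> +
          \<bar>W (\<lambda>s. H y s - H z s) (\<lambda>i. G y i - G z i) t\<bar> \<le> C * \<epsilon>"
        by (rule C(2)[OF continuous_on_diff[OF contH[OF yz(1)] contH[OF yz(2)]] h g t])
      then have "\<bar>U (H y) (G y) t - U (H z) (G z) t\<bar> + \<bar>V (H y) (G y) t - V (H z) (G z) t\<bar> +
          \<bar>W (H y) (G y) t - W (H z) (G z) t\<bar> \<le> C * \<epsilon>"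
        unfolding UVW_diff[OF contH[OF yz(1)] contH[OF yz(2)] t] .
      with norm3[of "\<Phi> y t" "\<Phi> z t"] \<epsilon>(2) show ?thesis by (simp add: \<Phi>_def)
    qed
    with \<delta>(1) show "\<exists>d>0. \<forall>y\<in>Y. \<forall>z\<in>Y. (\<forall>t\<in>{0..T}. norm (y t - z t) < d) \<longrightarrow>
        (\<forall>t\<in>{0..T}. norm (\<Phi> y t - \<Phi> z t) \<le> e)" by blast
  qed (rule that)
  define u where "u = U (H y) (G y)"
  have cH: "continuous_on {0..T} (H y)" by (rule contH[OF y])
  \<comment> \<open>At a fixed point, the second and third component of \<open>y\<close> are the Caputo derivatives of the first.\<close>
  have y_eq: "y t = (u t, caputo T (\<beta> 1) u t, caputo T (\<beta> 2) u t)" if "t \<in> {0..T}" for t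
    using fp[OF that] caputo_U_1[OF cH that, of "G y"] caputo_U_2[OF cH that, of "G y"] by (simp add: \<Phi>_def u_def)
  have Hu: "H y t = f t (u t) (caputo T (\<beta> 1) u t) (caputo T (\<beta> 2) u t)" if "t \<in> {0..T}" for t
    by (simp add: H_def F_def y_eq[OF that])
  have Gu: "G y i = lam i * integral {0..T} (\<lambda>s. g i s (u s))" for i
    unfolding G_def by (intro arg_cong2[of _ _ _ _ "(*)"] refl integral_cong) (simp add: y_eq)
  have in_int: "0 \<in> {0..T}" "\<eta> \<in> {0..T}" "T \<in> {0..T}" using T \<eta> by auto
  show ?thesis
  proof (intro exI[of _ u] conjI)
    show "C_k_on 2 {0..T} u" unfolding u_def by (rule U_derivatives(1)[OF cH])
    show "caputo_equation T \<alpha> u (\<lambda>t. f t (u t) (caputo T (\<beta> 1) u t) (caputo T (\<beta> 2) u t))"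
      unfolding caputo_equation_def
    proof (intro conjI exI ballI)
      show "continuous_on {0..T} (\<lambda>t. f t (u t) (caputo T (\<beta> 1) u t) (caputo T (\<beta> 2) u t))"
        by (rule iffD1[OF continuous_on_cong[OF refl Hu] cH])
      fix t assume t: "t \<in> {0..T}"
      have "RL_integral \<alpha> (\<lambda>t. f t (u t) (caputo T (\<beta> 1) u t) (caputo T (\<beta> 2) u t)) t = RL_integral \<alpha> (H y) t"
        using t by (intro RL_integral_cong) (auto simp: Hu)
      then show "u t = RL_integral \<alpha> (\<lambda>t. f t (u t) (caputo T (\<beta> 1) u t) (caputo T (\<beta> 2) u t)) t -
          k0 (H y) (G y) - k1 (H y) (G y) * t - k2 (H y) (G y) * t\<^sup>2"
        by (simp add: u_def U_def)
    qed
    show "a 0 * u 0 + b 0 * u T = lam 0 * integral {0..T} (\<lambda>s. g 0 s (u s))"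
      unfolding Gu[symmetric] unfolding u_def by (rule boundary_0)
    show "a 1 * caputo T (\<beta> 1) u \<eta> + b 1 * caputo T (\<beta> 1) u T = lam 1 * integral {0..T} (\<lambda>s. g 1 s (u s))"
      unfolding Gu[symmetric] unfolding u_def caputo_U_1[OF cH in_int(2)] caputo_U_1[OF cH in_int(3)] by (rule boundary_1)
    show "a 2 * caputo T (\<beta> 2) u \<eta> + b 2 * caputo T (\<beta> 2) u T = lam 2 * integral {0..T} (\<lambda>s. g 2 s (u s))"
      unfolding Gu[symmetric] unfolding u_def caputo_U_2[OF cH in_int(2)] caputo_U_2[OF cH in_int(3)] by (rule boundary_2)
  qed
qed

end
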